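(* Fix $d \geq 1$. Then $$\mathcal{W}^{\max}\left(\overline{\mathbb{D}}^d\right) \subseteq 2\sqrt{d}\cdot\mathcal{W}^{\min}\left(\overline{\mathbb{D}}^d\right),$$ and this constant is optimal for all $d$ (that is, $2\sqrt{d}$ is the smallest $C>0$ with $\mathcal{W}^{\max}(\overline{\mathbb{D}}^d)\subseteq C\cdot\mathcal{W}^{\min}(\overline{\mathbb{D}}^d)$). Further, if $H$ is a Hilbert space and $(T_1, \ldots, T_d) \in \mathcal{B}(H)^d$ is a tuple of (not necessarily normal) contractions, then there exists a normal dilation $N = (N_1, \ldots, N_d)$ of $(T_1,\dots,T_d)$ such that $\|N_j\| \leq \min\{d, 2\sqrt{d}\}$ for all $j$.
   Context: $\overline{\mathbb{D}}$ is the closed unit disk in $\mathbb{C}$, and $\overline{\mathbb{D}}^d\subseteq\mathbb{C}^d$ is viewed as a subset of $\mathbb{R}^{2d}$ via real and imaginary parts of the coordinates. For $m\ge1$, $(M_n)^m_{sa}$ denotes $m$-tuples of self-adjoint complex $n\times n$ matrices. For an $m$-tuple $A$ of bounded operators on a Hilbert space, $\mathcal{W}_1(A)=\{(\varphi(A_1),\dots,\varphi(A_m)) : \varphi \text{ a state on the unital } C^*\text{-algebra generated by } A\}$. A tuple $N$ on $H_2$ is a dilation of a tuple $X$ on $H_1$ ($X\prec N$) if there is an isometry $V:H_1\to H_2$ with $X_i=V^*N_iV$ for all $i$. A normal tuple is a tuple of commuting normal bounded operators; $\sigma(N)$ is its joint spectrum; a normal dilation is a dilation that is a normal tuple. For a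 closed convex set $K\subseteq\mathbb{R}^m$: $\mathcal{W}^{\max}_n(K)=\{X\in(M_n)^m_{sa}:\mathcal{W}_1(X)\subseteq K\}$, $\mathcal{W}^{\min}_n(K)=\{X\in(M_n)^m_{sa}: \text{there is a normal tuple } N \text{ on some Hilbert space with } X\prec N,\ \sigma(N)\subseteq K\}$, $\mathcal{W}^{\max}(K)=\bigcup_n\mathcal{W}^{\max}_n(K)$, $\mathcal{W}^{\min}(K)=\bigcup_n\mathcal{W}^{\min}_n(K)$ (containment is levelwise). *)

theory Defs
  imports Complex_Main
    "Jordan_Normal_Form.VS_Connect"
    "Jordan_Normal_Form.Schur_Decomposition"
begin

section \<open>Complex Hilbert spaces with explicit carriers\<close>

text \<open>
  Hilbert spaces are carrier-based, so that one can quantify over Hilbert spaces inside a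
  formula and treat \<open>\<complex>\<^sup>n\<close> for variable \<open>n\<close>.  The multiplicative fields that the module record
  inherits from the ring record play no role.  The inner product is linear in its first argument.
\<close>

record 'a cinner_space = "(complex, 'a) module" +
  cinner :: "'a \<Rightarrow> 'a \<Rightarrow> complex"

definition hnorm :: "'a cinner_space \<Rightarrow> 'a \<Rightarrow> real" where
  "hnorm H x = sqrt (Re (cinner H x x))"

locale hilbert_space = vectorspace class_ring H
  for H :: "'a cinner_space" (structure) +
  assumes cinner_add_left:
      "\<lbrakk>x \<in> carrier H; y \<in> carrier H; z \<in> carrier H\<rbrakk>
        \<Longrightarrow> cinner H (x \<oplus> y) z = cinner H x z + cinner H y z"
    and cinner_smult_left:
      "\<lbrakk>x \<in> carrier H; y \<in> carrier H\<rbrakk> \<Longrightarrow> cinner H (c \<odot>\<^bsub>H\<^esub> x) y = c * cinner H x y"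
    and cinner_commute:
      "\<lbrakk>x \<in> carrier H; y \<in> carrier H\<rbrakk> \<Longrightarrow> cinner H y x = cnj (cinner H x y)"
    and cinner_pos:
      "\<lbrakk>x \<in> carrier H; x \<noteq> \<zero>\<rbrakk> \<Longrightarrow> 0 < Re (cinner H x x)"
    and complete:
      "\<lbrakk>\<And>k. s k \<in> carrier H;
        \<And>e. 0 < e \<Longrightarrow> \<exists>M. \<forall>i\<ge>M. \<forall>j\<ge>M. hnorm H (s i \<ominus> s j) < e\<rbrakk>
        \<Longrightarrow> \<exists>l\<in>carrier H. (\<lambda>k. hnorm H (s k \<ominus> l)) \<longlonglongrightarrow> 0"

definition Cn :: "nat \<Rightarrow> complex vec cinner_space" where
  "Cn n = module.extend (module_vec TYPE(complex) n) \<lparr>cinner = (\<lambda>x y. x \<bullet>c y)\<rparr>"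

section \<open>Bounded operators\<close>

text \<open>
  Operators are extensional (\<open>undefined\<close> off the carrier), so that equality of operators is
  equality of functions.
\<close>

definition bounded_ops :: "'a cinner_space \<Rightarrow> 'b cinner_space \<Rightarrow> ('a \<Rightarrow> 'b) set" where
  "bounded_ops H K = {T \<in> extensional (carrier H). T \<in> LinearCombinations.module_hom class_ring H K \<and>
     (\<exists>c. \<forall>x\<in>carrier H. hnorm K (T x) \<le> c * hnorm H x)}"

definition op_norm :: "'a cinner_space \<Rightarrow> 'b cinner_space \<Rightarrow> ('a \<Rightarrow> 'b) \<Rightarrow> real" where
  "op_norm H K T = Sup {hnorm K (T x) |x. x \<in> carrier H \<and> hnorm H x \<le> 1}"

definition op_adj :: "'a cinner_space \<Rightarrow> 'b cinner_space \<Rightarrow> ('a \<Rightarrow> 'b) \<Rightarrow> ('b \<Rightarrow> 'a)" where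
  "op_adj H K T = (THE S. S \<in> bounded_ops K H \<and>
     (\<forall>x\<in>carrier H. \<forall>y\<in>carrier K. cinner K (T x) y = cinner H x (S y)))"

definition op_comp :: "'a cinner_space \<Rightarrow> ('b \<Rightarrow> 'c) \<Rightarrow> ('a \<Rightarrow> 'b) \<Rightarrow> ('a \<Rightarrow> 'c)" where
  "op_comp H S T = compose (carrier H) S T"

definition op_id :: "'a cinner_space \<Rightarrow> 'a \<Rightarrow> 'a" where
  "op_id H = (\<lambda>x\<in>carrier H. x)"

definition op_add :: "'a cinner_space \<Rightarrow> ('a \<Rightarrow> 'a) \<Rightarrow> ('a \<Rightarrow> 'a) \<Rightarrow> 'a \<Rightarrow> 'a" where
  "op_add H S T = (\<lambda>x\<in>carrier H. S x \<oplus>\<^bsub>H\<^esub> T x)"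

definition op_scale :: "'a cinner_space \<Rightarrow> complex \<Rightarrow> ('a \<Rightarrow> 'a) \<Rightarrow> 'a \<Rightarrow> 'a" where
  "op_scale H c T = (\<lambda>x\<in>carrier H. c \<odot>\<^bsub>H\<^esub> T x)"

definition contraction :: "'a cinner_space \<Rightarrow> ('a \<Rightarrow> 'a) \<Rightarrow> bool" where
  "contraction H T \<longleftrightarrow> T \<in> bounded_ops H H \<and> op_norm H H T \<le> 1"

definition normal_op :: "'a cinner_space \<Rightarrow> ('a \<Rightarrow> 'a) \<Rightarrow> bool" where
  "normal_op H T \<longleftrightarrow> T \<in> bounded_ops H H \<and>
     op_comp H (op_adj H H T) T = op_comp H T (op_adj H H T)"

text \<open>Tuples of operators, of matrices, etc. are lists.\<close>

definition normal_tuple :: "'a cinner_space \<Rightarrow> ('a \<Rightarrow> 'a) list \<Rightarrow> bool" where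
  "normal_tuple H N \<longleftrightarrow> (\<forall>S\<in>set N. normal_op H S) \<and>
     (\<forall>S\<in>set N. \<forall>T\<in>set N. op_comp H S T = op_comp H T S)"

section \<open>C*-algebras, states and characters\<close>

definition unital_cstar_subalgebra :: "'a cinner_space \<Rightarrow> ('a \<Rightarrow> 'a) set \<Rightarrow> bool" where
  "unital_cstar_subalgebra H \<A> \<longleftrightarrow> \<A> \<subseteq> bounded_ops H H \<and> op_id H \<in> \<A> \<and>
     (\<forall>S\<in>\<A>. \<forall>T\<in>\<A>. op_add H S T \<in> \<A> \<and> op_comp H S T \<in> \<A>) \<and>
     (\<forall>S\<in>\<A>. (\<forall>c. op_scale H c S \<in> \<A>) \<and> op_adj H H S \<in> \<A>) \<and>
     (\<forall>T\<in>bounded_ops H H.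
        (\<forall>e>0. \<exists>S\<in>\<A>. op_norm H H (op_add H T (op_scale H (-1) S)) < e) \<longrightarrow> T \<in> \<A>)"

definition cstar_generated :: "'a cinner_space \<Rightarrow> ('a \<Rightarrow> 'a) set \<Rightarrow> ('a \<Rightarrow> 'a) set" where
  "cstar_generated H G = \<Inter> {\<A>. unital_cstar_subalgebra H \<A> \<and> G \<subseteq> \<A>}"

definition linear_functional ::
  "'a cinner_space \<Rightarrow> ('a \<Rightarrow> 'a) set \<Rightarrow> (('a \<Rightarrow> 'a) \<Rightarrow> complex) \<Rightarrow> bool" where
  "linear_functional H \<A> \<phi> \<longleftrightarrow>
     (\<forall>S\<in>\<A>. \<forall>T\<in>\<A>. \<phi> (op_add H S T) = \<phi> S + \<phi> T) \<and>
     (\<forall>S\<in>\<A>. \<forall>c. \<phi> (op_scale H c S) = c * \<phi> S)"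

definition state :: "'a cinner_space \<Rightarrow> ('a \<Rightarrow> 'a) set \<Rightarrow> (('a \<Rightarrow> 'a) \<Rightarrow> complex) \<Rightarrow> bool" where
  "state H \<A> \<phi> \<longleftrightarrow> linear_functional H \<A> \<phi> \<and> \<phi> (op_id H) = 1 \<and>
     (\<forall>S\<in>\<A>. \<phi> (op_comp H (op_adj H H S) S) \<in> \<real> \<and> 0 \<le> Re (\<phi> (op_comp H (op_adj H H S) S)))"

definition character :: "'a cinner_space \<Rightarrow> ('a \<Rightarrow> 'a) set \<Rightarrow> (('a \<Rightarrow> 'a) \<Rightarrow> complex) \<Rightarrow> bool" where
  "character H \<A> \<chi> \<longleftrightarrow> linear_functional H \<A> \<chi> \<and> \<chi> (op_id H) = 1 \<and>
     (\<forall>S\<in>\<A>. \<forall>T\<in>\<A>. \<chi> (op_comp H S T) = \<chi> S * \<chi> T)"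

text \<open>The set \<open>\<W>\<^sub>1(A)\<close>, in \<open>\<complex>\<^sup>m\<close>; it consists of real vectors if \<open>A\<close> is self-adjoint.\<close>

definition W1 :: "'a cinner_space \<Rightarrow> ('a \<Rightarrow> 'a) list \<Rightarrow> complex vec set" where
  "W1 H A = {vec (length A) (\<lambda>i. \<phi> (A ! i)) |\<phi>. state H (cstar_generated H (set A)) \<phi>}"

text \<open>
  The joint spectrum of a normal tuple \<open>N\<close> is the image of the Gelfand spectrum of the
  (commutative) unital C*-algebra generated by \<open>N\<close>.
\<close>

definition joint_spectrum :: "'a cinner_space \<Rightarrow> ('a \<Rightarrow> 'a) list \<Rightarrow> complex vec set" where
  "joint_spectrum H N =
     {vec (length N) (\<lambda>i. \<chi> (N ! i)) |\<chi>. character H (cstar_generated H (set N)) \<chi>}"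

section \<open>Dilations\<close>

definition isometry :: "'a cinner_space \<Rightarrow> 'b cinner_space \<Rightarrow> ('a \<Rightarrow> 'b) \<Rightarrow> bool" where
  "isometry H K V \<longleftrightarrow> V \<in> bounded_ops H K \<and> (\<forall>x\<in>carrier H. hnorm K (V x) = hnorm H x)"

definition dilation ::
  "'a cinner_space \<Rightarrow> 'b cinner_space \<Rightarrow> ('a \<Rightarrow> 'a) list \<Rightarrow> ('b \<Rightarrow> 'b) list \<Rightarrow> bool" where
  "dilation H K X N \<longleftrightarrow> length N = length X \<and>
     (\<exists>V. isometry H K V \<and>
       (\<forall>i<length X. X ! i = op_comp H (op_adj H K V) (op_comp H (N ! i) V)))"

section \<open>Maximal and minimal matrix convex sets\<close>

definition mat_op :: "nat \<Rightarrow> complex mat \<Rightarrow> complex vec \<Rightarrow> complex vec" where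
  "mat_op n A = (\<lambda>v\<in>carrier_vec n. A *\<^sub>v v)"

definition sa_tuples :: "nat \<Rightarrow> nat \<Rightarrow> complex mat list set" where
  "sa_tuples m n = {X. length X = m \<and> (\<forall>A\<in>set X. A \<in> carrier_mat n n \<and> mat_adjoint A = A)}"

text \<open>Below, \<open>K\<close> is a subset of \<open>\<real>\<^sup>m\<close>, that is, of \<^term>\<open>carrier_vec m :: real vec set\<close>.\<close>

definition W_max_level :: "nat \<Rightarrow> nat \<Rightarrow> real vec set \<Rightarrow> complex mat list set" where
  "W_max_level m n K =
     {X \<in> sa_tuples m n. W1 (Cn n) (map (mat_op n) X) \<subseteq> map_vec complex_of_real ` K}"

text \<open>
  The type argument is the type in which the carriers of the dilation Hilbert spaces live.
  Replacing the dilation space by the smallest reducing subspace for \<open>N\<close> that contains the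
  (finite-dimensional) range of the isometry makes it separable, hence of cardinality at most
  the continuum; so the universe \<^typ>\<open>nat \<Rightarrow> complex\<close> already yields all of \<open>\<W>\<^sup>m\<^sup>i\<^sup>n\<close>.
\<close>

definition W_min_level ::
  "'k itself \<Rightarrow> nat \<Rightarrow> nat \<Rightarrow> real vec set \<Rightarrow> complex mat list set" where
  "W_min_level TYPE('k) m n K =
     {X \<in> sa_tuples m n. \<exists>(L :: 'k cinner_space) N. hilbert_space L \<and> normal_tuple L N \<and>
        dilation (Cn n) L (map (mat_op n) X) N \<and>
        joint_spectrum L N \<subseteq> map_vec complex_of_real ` K}"

text \<open>
  Matrices know their dimension, so for \<open>m \<ge> 1\<close> the levels are disjoint and inclusion of the
  unions is levelwise inclusion.
\<close>

definition W_max :: "nat \<Rightarrow> real vec set \<Rightarrow> complex mat list set" where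
  "W_max m K = (\<Union>n\<in>{1..}. W_max_level m n K)"

definition W_min :: "'k itself \<Rightarrow> nat \<Rightarrow> real vec set \<Rightarrow> complex mat list set" where
  "W_min ty m K = (\<Union>n\<in>{1..}. W_min_level ty m n K)"

definition scale_tuples :: "real \<Rightarrow> complex mat list set \<Rightarrow> complex mat list set" where
  "scale_tuples c W = map (\<lambda>A. complex_of_real c \<cdot>\<^sub>m A) ` W"

section \<open>The closed polydisk\<close>

text \<open>\<open>\<complex>\<^sup>d\<close> is identified with \<open>\<real>\<^sup>2\<^sup>d\<close> via \<open>(z\<^sub>1, \<dots>) \<mapsto> (Re z\<^sub>1, Im z\<^sub>1, Re z\<^sub>2, Im z\<^sub>2, \<dots>)\<close>.\<close>

definition realify :: "complex vec \<Rightarrow> real vec" where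
  "realify z = vec (2 * dim_vec z)
     (\<lambda>i. if even i then Re (z $ (i div 2)) else Im (z $ (i div 2)))"

definition closed_polydisk :: "nat \<Rightarrow> real vec set" where
  "closed_polydisk d = realify ` {z \<in> carrier_vec d. \<forall>j<d. cmod (z $ j) \<le> 1}"

end

theory Submission
  imports Defs
begin

text \<open>
  Write \<open>T\<^sub>j = X\<^sub>2\<^sub>j + \<i> X\<^sub>2\<^sub>j\<^sub>+\<^sub>1\<close>.  If the tuple lies in \<open>\<W>\<^sup>m\<^sup>a\<^sup>x\<close> of the polydisk,
  or if the \<open>T\<^sub>j\<close> are contractions, then the \<open>m = 2 d\<close> operators \<open>X\<^sub>i\<close> are self-adjoint
  contractions.  An explicit positive operator valued measure on \<open>{0, \<plusminus>1}\<^sup>m\<close> dilates them to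
  commuting self-adjoint operators with spectrum in \<open>{0, \<plusminus>\<surd>m}\<close>, so that the \<open>T\<^sub>j\<close> dilate to
  normal operators of norm at most \<open>\<surd>(2 m) = 2 \<surd>d\<close>.  The bound \<open>d\<close> comes from
  the Halmos unitaries \<open>U\<^sub>j\<close> of the \<open>T\<^sub>j\<close>: the block diagonal operators with the single
  nonzero block \<open>d U\<^sub>j\<close> commute, and compress to \<open>T\<^sub>j\<close> along the diagonal embedding divided
  by \<open>\<surd>d\<close>.

  The constant \<open>2 \<surd>d\<close> is attained at anticommuting self-adjoint unitaries
  \<open>F\<^sub>1, \<dots>, F\<^sub>2\<^sub>d\<close>: the norm of \<open>\<Sum> F\<^sub>j \<otimes> cnj F\<^sub>j\<close> is \<open>2 d\<close>, whereas
  \<open>(\<Sum> N\<^sub>j \<otimes> cnj F\<^sub>j)\<^sup>2 = \<Sum> N\<^sub>j\<^sup>2 \<otimes> 1 \<le> d\<close> for commuting self-adjoint \<open>N\<^sub>j\<close> with joint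
  spectrum in the polydisk.  Operator inequalities are read off the joint spectrum by means of
  joint approximate eigenvectors of commuting normal operators; each such sequence of vectors
  defines a character.
\<close>

section \<open>Inner products and the Riesz representation\<close>

text \<open>The constant comes from an optimisation. Averaged over signs, the square of
  \<open>1 + t \<Sum> \<epsilon>\<^sub>j X\<^sub>j\<close> has mass at most
  \<open>1 + t\<^sup>2 m\<close> and first moments \<open>2 t X\<^sub>j\<close>; the ratio
  \<open>2 t / (1 + t\<^sup>2 m)\<close> peaks at \<open>t = 1 / \<surd>m\<close>, with value
  \<open>1 / \<surd>m\<close>. The additional factor \<open>\<surd>2\<close> is the modulus of the
  corner \<open>1 + \<i>\<close> of a square. The main obstacle is that the joint spectrum consists
  of values of characters on a generated C*-algebra that is not described explicitly. For the
  diagonal dilations a polynomial identity confines these values. For optimality, characters have to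
  be produced, out of normal operators that commute with each other but for which nothing is assumed
  about how one commutes with the adjoint of another. Approximate eigenvectors for a normal
  \<open>b\<close> are therefore found by applying powers of translates \<open>b - z\<close>: these
  preserve what has been achieved for operators that commute with \<open>b\<close>. Each translate
  yields an approximate eigenvalue of its squared modulus, and four of these moduli recover
  \<open>b\<close> by polarisation.\<close>

lemma mult_cnj_cmod: "z * cnj z = (complex_of_real (cmod z))\<^sup>2"
  by (simp add: complex_norm_square[symmetric])

context hilbert_space
begin

lemma smult_in [simp, intro]: "x \<in> carrier H \<Longrightarrow> c \<odot> x \<in> carrier H"
  by (rule smult_closed) auto

lemma minus_in: "x \<in> carrier H \<Longrightarrow> y \<in> carrier H \<Longrightarrow> x \<ominus> y \<in> carrier H"
  by (rule minus_closed)

lemma cinner_add_right: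
  "\<lbrakk>x \<in> carrier H; y \<in> carrier H; z \<in> carrier H\<rbrakk>
     \<Longrightarrow> cinner H z (x \<oplus> y) = cinner H z x + cinner H z y"
  by (metis cinner_add_left cinner_commute complex_cnj_add a_closed)

lemma cinner_smult_right:
  "\<lbrakk>x \<in> carrier H; y \<in> carrier H\<rbrakk> \<Longrightarrow> cinner H x (c \<odot> y) = cnj c * cinner H x y"
  by (metis cinner_smult_left cinner_commute complex_cnj_mult smult_in)

lemma cinner_zero_left: "x \<in> carrier H \<Longrightarrow> cinner H \<zero> x = 0"
  using cinner_add_left[of \<zero> \<zero> x] by simp

lemma cinner_zero_right: "x \<in> carrier H \<Longrightarrow> cinner H x \<zero> = 0"
  using cinner_add_right[of \<zero> \<zero> x] by simp

lemma diff_add_cancel_carrier: "\<lbrakk>x \<in> carrier H; y \<in> carrier H\<rbrakk> \<Longrightarrow> (x \<ominus> y) \<oplus> y = x"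
  by (simp add: a_minus_def a_assoc l_neg)

lemma cinner_diff_left:
  assumes "x \<in> carrier H" "y \<in> carrier H" "z \<in> carrier H"
  shows "cinner H (x \<ominus> y) z = cinner H x z - cinner H y z"
proof -
  have "x = (x \<ominus> y) \<oplus> y" using assms
    by (simp add: diff_add_cancel_carrier)
  then have "cinner H x z = cinner H (x \<ominus> y) z + cinner H y z"
    using assms cinner_add_left[of "x \<ominus> y" y z] by simp
  then show ?thesis by simp
qed

lemma cinner_diff_right:
  "\<lbrakk>x \<in> carrier H; y \<in> carrier H; z \<in> carrier H\<rbrakk>
     \<Longrightarrow> cinner H z (x \<ominus> y) = cinner H z x - cinner H z y"
  by (metis cinner_diff_left cinner_commute complex_cnj_diff minus_in)

lemmas ip_simps = cinner_add_left cinner_add_right cinner_smult_left cinner_smult_right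
  cinner_zero_left cinner_zero_right cinner_diff_left cinner_diff_right

lemma cinner_self_ge: "x \<in> carrier H \<Longrightarrow> 0 \<le> Re (cinner H x x)"
  using cinner_pos[of x] cinner_zero_left[of \<zero>] by (cases "x = \<zero>") auto

lemma hnorm_ge [simp]: "x \<in> carrier H \<Longrightarrow> 0 \<le> hnorm H x"
  by (simp add: hnorm_def cinner_self_ge)

lemma hnorm_sq: "x \<in> carrier H \<Longrightarrow> (hnorm H x)\<^sup>2 = Re (cinner H x x)"
  by (simp add: hnorm_def cinner_self_ge)

lemma cinner_self: "x \<in> carrier H \<Longrightarrow> cinner H x x = complex_of_real ((hnorm H x)\<^sup>2)"
  using cinner_commute[of x x] hnorm_sq[of x] by (simp add: complex_eq_iff)

lemma hnorm_zero [simp]: "hnorm H \<zero> = 0"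
  by (simp add: hnorm_def cinner_zero_left)

lemma hnorm_eq_0: "x \<in> carrier H \<Longrightarrow> hnorm H x = 0 \<longleftrightarrow> x = \<zero>"
  using cinner_pos[of x] hnorm_sq[of x] by (cases "x = \<zero>") auto

lemma hnorm_smult:
  assumes x: "x \<in> carrier H"
  shows "hnorm H (c \<odot> x) = cmod c * hnorm H x"
proof (rule power2_eq_imp_eq)
  have "cinner H (c \<odot> x) (c \<odot> x) = (c * cnj c) * cinner H x x"
    using x by (simp add: ip_simps)
  also have "\<dots> = complex_of_real ((cmod c * hnorm H x)\<^sup>2)"
    unfolding mult_cnj_cmod cinner_self[OF x] by (simp add: power_mult_distrib)
  finally show "(hnorm H (c \<odot> x))\<^sup>2 = (cmod c * hnorm H x)\<^sup>2"
    by (simp only: hnorm_sq[OF smult_in[OF x]] Re_complex_of_real)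
qed (use x in simp_all)

text \<open>Nondegeneracy of the inner product. Most vector identities below go through it: tested
  against \<open>z\<close>, they become identities of complex numbers, which \<open>ip_simps\<close>
  can expand.\<close>

lemma inner_ext:
  assumes "x \<in> carrier H" "y \<in> carrier H" "\<And>z. z \<in> carrier H \<Longrightarrow> cinner H x z = cinner H y z"
  shows "x = y"
proof -
  have "hnorm H (x \<ominus> y) = 0"
    using assms by (simp add: hnorm_def cinner_diff_left)
  then have "x \<ominus> y = \<zero>" using assms hnorm_eq_0 by blast
  then show ?thesis using assms diff_add_cancel_carrier[of x y] by simp
qed

lemma hnorm_add_sq:
  "\<lbrakk>x \<in> carrier H; y \<in> carrier H\<rbrakk> \<Longrightarrow>
     (hnorm H (x \<oplus> y))\<^sup>2 = (hnorm H x)\<^sup>2 + 2 * Re (cinner H x y) + (hnorm H y)\<^sup>2"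
  using cinner_commute[of x y] by (simp add: hnorm_sq ip_simps)

lemma hnorm_diff_sq:
  "\<lbrakk>x \<in> carrier H; y \<in> carrier H\<rbrakk> \<Longrightarrow>
     (hnorm H (x \<ominus> y))\<^sup>2 = (hnorm H x)\<^sup>2 - 2 * Re (cinner H x y) + (hnorm H y)\<^sup>2"
  using cinner_commute[of x y] by (simp add: hnorm_sq ip_simps)

lemma cauchy_schwarz:
  assumes x: "x \<in> carrier H" and y: "y \<in> carrier H"
  shows "cmod (cinner H x y) \<le> hnorm H x * hnorm H y"
proof (cases "hnorm H y = 0")
  case True
  then show ?thesis using x y by (simp add: hnorm_eq_0 cinner_zero_right)
next
  case False
  define n where "n = (hnorm H y)\<^sup>2"
  define a where "a = cinner H x y"
  have n: "n > 0" using False y by (simp add: n_def)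
  \<comment> \<open>\<open>?u - ?v\<close> is \<open>n\<close> times the component of
    \<open>x\<close> orthogonal to \<open>y\<close>; clearing the denominator keeps the expansion
    polynomial.\<close>
  let ?u = "complex_of_real n \<odot> x" and ?v = "a \<odot> y"
  have e: "cnj a * a = complex_of_real ((cmod a)\<^sup>2)"
    by (simp add: mult_cnj_cmod mult.commute)
  have "cinner H ?u ?v = of_real n * (cnj a * a)"
    using x y by (simp add: ip_simps a_def)
  then have "Re (cinner H ?u ?v) = n * (cmod a)\<^sup>2" by (simp add: e)
  moreover have "(hnorm H ?u)\<^sup>2 = n\<^sup>2 * (hnorm H x)\<^sup>2"
    using x n by (simp only: hnorm_smult power_mult_distrib norm_of_real power2_abs)
  moreover have "(hnorm H ?v)\<^sup>2 = (cmod a)\<^sup>2 * n"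
    unfolding n_def using y by (simp only: hnorm_smult power_mult_distrib)
  ultimately have "(hnorm H (?u \<ominus> ?v))\<^sup>2
      = n\<^sup>2 * (hnorm H x)\<^sup>2 - 2 * (n * (cmod a)\<^sup>2) + (cmod a)\<^sup>2 * n"
    using x y by (simp only: hnorm_diff_sq smult_in)
  also have "\<dots> = n * (n * (hnorm H x)\<^sup>2 - (cmod a)\<^sup>2)" by (simp add: algebra_simps power2_eq_square)
  finally have "0 \<le> n * (n * (hnorm H x)\<^sup>2 - (cmod a)\<^sup>2)" by (metis zero_le_power2)
  then have "(cmod a)\<^sup>2 \<le> n * (hnorm H x)\<^sup>2"
    using n by (simp add: zero_le_mult_iff)
  then have "(cmod a)\<^sup>2 \<le> (hnorm H x * hnorm H y)\<^sup>2"
    by (simp only: n_def power_mult_distrib mult.commute)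
  then show ?thesis
    unfolding a_def by (rule power2_le_imp_le) (use x y in simp)
qed

lemma hnorm_triangle:
  assumes "x \<in> carrier H" "y \<in> carrier H"
  shows "hnorm H (x \<oplus> y) \<le> hnorm H x + hnorm H y"
proof (rule power2_le_imp_le)
  have "Re (cinner H x y) \<le> hnorm H x * hnorm H y"
    using cauchy_schwarz[OF assms] complex_Re_le_cmod order_trans by blast
  then show "(hnorm H (x \<oplus> y))\<^sup>2 \<le> (hnorm H x + hnorm H y)\<^sup>2"
    using assms by (simp add: hnorm_add_sq power2_sum)
qed (use assms in simp)

lemma hnorm_minus_commute:
  "\<lbrakk>x \<in> carrier H; y \<in> carrier H\<rbrakk> \<Longrightarrow> hnorm H (x \<ominus> y) = hnorm H (y \<ominus> x)"
  by (simp add: hnorm_def ip_simps algebra_simps)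

lemma diff_zero_carrier: "x \<in> carrier H \<Longrightarrow> x \<ominus> \<zero> = x"
  by (rule inner_ext) (simp_all add: ip_simps)

lemma diff_as_sum:
  "\<lbrakk>x \<in> carrier H; y \<in> carrier H; z \<in> carrier H\<rbrakk> \<Longrightarrow> x \<ominus> z = (x \<ominus> y) \<oplus> (y \<ominus> z)"
  by (rule inner_ext) (simp_all add: ip_simps)

lemma hnorm_triangle_diff:
  "\<lbrakk>x \<in> carrier H; y \<in> carrier H; z \<in> carrier H\<rbrakk> \<Longrightarrow>
     hnorm H (x \<ominus> z) \<le> hnorm H (x \<ominus> y) + hnorm H (y \<ominus> z)"
  using hnorm_triangle[of "x \<ominus> y" "y \<ominus> z"] diff_as_sum[of x y z] by simp

lemma hnorm_triangle_sub:
  "\<lbrakk>x \<in> carrier H; y \<in> carrier H\<rbrakk> \<Longrightarrow> hnorm H (x \<ominus> y) \<le> hnorm H x + hnorm H y"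
  using hnorm_triangle_diff[of x \<zero> y] hnorm_minus_commute[of \<zero> y] by (simp add: diff_zero_carrier)

lemma cinner_tendsto:
  assumes s: "\<And>n. s n \<in> carrier H" and l: "l \<in> carrier H" and t: "\<And>n. t n \<in> carrier H"
    and m: "m \<in> carrier H"
    and sl: "(\<lambda>n. hnorm H (s n \<ominus> l)) \<longlonglongrightarrow> 0" and tm: "(\<lambda>n. hnorm H (t n \<ominus> m)) \<longlonglongrightarrow> 0"
  shows "(\<lambda>n. cinner H (s n) (t n)) \<longlonglongrightarrow> cinner H l m"
proof -
  have "(\<lambda>n. cinner H (s n) (t n) - cinner H l m) \<longlonglongrightarrow> 0"
  proof (rule tendsto_norm_zero_cancel, rule tendsto_sandwich[OF _ _ tendsto_const])
    let ?a = "\<lambda>n. hnorm H (s n \<ominus> l)" and ?b = "\<lambda>n. hnorm H (t n \<ominus> m)"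
    show "\<forall>\<^sub>F n in sequentially. 0 \<le> norm (cinner H (s n) (t n) - cinner H l m)" by simp
    show "\<forall>\<^sub>F n in sequentially. norm (cinner H (s n) (t n) - cinner H l m)
            \<le> ?a n * ?b n + ?a n * hnorm H m + hnorm H l * ?b n"
    proof (intro always_eventually allI)
      fix n
      \<comment> \<open>Expanding around the limits \<open>l\<close> and \<open>m\<close> leaves
        only terms with a factor tending to 0, without first having to bound the norms of
        \<open>t n\<close>.\<close>
      have "cinner H (s n) (t n) - cinner H l m =
          cinner H (s n \<ominus> l) (t n \<ominus> m) + cinner H (s n \<ominus> l) m + cinner H l (t n \<ominus> m)"
        using s l t m by (simp add: ip_simps algebra_simps)
      also have "norm \<dots> \<le> cmod (cinner H (s n \<ominus> l) (t n \<ominus> m)) + cmod (cinner H (s n \<ominus> l) m)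
          + cmod (cinner H l (t n \<ominus> m))"
        by (meson norm_triangle_ineq norm_triangle_mono order_refl)
      also have "\<dots> \<le> ?a n * ?b n + ?a n * hnorm H m + hnorm H l * ?b n"
        using s l t m by (intro add_mono cauchy_schwarz) auto
      finally show "norm (cinner H (s n) (t n) - cinner H l m) \<le> \<dots>" .
    qed
    show "(\<lambda>n. ?a n * ?b n + ?a n * hnorm H m + hnorm H l * ?b n) \<longlonglongrightarrow> 0"
      using tendsto_add[OF tendsto_add[OF tendsto_mult[OF sl tm]
          tendsto_mult[OF sl tendsto_const]] tendsto_mult[OF tendsto_const tm]] by simp
  qed
  then show ?thesis by (simp add: LIM_zero_iff)
qed

text \<open>The representing vector minimises \<open>\<parallel>x\<parallel>\<^sup>2 - 2 Re (f x)\<close>; the parallelogram law makes every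
  minimising sequence Cauchy.\<close>

lemma riesz:
  assumes add: "\<And>x y. x \<in> carrier H \<Longrightarrow> y \<in> carrier H \<Longrightarrow> f (x \<oplus> y) = f x + f y"
    and smult: "\<And>c x. x \<in> carrier H \<Longrightarrow> f (c \<odot> x) = c * f x"
    and bound: "\<And>x. x \<in> carrier H \<Longrightarrow> cmod (f x) \<le> b * hnorm H x"
  shows "\<exists>w\<in>carrier H. \<forall>x\<in>carrier H. f x = cinner H x w"
proof -
  define J where "J x = (hnorm H x)\<^sup>2 - 2 * Re (f x)" for x
  define m where "m = Inf (J ` carrier H)"
  have "J x \<ge> - b\<^sup>2" if x: "x \<in> carrier H" for x
  proof -
    have "Re (f x) \<le> b * hnorm H x" using bound[OF x] complex_Re_le_cmod order_trans by blast
    moreover have "0 \<le> (hnorm H x - b)\<^sup>2" by simp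
    ultimately show ?thesis by (simp add: J_def power2_diff mult.commute)
  qed
  then have bdd: "bdd_below (J ` carrier H)" by (auto intro!: bdd_belowI2)
  have m_le: "m \<le> J x" if "x \<in> carrier H" for x
    unfolding m_def using that by (intro cInf_lower bdd) auto
  have "\<exists>x\<in>carrier H. J x < m + inverse (real (Suc n))" for n
    using cInf_lessD[of "J ` carrier H" "m + inverse (real (Suc n))"] by (auto simp: m_def)
  then obtain s where s: "\<And>n. s n \<in> carrier H" and sJ: "\<And>n. J (s n) < m + inverse (real (Suc n))"
    by metis
  have para: "(hnorm H (x \<ominus> y))\<^sup>2 / 2 \<le> J x + J y - 2 * m"
    if x: "x \<in> carrier H" and y: "y \<in> carrier H" for x y
  proof -
    let ?z = "(1/2) \<odot> (x \<oplus> y)"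
    have "2 * J ?z = (hnorm H (x \<oplus> y))\<^sup>2 / 2 - 2 * Re (f x) - 2 * Re (f y)"
      using x y by (simp add: J_def hnorm_smult add smult power_mult_distrib power2_eq_square
          add_divide_distrib)
    moreover have "m \<le> J ?z" using x y by (intro m_le) auto
    moreover have "(hnorm H (x \<ominus> y))\<^sup>2 + (hnorm H (x \<oplus> y))\<^sup>2 = 2 * (hnorm H x)\<^sup>2 + 2 * (hnorm H y)\<^sup>2"
      using x y by (simp add: hnorm_add_sq hnorm_diff_sq)
    ultimately show ?thesis by (simp add: J_def)
  qed
  have "\<exists>M. \<forall>i\<ge>M. \<forall>j\<ge>M. hnorm H (s i \<ominus> s j) < e" if e: "0 < e" for e
  proof -
    obtain M where M: "inverse (real (Suc M)) < e\<^sup>2 / 4"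
      using reals_Archimedean[of "e\<^sup>2 / 4"] e by auto
    have "hnorm H (s i \<ominus> s j) < e" if "i \<ge> M" "j \<ge> M" for i j
    proof (rule power2_less_imp_less)
      have "inverse (real (Suc i)) \<le> inverse (real (Suc M))"
        "inverse (real (Suc j)) \<le> inverse (real (Suc M))"
        using that by (auto intro!: le_imp_inverse_le)
      then show "(hnorm H (s i \<ominus> s j))\<^sup>2 < e\<^sup>2"
        using para[OF s s, of i j] sJ[of i] sJ[of j] M by linarith
    qed (use e in simp)
    then show ?thesis by blast
  qed
  then obtain w where w: "w \<in> carrier H" and sw: "(\<lambda>k. hnorm H (s k \<ominus> w)) \<longlonglongrightarrow> 0"
    using complete[of s] s by auto
  have re: "Re (cinner H x w) = Re (f x)" if x: "x \<in> carrier H" for x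
  proof -
    have lim: "(\<lambda>n. cinner H x (s n)) \<longlonglongrightarrow> cinner H x w"
      using cinner_tendsto[of "\<lambda>n. x" x s w] x s w sw by (simp add: a_minus_def r_neg)
    \<comment> \<open>\<open>J\<close> at \<open>s n + t x\<close> is at least the infimum
      \<open>m\<close>, and \<open>J (s n)\<close> exceeds \<open>m\<close> by less than
      \<open>1 / (n + 1)\<close>. What survives in the limit is the variation of \<open>J\<close> at
      the minimiser \<open>w\<close> in direction \<open>x\<close>.\<close>
    have pos: "0 \<le> 2 * t * (Re (cinner H x w) - Re (f x)) + t\<^sup>2 * (hnorm H x)\<^sup>2" for t :: real
    proof (rule LIMSEQ_le_const)
      show "(\<lambda>n. inverse (real (Suc n)) + (2 * t * (Re (cinner H x (s n)) - Re (f x))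
               + t\<^sup>2 * (hnorm H x)\<^sup>2))
          \<longlonglongrightarrow> 2 * t * (Re (cinner H x w) - Re (f x)) + t\<^sup>2 * (hnorm H x)\<^sup>2"
        using tendsto_add[OF LIMSEQ_inverse_real_of_nat
            tendsto_add[OF tendsto_mult[OF tendsto_const
              tendsto_diff[OF tendsto_Re[OF lim] tendsto_const]] tendsto_const]] by simp
      show "\<exists>N. \<forall>n\<ge>N. 0 \<le> inverse (real (Suc n)) + (2 * t * (Re (cinner H x (s n)) - Re (f x))
               + t\<^sup>2 * (hnorm H x)\<^sup>2)"
      proof (intro exI allI impI)
        fix n
        have "m \<le> J (s n \<oplus> complex_of_real t \<odot> x)" using s x by (intro m_le) auto
        also have "\<dots> = J (s n) + (2 * t * (Re (cinner H x (s n)) - Re (f x)) + t\<^sup>2 * (hnorm H x)\<^sup>2)"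
          using s[of n] x cinner_commute[of x "s n"]
          by (simp add: J_def hnorm_add_sq hnorm_smult add smult ip_simps algebra_simps
              power_mult_distrib)
        finally show "0 \<le> inverse (real (Suc n)) + (2 * t * (Re (cinner H x (s n)) - Re (f x))
               + t\<^sup>2 * (hnorm H x)\<^sup>2)"
          using sJ[of n] by linarith
      qed
    qed
    define a where "a = Re (cinner H x w) - Re (f x)"
    define q where "q = (hnorm H x)\<^sup>2"
    have q: "q \<ge> 0" by (simp add: q_def)
    \<comment> \<open>The denominator \<open>q + 1\<close> covers \<open>q = 0\<close> as well, and
      at \<open>t = - u\<close> the quadratic equals \<open>- u^2 (q + 2)\<close>, which forces
      \<open>u = 0\<close>.\<close>
    define u where "u = a / (q + 1)"
    have a: "a = u * (q + 1)" using q by (simp add: u_def)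
    have "0 \<le> 2 * (- u) * a + (- u)\<^sup>2 * q"
      using pos[of "- u"] unfolding a_def q_def .
    also have "\<dots> = - (u\<^sup>2 * (q + 2))"
      by (simp add: a algebra_simps power2_eq_square)
    finally have "u\<^sup>2 * (q + 2) \<le> 0" by simp
    then have "u = 0" using q by (simp add: mult_le_0_iff)
    then have "a = 0" by (simp add: a)
    then show ?thesis by (simp add: a_def)
  qed
  have "f x = cinner H x w" if x: "x \<in> carrier H" for x
  proof (rule complex_eqI)
    show "Re (f x) = Re (cinner H x w)" using re x by simp
    \<comment> \<open>The real part of a linear functional determines it, since
      \<open>Im (f x) = - Re (f (\<i> x))\<close>.\<close>
    show "Im (f x) = Im (cinner H x w)"
      using re[of "\<i> \<odot> x"] x w by (simp add: smult ip_simps)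
  qed
  then show ?thesis using w by blast
qed

end

section \<open>Bounded operators and adjoints\<close>

lemma bop_in: "T \<in> bounded_ops H K \<Longrightarrow> x \<in> carrier H \<Longrightarrow> T x \<in> carrier K"
  by (auto simp: bounded_ops_def LinearCombinations.module_hom_def)

lemma bop_add:
  "\<lbrakk>T \<in> bounded_ops H K; x \<in> carrier H; y \<in> carrier H\<rbrakk> \<Longrightarrow> T (x \<oplus>\<^bsub>H\<^esub> y) = T x \<oplus>\<^bsub>K\<^esub> T y"
  by (auto simp: bounded_ops_def LinearCombinations.module_hom_def)

lemma bop_smult:
  "\<lbrakk>T \<in> bounded_ops H K; x \<in> carrier H\<rbrakk> \<Longrightarrow> T (c \<odot>\<^bsub>H\<^esub> x) = c \<odot>\<^bsub>K\<^esub> T x"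
  by (auto simp: bounded_ops_def LinearCombinations.module_hom_def)

lemma bop_eqI:
  "\<lbrakk>S \<in> bounded_ops H K; T \<in> bounded_ops H K; \<And>x. x \<in> carrier H \<Longrightarrow> S x = T x\<rbrakk> \<Longrightarrow> S = T"
  by (rule extensionalityI) (auto simp: bounded_ops_def)

lemma op_comp_app [simp]: "x \<in> carrier H \<Longrightarrow> op_comp H S T x = S (T x)"
  by (simp add: op_comp_def compose_def)

lemma op_add_app [simp]: "x \<in> carrier H \<Longrightarrow> op_add H S T x = S x \<oplus>\<^bsub>H\<^esub> T x"
  by (simp add: op_add_def)

lemma op_scale_app [simp]: "x \<in> carrier H \<Longrightarrow> op_scale H c T x = c \<odot>\<^bsub>H\<^esub> T x"
  by (simp add: op_scale_def)

lemma op_id_app [simp]: "x \<in> carrier H \<Longrightarrow> op_id H x = x"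
  by (simp add: op_id_def)

lemma cstar_sub: "unital_cstar_subalgebra H A \<Longrightarrow> T \<in> A \<Longrightarrow> T \<in> bounded_ops H H"
  and cstar_id: "unital_cstar_subalgebra H A \<Longrightarrow> op_id H \<in> A"
  and cstar_add: "unital_cstar_subalgebra H A \<Longrightarrow> S \<in> A \<Longrightarrow> T \<in> A \<Longrightarrow> op_add H S T \<in> A"
  and cstar_comp: "unital_cstar_subalgebra H A \<Longrightarrow> S \<in> A \<Longrightarrow> T \<in> A \<Longrightarrow> op_comp H S T \<in> A"
  and cstar_scale: "unital_cstar_subalgebra H A \<Longrightarrow> T \<in> A \<Longrightarrow> op_scale H c T \<in> A"
  and cstar_adj: "unital_cstar_subalgebra H A \<Longrightarrow> T \<in> A \<Longrightarrow> op_adj H H T \<in> A"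
  unfolding unital_cstar_subalgebra_def by blast+

lemma cstar_generated_iff:
  "T \<in> cstar_generated H G \<longleftrightarrow> (\<forall>A. unital_cstar_subalgebra H A \<and> G \<subseteq> A \<longrightarrow> T \<in> A)"
  by (auto simp: cstar_generated_def)

locale hilbert_pair = H: hilbert_space H + K: hilbert_space K
  for H :: "'a cinner_space" and K :: "'b cinner_space"
begin

lemma bop_in_pair [simp]: "T \<in> bounded_ops H K \<Longrightarrow> x \<in> carrier H \<Longrightarrow> T x \<in> carrier K"
  by (rule bop_in)

lemma bop_zero: "T \<in> bounded_ops H K \<Longrightarrow> T \<zero>\<^bsub>H\<^esub> = \<zero>\<^bsub>K\<^esub>"
  using bop_add[of T H K "\<zero>\<^bsub>H\<^esub>" "\<zero>\<^bsub>H\<^esub>"] bop_in[of T H K "\<zero>\<^bsub>H\<^esub>"]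
  by (metis H.M.l_zero H.M.zero_closed K.M.add.l_cancel_one')

lemma bop_diff:
  assumes T: "T \<in> bounded_ops H K" and x: "x \<in> carrier H" and y: "y \<in> carrier H"
  shows "T (x \<ominus>\<^bsub>H\<^esub> y) = T x \<ominus>\<^bsub>K\<^esub> T y"
proof -
  have e: "x \<ominus>\<^bsub>H\<^esub> y = x \<oplus>\<^bsub>H\<^esub> (-1) \<odot>\<^bsub>H\<^esub> y"
    using x y by (intro H.inner_ext) (simp_all add: H.ip_simps)
  have "T (x \<ominus>\<^bsub>H\<^esub> y) = T x \<oplus>\<^bsub>K\<^esub> (-1) \<odot>\<^bsub>K\<^esub> T y"
    using T x y by (simp add: e bop_add bop_smult)
  also have "\<dots> = T x \<ominus>\<^bsub>K\<^esub> T y"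
    using T x y by (intro K.inner_ext) (simp_all add: K.ip_simps)
  finally show ?thesis .
qed

lemma bop_boundE:
  assumes "T \<in> bounded_ops H K"
  obtains c where "0 \<le> c" "\<And>x. x \<in> carrier H \<Longrightarrow> hnorm K (T x) \<le> c * hnorm H x"
proof -
  obtain c where c: "\<And>x. x \<in> carrier H \<Longrightarrow> hnorm K (T x) \<le> c * hnorm H x"
    using assms by (auto simp: bounded_ops_def)
  have "hnorm K (T x) \<le> max c 0 * hnorm H x" if "x \<in> carrier H" for x
    using c[OF that] mult_right_mono[of c "max c 0" "hnorm H x"] that by simp
  then show ?thesis using that[of "max c 0"] by simp
qed

lemma bopI:
  assumes "\<And>x. x \<in> carrier H \<Longrightarrow> f x \<in> carrier K"
    and "\<And>x y. x \<in> carrier H \<Longrightarrow> y \<in> carrier H \<Longrightarrow> f (x \<oplus>\<^bsub>H\<^esub> y) = f x \<oplus>\<^bsub>K\<^esub> f y"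
    and "\<And>a x. x \<in> carrier H \<Longrightarrow> f (a \<odot>\<^bsub>H\<^esub> x) = a \<odot>\<^bsub>K\<^esub> f x"
    and "\<And>x. x \<in> carrier H \<Longrightarrow> hnorm K (f x) \<le> c * hnorm H x"
  shows "(\<lambda>x\<in>carrier H. f x) \<in> bounded_ops H K"
proof -
  have "\<exists>c. \<forall>x\<in>carrier H. hnorm K (f x) \<le> c * hnorm H x" using assms(4) by blast
  then show ?thesis using assms(1-3)
    by (auto simp: bounded_ops_def LinearCombinations.module_hom_def simp del: bop_in_pair)
qed

text \<open>A map with an adjoint is linear, so only boundedness has to be checked.\<close>

lemma bop_adjointI:
  assumes f: "\<And>x. x \<in> carrier H \<Longrightarrow> f x \<in> carrier K"
    and g: "\<And>y. y \<in> carrier K \<Longrightarrow> g y \<in> carrier H"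
    and adj: "\<And>x y. x \<in> carrier H \<Longrightarrow> y \<in> carrier K \<Longrightarrow> cinner K (f x) y = cinner H x (g y)"
    and bd: "\<And>x. x \<in> carrier H \<Longrightarrow> hnorm K (f x) \<le> c * hnorm H x"
  shows "(\<lambda>x\<in>carrier H. f x) \<in> bounded_ops H K"
proof (rule bopI[OF f _ _ bd])
  show "f (x \<oplus>\<^bsub>H\<^esub> y) = f x \<oplus>\<^bsub>K\<^esub> f y" if "x \<in> carrier H" "y \<in> carrier H" for x y
    using that f g by (intro K.inner_ext) (simp_all add: K.ip_simps H.ip_simps adj)
  show "f (a \<odot>\<^bsub>H\<^esub> x) = a \<odot>\<^bsub>K\<^esub> f x" if "x \<in> carrier H" for a x
    using that f g by (intro K.inner_ext) (simp_all add: K.ip_simps H.ip_simps adj)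
qed

text \<open>At \<open>x = w\<close> the adjoint relation gives
  \<open>\<parallel>w\<parallel>^2 = Re <T w, y>\<close>, and one factor
  \<open>\<parallel>w\<parallel>\<close> cancels. Speaking of a single vector \<open>w\<close>
  rather than of an adjoint operator lets the bound take part in the construction of that
  operator.\<close>

lemma adj_bound:
  assumes T: "T \<in> bounded_ops H K" and c: "0 \<le> c"
    and b: "\<And>x. x \<in> carrier H \<Longrightarrow> hnorm K (T x) \<le> c * hnorm H x"
    and y: "y \<in> carrier K" and w: "w \<in> carrier H"
    and adj: "\<And>x. x \<in> carrier H \<Longrightarrow> cinner K (T x) y = cinner H x w"
  shows "hnorm H w \<le> c * hnorm K y"
proof (cases "hnorm H w = 0")
  case True
  then show ?thesis using c y by simp
next
  case False
  then have pos: "0 < hnorm H w" using H.hnorm_ge[OF w] by linarith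
  have "(hnorm H w)\<^sup>2 = Re (cinner K (T w) y)"
    using w by (simp add: adj H.hnorm_sq)
  also have "\<dots> \<le> hnorm K (T w) * hnorm K y"
    using K.cauchy_schwarz[of "T w" y] complex_Re_le_cmod order_trans T w y by (meson bop_in_pair)
  also have "\<dots> \<le> (c * hnorm H w) * hnorm K y"
    using b w y by (simp add: mult_right_mono)
  finally have "hnorm H w * hnorm H w \<le> hnorm H w * (c * hnorm K y)"
    by (simp add: power2_eq_square mult_ac)
  then show ?thesis using pos by simp
qed

lemma adj_unique:
  assumes "S \<in> bounded_ops K H" "S' \<in> bounded_ops K H"
    "\<And>x y. x \<in> carrier H \<Longrightarrow> y \<in> carrier K \<Longrightarrow> cinner H x (S y) = cinner H x (S' y)"
  shows "S = S'"
proof (rule bop_eqI[OF assms(1,2)])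
  fix y assume y: "y \<in> carrier K"
  show "S y = S' y"
  proof (rule H.inner_ext)
    fix z assume z: "z \<in> carrier H"
    show "cinner H (S y) z = cinner H (S' y) z"
      using assms(3)[OF z y] z H.cinner_commute[of z "S y"] H.cinner_commute[of z "S' y"]
        bop_in[OF assms(1) y] bop_in[OF assms(2) y] by simp
  qed (rule bop_in[OF assms(1) y] bop_in[OF assms(2) y])+
qed

end

text \<open>The value of the adjoint at \<open>y\<close> is the Riesz vector of the bounded
  functional sending \<open>x\<close> to \<open><T x, y>\<close>.\<close>

lemma (in hilbert_pair) ex_adj:
  assumes T: "T \<in> bounded_ops H K"
  shows "\<exists>S\<in>bounded_ops K H. \<forall>x\<in>carrier H. \<forall>y\<in>carrier K. cinner K (T x) y = cinner H x (S y)"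
proof -
  interpret KH: hilbert_pair K H ..
  obtain c where c: "0 \<le> c" "\<And>x. x \<in> carrier H \<Longrightarrow> hnorm K (T x) \<le> c * hnorm H x"
    using bop_boundE[OF T] by blast
  have "\<exists>w\<in>carrier H. \<forall>x\<in>carrier H. cinner K (T x) y = cinner H x w" if y: "y \<in> carrier K" for y
  proof (rule H.riesz)
    show "cmod (cinner K (T x) y) \<le> (c * hnorm K y) * hnorm H x" if x: "x \<in> carrier H" for x
    proof -
      have "cmod (cinner K (T x) y) \<le> hnorm K (T x) * hnorm K y"
        using T x y by (intro K.cauchy_schwarz) simp_all
      also have "\<dots> \<le> (c * hnorm H x) * hnorm K y" using c x y by (simp add: mult_right_mono)
      finally show ?thesis by (simp add: mult_ac)
    qed
  qed (use T y in \<open>simp_all add: bop_add bop_smult K.ip_simps\<close>)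
  then obtain g where g: "\<And>y. y \<in> carrier K \<Longrightarrow> g y \<in> carrier H"
    and adj: "\<And>x y. x \<in> carrier H \<Longrightarrow> y \<in> carrier K \<Longrightarrow> cinner K (T x) y = cinner H x (g y)"
    by metis
  have "(\<lambda>y\<in>carrier K. g y) \<in> bounded_ops K H"
  proof (rule KH.bop_adjointI)
    show "cinner H (g y) x = cinner K y (T x)" if "y \<in> carrier K" "x \<in> carrier H" for x y
      using that T g adj[of x y] H.cinner_commute[of x "g y"] K.cinner_commute[of "T x" y] by simp
    show "hnorm H (g y) \<le> c * hnorm K y" if "y \<in> carrier K" for y
      using adj_bound[OF T c that g[OF that]] adj that by blast
  qed (use g T in simp_all)
  then show ?thesis using adj by (intro bexI[of _ "\<lambda>y\<in>carrier K. g y"]) auto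
qed

context hilbert_pair
begin

text \<open>The adjoint is a definite description; this lemma is how concrete adjoints are
  computed.\<close>

lemma op_adj_eqI:
  assumes S: "S \<in> bounded_ops K H"
    and adj: "\<And>x y. x \<in> carrier H \<Longrightarrow> y \<in> carrier K \<Longrightarrow> cinner K (T x) y = cinner H x (S y)"
  shows "op_adj H K T = S"
  unfolding op_adj_def
proof (rule the_equality)
  show "S' = S" if "S' \<in> bounded_ops K H \<and>
      (\<forall>x\<in>carrier H. \<forall>y\<in>carrier K. cinner K (T x) y = cinner H x (S' y))" for S'
    using that S adj by (intro adj_unique) auto
qed (use S adj in auto)

lemma op_adj_in [simp]: "T \<in> bounded_ops H K \<Longrightarrow> op_adj H K T \<in> bounded_ops K H"
  and cinner_op_adj: "\<lbrakk>T \<in> bounded_ops H K; x \<in> carrier H; y \<in> carrier K\<rbrakk>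
        \<Longrightarrow> cinner H x (op_adj H K T y) = cinner K (T x) y"
  using ex_adj[of T] op_adj_eqI[of _ T] by metis+

lemma op_adj_app_in [simp]: "T \<in> bounded_ops H K \<Longrightarrow> y \<in> carrier K \<Longrightarrow> op_adj H K T y \<in> carrier H"
  by (rule bop_in[OF op_adj_in])

lemma cinner_op_adj_left:
  "\<lbrakk>T \<in> bounded_ops H K; x \<in> carrier H; y \<in> carrier K\<rbrakk>
        \<Longrightarrow> cinner H (op_adj H K T y) x = cinner K y (T x)"
  using cinner_op_adj[of T x y] H.cinner_commute[of x "op_adj H K T y"]
    K.cinner_commute[of "T x" y] bop_in[of "op_adj H K T" K H y] bop_in[of T H K x]
  by simp

lemma hnorm_op_adj:
  assumes "T \<in> bounded_ops H K" "0 \<le> c" "\<And>x. x \<in> carrier H \<Longrightarrow> hnorm K (T x) \<le> c * hnorm H x"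
    "y \<in> carrier K"
  shows "hnorm H (op_adj H K T y) \<le> c * hnorm K y"
proof (rule adj_bound[OF assms])
  show "op_adj H K T y \<in> carrier H" using bop_in[OF op_adj_in] assms(1,4) .
qed (use assms in \<open>simp_all add: cinner_op_adj\<close>)

lemma op_norm_le:
  assumes "0 \<le> c" "\<And>x. x \<in> carrier H \<Longrightarrow> hnorm K (T x) \<le> c * hnorm H x"
  shows "op_norm H K T \<le> c"
  unfolding op_norm_def
proof (rule cSup_least)
  show "{hnorm K (T x) |x. x \<in> carrier H \<and> hnorm H x \<le> 1} \<noteq> {}"
    using H.M.zero_closed H.hnorm_zero by force
next
  fix r assume "r \<in> {hnorm K (T x) |x. x \<in> carrier H \<and> hnorm H x \<le> 1}"
  then show "r \<le> c" using assms mult_left_le[of _ c] order_trans by (fastforce)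
qed

lemma hnorm_le_op_norm:
  assumes T: "T \<in> bounded_ops H K" and x: "x \<in> carrier H"
  shows "hnorm K (T x) \<le> op_norm H K T * hnorm H x"
proof (cases "hnorm H x = 0")
  case True
  then show ?thesis using T x by (simp add: H.hnorm_eq_0 bop_zero)
next
  case False
  then have pos: "0 < hnorm H x" using H.hnorm_ge[OF x] by linarith
  obtain c where c: "0 \<le> c" "\<And>x. x \<in> carrier H \<Longrightarrow> hnorm K (T x) \<le> c * hnorm H x"
    using bop_boundE[OF T] by blast
  let ?y = "complex_of_real (inverse (hnorm H x)) \<odot>\<^bsub>H\<^esub> x"
  have "hnorm K (T ?y) \<le> op_norm H K T"
    unfolding op_norm_def
  proof (rule cSup_upper)
    show "hnorm K (T ?y) \<in> {hnorm K (T x) |x. x \<in> carrier H \<and> hnorm H x \<le> 1}"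
      using pos x by (intro CollectI exI[of _ ?y]) (simp add: H.hnorm_smult norm_inverse)
    show "bdd_above {hnorm K (T x) |x. x \<in> carrier H \<and> hnorm H x \<le> 1}"
      using c mult_left_le[of _ c] by (intro bdd_aboveI[of _ c]) fastforce
  qed
  then have "inverse (hnorm H x) * hnorm K (T x) \<le> op_norm H K T"
    using T x pos by (simp add: bop_smult K.hnorm_smult norm_inverse)
  then show ?thesis using pos by (simp add: field_simps)
qed

lemma op_norm_ge: "T \<in> bounded_ops H K \<Longrightarrow> 0 \<le> op_norm H K T"
proof -
  assume T: "T \<in> bounded_ops H K"
  obtain c where c: "0 \<le> c" "\<And>x. x \<in> carrier H \<Longrightarrow> hnorm K (T x) \<le> c * hnorm H x"
    using bop_boundE[OF T] by blast
  show ?thesis unfolding op_norm_def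
  proof (rule cSup_upper)
    show "0 \<in> {hnorm K (T x) |x. x \<in> carrier H \<and> hnorm H x \<le> 1}"
      using T by (intro CollectI exI[of _ "\<zero>\<^bsub>H\<^esub>"]) (simp add: bop_zero)
    show "bdd_above {hnorm K (T x) |x. x \<in> carrier H \<and> hnorm H x \<le> 1}"
      using c mult_left_le[of _ c] by (intro bdd_aboveI[of _ c]) fastforce
  qed
qed

lemma isometryI:
  assumes "V \<in> bounded_ops H K" "\<And>x y. x \<in> carrier H \<Longrightarrow> y \<in> carrier H \<Longrightarrow> cinner K (V x) (V y) = cinner H x y"
  shows "isometry H K V"
  using assms by (simp add: isometry_def hnorm_def)

end

section \<open>Algebra of bounded operators, generated C*-algebras, normality\<close>

context hilbert_space
begin

sublocale HH: hilbert_pair H H ..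

lemmas adj_simps = HH.cinner_op_adj HH.cinner_op_adj_left

lemma op_comp_in [simp]:
  assumes S: "S \<in> bounded_ops H H" and T: "T \<in> bounded_ops H H"
  shows "op_comp H S T \<in> bounded_ops H H"
proof -
  obtain c where c: "0 \<le> c" "\<And>x. x \<in> carrier H \<Longrightarrow> hnorm H (S x) \<le> c * hnorm H x"
    using HH.bop_boundE[OF S] by blast
  obtain d where d: "0 \<le> d" "\<And>x. x \<in> carrier H \<Longrightarrow> hnorm H (T x) \<le> d * hnorm H x"
    using HH.bop_boundE[OF T] by blast
  have "(\<lambda>x\<in>carrier H. S (T x)) \<in> bounded_ops H H"
  proof (rule HH.bopI)
    show "hnorm H (S (T x)) \<le> (c * d) * hnorm H x" if x: "x \<in> carrier H" for x
      using c(2)[of "T x"] d(2)[OF x] T x c(1) mult_left_mono[OF d(2)[OF x] c(1)] by simp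
  qed (use S T in \<open>simp_all add: bop_add bop_smult\<close>)
  then show ?thesis by (simp add: op_comp_def compose_def)
qed

lemma op_add_in [simp]:
  assumes S: "S \<in> bounded_ops H H" and T: "T \<in> bounded_ops H H"
  shows "op_add H S T \<in> bounded_ops H H"
proof -
  obtain c where c: "0 \<le> c" "\<And>x. x \<in> carrier H \<Longrightarrow> hnorm H (S x) \<le> c * hnorm H x"
    using HH.bop_boundE[OF S] by blast
  obtain d where d: "0 \<le> d" "\<And>x. x \<in> carrier H \<Longrightarrow> hnorm H (T x) \<le> d * hnorm H x"
    using HH.bop_boundE[OF T] by blast
  show ?thesis unfolding op_add_def
  proof (rule HH.bop_adjointI)
    show "cinner H (S x \<oplus> T x) y = cinner H x (op_adj H H S y \<oplus> op_adj H H T y)"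
      if "x \<in> carrier H" "y \<in> carrier H" for x y
      using that S T by (simp add: ip_simps adj_simps)
    show "hnorm H (S x \<oplus> T x) \<le> (c + d) * hnorm H x" if x: "x \<in> carrier H" for x
      using hnorm_triangle[of "S x" "T x"] c(2)[OF x] d(2)[OF x] S T x by (simp add: distrib_right)
  qed (use S T in simp_all)
qed

lemma op_scale_in [simp]:
  assumes S: "S \<in> bounded_ops H H"
  shows "op_scale H a S \<in> bounded_ops H H"
proof -
  obtain c where c: "0 \<le> c" "\<And>x. x \<in> carrier H \<Longrightarrow> hnorm H (S x) \<le> c * hnorm H x"
    using HH.bop_boundE[OF S] by blast
  show ?thesis unfolding op_scale_def
  proof (rule HH.bop_adjointI)
    show "cinner H (a \<odot> S x) y = cinner H x (cnj a \<odot> op_adj H H S y)"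
      if "x \<in> carrier H" "y \<in> carrier H" for x y
      using that S by (simp add: ip_simps adj_simps)
    show "hnorm H (a \<odot> S x) \<le> (cmod a * c) * hnorm H x" if x: "x \<in> carrier H" for x
      using c(2)[OF x] S x by (simp add: hnorm_smult mult.assoc mult_left_mono)
  qed (use S in simp_all)
qed

lemma op_id_in [simp]: "op_id H \<in> bounded_ops H H"
  unfolding op_id_def by (rule HH.bopI[where c = 1]) simp_all

lemma bounded_ops_cstar: "unital_cstar_subalgebra H (bounded_ops H H)"
  by (simp add: unital_cstar_subalgebra_def)

lemma cstar_generated_subset: "G \<subseteq> bounded_ops H H \<Longrightarrow> cstar_generated H G \<subseteq> bounded_ops H H"
  using bounded_ops_cstar by (auto simp: cstar_generated_def)

lemma cstar_generated_cstar:
  assumes "G \<subseteq> bounded_ops H H"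
  shows "unital_cstar_subalgebra H (cstar_generated H G)"
proof -
  have "T \<in> cstar_generated H G"
    if T: "T \<in> bounded_ops H H"
      and l: "\<forall>e>0. \<exists>S\<in>cstar_generated H G. op_norm H H (op_add H T (op_scale H (-1) S)) < e" for T
    unfolding cstar_generated_def
  proof (rule InterI)
    fix A assume A: "A \<in> {A. unital_cstar_subalgebra H A \<and> G \<subseteq> A}"
    then have "cstar_generated H G \<subseteq> A" by (auto simp: cstar_generated_def)
    then have "\<forall>e>0. \<exists>S\<in>A. op_norm H H (op_add H T (op_scale H (-1) S)) < e" using l by blast
    then show "T \<in> A" using A T by (auto simp: unital_cstar_subalgebra_def)
  qed
  moreover have "cstar_generated H G \<subseteq> bounded_ops H H" by (rule cstar_generated_subset[OF assms])
  ultimately show ?thesis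
    unfolding unital_cstar_subalgebra_def[of H "cstar_generated H G"]
    by (simp add: cstar_generated_iff cstar_id cstar_add cstar_comp cstar_scale cstar_adj)
qed

lemma cstar_generated_incl: "G \<subseteq> cstar_generated H G"
  by (auto simp: cstar_generated_def)

text \<open>Normality as the equality of two sesquilinear forms. It suits operators for which both
  forms can be computed but the products with the adjoint are unwieldy.\<close>

lemma normal_opI:
  assumes T: "T \<in> bounded_ops H H"
    and n: "\<And>x y. x \<in> carrier H \<Longrightarrow> y \<in> carrier H \<Longrightarrow>
      cinner H (T x) (T y) = cinner H (op_adj H H T x) (op_adj H H T y)"
  shows "normal_op H T"
  unfolding normal_op_def
proof (intro conjI T bop_eqI[where H = H and K = H])
  fix x assume x: "x \<in> carrier H"
  have "op_adj H H T (T x) = T (op_adj H H T x)"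
  proof (rule inner_ext)
    fix z assume z: "z \<in> carrier H"
    have "cinner H (op_adj H H T x) (op_adj H H T z) = cinner H (T (op_adj H H T x)) z"
      using T x z HH.cinner_op_adj[OF T, of "op_adj H H T x" z] by simp
    then show "cinner H (op_adj H H T (T x)) z = cinner H (T (op_adj H H T x)) z"
      using T x z n[OF x z] by (simp add: HH.cinner_op_adj_left)
  qed (use T x in simp_all)
  then show "op_comp H (op_adj H H T) T x = op_comp H T (op_adj H H T) x" using x by simp
qed (use T in simp_all)

lemma normal_op_app:
  "normal_op H T \<Longrightarrow> x \<in> carrier H \<Longrightarrow> op_adj H H T (T x) = T (op_adj H H T x)"
  by (metis normal_op_def op_comp_app)

lemma op_adj_invol: "T \<in> bounded_ops H H \<Longrightarrow> op_adj H H (op_adj H H T) = T"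
  by (rule HH.op_adj_eqI) (simp_all add: adj_simps)

lemma normal_op_cinner:
  assumes "normal_op H T" "x \<in> carrier H" "y \<in> carrier H"
  shows "cinner H (op_adj H H T x) (op_adj H H T y) = cinner H (T x) (T y)"
proof -
  have T: "T \<in> bounded_ops H H" using assms by (simp add: normal_op_def)
  have "cinner H (op_adj H H T x) (op_adj H H T y) = cinner H (T (op_adj H H T x)) y"
    using T assms HH.cinner_op_adj[OF T, of "op_adj H H T x" y] by simp
  also have "\<dots> = cinner H (op_adj H H T (T x)) y"
    using assms by (simp add: normal_op_app)
  also have "\<dots> = cinner H (T x) (T y)"
    using T assms by (simp add: HH.cinner_op_adj_left)
  finally show ?thesis .
qed

end

text \<open>Testing \<open>V^* N V = X\<close> against vectors removes the adjoint of
  \<open>V\<close>; \<open>dilationE\<close> is the converse translation.\<close>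

lemma (in hilbert_pair) dilationI:
  assumes len: "length N = length X" and iso: "isometry H K V"
    and X: "\<And>i. i < length X \<Longrightarrow> X ! i \<in> bounded_ops H H"
    and N: "\<And>i. i < length X \<Longrightarrow> N ! i \<in> bounded_ops K K"
    and dil: "\<And>i x y. i < length X \<Longrightarrow> x \<in> carrier H \<Longrightarrow> y \<in> carrier H \<Longrightarrow>
      cinner K ((N ! i) (V x)) (V y) = cinner H ((X ! i) x) y"
  shows "dilation H K X N"
  unfolding dilation_def
proof (intro conjI len exI[of _ V] iso allI impI)
  fix i assume i: "i < length X"
  have V: "V \<in> bounded_ops H K" using iso by (simp add: isometry_def)
  have app: "op_comp H (op_adj H K V) (op_comp H (N ! i) V) =
      (\<lambda>x\<in>carrier H. op_adj H K V ((N ! i) (V x)))"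
    by (auto simp: op_comp_def compose_def)
  show "X ! i = op_comp H (op_adj H K V) (op_comp H (N ! i) V)"
  proof (rule extensionalityI)
    show "X ! i \<in> extensional (carrier H)" using X[OF i] by (simp add: bounded_ops_def)
    show "op_comp H (op_adj H K V) (op_comp H (N ! i) V) \<in> extensional (carrier H)"
      by (simp add: app)
    fix x assume x: "x \<in> carrier H"
    have NV: "(N ! i) (V x) \<in> carrier K" using N[OF i] V x by simp
    have "(X ! i) x = op_adj H K V ((N ! i) (V x))"
      using X[OF i] V x NV bop_in[OF op_adj_in[OF V] NV]
      by (intro H.inner_ext) (simp_all add: cinner_op_adj_left dil i)
    then show "(X ! i) x = op_comp H (op_adj H K V) (op_comp H (N ! i) V) x"
      using x by (simp add: app)
  qed
qed

lemma (in hilbert_pair) dilationE: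
  assumes "dilation H K X N" "\<And>i. i < length X \<Longrightarrow> N ! i \<in> bounded_ops K K"
  obtains V where "isometry H K V" "\<And>i x y. i < length X \<Longrightarrow> x \<in> carrier H \<Longrightarrow> y \<in> carrier H \<Longrightarrow>
      cinner K ((N ! i) (V x)) (V y) = cinner H ((X ! i) x) y"
proof -
  obtain V where iso: "isometry H K V"
    and X: "\<And>i. i < length X \<Longrightarrow> X ! i = op_comp H (op_adj H K V) (op_comp H (N ! i) V)"
    using assms(1) by (auto simp: dilation_def)
  have V: "V \<in> bounded_ops H K" using iso by (simp add: isometry_def)
  have "cinner K ((N ! i) (V x)) (V y) = cinner H ((X ! i) x) y"
    if "i < length X" "x \<in> carrier H" "y \<in> carrier H" for i x y
    using assms(2)[OF that(1)] V that by (simp add: X cinner_op_adj_left)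
  then show ?thesis using that iso by blast
qed

section \<open>Square roots\<close>

primrec sq_iter :: "'a cinner_space \<Rightarrow> ('a \<Rightarrow> 'a) \<Rightarrow> nat \<Rightarrow> 'a \<Rightarrow> 'a" where
  "sq_iter H P 0 = (\<lambda>x. \<zero>\<^bsub>H\<^esub>)"
| "sq_iter H P (Suc n) = (\<lambda>x. (1/2) \<odot>\<^bsub>H\<^esub> (P x \<oplus>\<^bsub>H\<^esub> sq_iter H P n (sq_iter H P n x)))"

text \<open>The iteration of \<open>sq_iter\<close> for the scalar \<open>P = 1\<close>. The
  iterates and their successive differences are polynomials in \<open>P\<close> with nonnegative
  coefficients, so for a contraction their norms are dominated by the values at 1. Convergence of
  the operators thus reduces to that of a bounded monotone sequence of reals.\<close>

primrec sq_bound :: "nat \<Rightarrow> real" where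
  "sq_bound 0 = 0"
| "sq_bound (Suc n) = (1 + (sq_bound n)\<^sup>2) / 2"

definition sq_lim :: "'a cinner_space \<Rightarrow> ('a \<Rightarrow> 'a) \<Rightarrow> 'a \<Rightarrow> 'a" where
  "sq_lim H P x = (SOME l. l \<in> carrier H \<and> (\<lambda>n. hnorm H (sq_iter H P n x \<ominus>\<^bsub>H\<^esub> l)) \<longlonglongrightarrow> 0)"

text \<open>A square root of \<open>1 - P\<close>: the limit \<open>Y\<close> of the iteration solves \<open>2 Y = P + Y\<^sup>2\<close>, that is,
  \<open>(1 - Y)\<^sup>2 = 1 - P\<close>.\<close>

definition defect_root :: "'a cinner_space \<Rightarrow> ('a \<Rightarrow> 'a) \<Rightarrow> 'a \<Rightarrow> 'a" where
  "defect_root H P = (\<lambda>x\<in>carrier H. x \<ominus>\<^bsub>H\<^esub> sq_lim H P x)"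

lemma sq_bound_range: "0 \<le> sq_bound n \<and> sq_bound n \<le> 1"
proof (induction n)
  case (Suc n)
  then show ?case using power_le_one[of "sq_bound n" 2] by simp
qed simp

lemma sq_bound_mono: "sq_bound n \<le> sq_bound (Suc n)"
proof -
  have "0 \<le> (1 - sq_bound n)\<^sup>2" by simp
  then show ?thesis by (simp add: power2_diff)
qed

lemma sq_bound_convergent: "convergent sq_bound"
proof (rule Bseq_monoseq_convergent)
  show "Bseq sq_bound" using sq_bound_range by (intro BseqI'[of _ 1]) simp
  show "monoseq sq_bound" using sq_bound_mono by (simp add: monoseq_Suc)
qed

locale sa_contraction = hilbert_space +
  fixes P
  assumes P_in: "P \<in> bounded_ops H H"
    and P_sa: "\<And>x y. x \<in> carrier H \<Longrightarrow> y \<in> carrier H \<Longrightarrow> cinner H (P x) y = cinner H x (P y)"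
    and P_contr: "\<And>x. x \<in> carrier H \<Longrightarrow> hnorm H (P x) \<le> hnorm H x"
begin

abbreviation "Y \<equiv> sq_iter H P"

lemma P_carrier [simp]: "x \<in> carrier H \<Longrightarrow> P x \<in> carrier H"
  using P_in by simp

lemma Y_in [simp]: "x \<in> carrier H \<Longrightarrow> Y n x \<in> carrier H"
  by (induction n arbitrary: x) simp_all

lemma Y_sa: "x \<in> carrier H \<Longrightarrow> y \<in> carrier H \<Longrightarrow> cinner H (Y n x) y = cinner H x (Y n y)"
  by (induction n arbitrary: x y) (simp_all add: ip_simps P_sa)

lemma Y_diff: "x \<in> carrier H \<Longrightarrow> y \<in> carrier H \<Longrightarrow> Y n (x \<ominus> y) = Y n x \<ominus> Y n y"
  by (rule inner_ext) (simp_all add: Y_sa ip_simps)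

lemma Y_bound: "x \<in> carrier H \<Longrightarrow> hnorm H (Y n x) \<le> sq_bound n * hnorm H x"
proof (induction n arbitrary: x)
  case (Suc n)
  have "hnorm H (Y n (Y n x)) \<le> sq_bound n * hnorm H (Y n x)" using Suc by simp
  also have "\<dots> \<le> sq_bound n * (sq_bound n * hnorm H x)"
    using Suc sq_bound_range by (intro mult_left_mono) auto
  finally have "hnorm H (Y n (Y n x)) \<le> (sq_bound n)\<^sup>2 * hnorm H x"
    by (simp add: power2_eq_square mult.assoc)
  then have "hnorm H (P x \<oplus> Y n (Y n x)) \<le> hnorm H x + (sq_bound n)\<^sup>2 * hnorm H x"
    using hnorm_triangle[of "P x" "Y n (Y n x)"] P_contr[of x] Suc.prems by simp
  then show ?case using Suc.prems by (simp add: hnorm_smult field_simps)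
qed simp

text \<open>With \<open>A = Y (n + 1)\<close> and \<open>B = Y n\<close> the next difference is
  \<open>(A^2 - B^2) / 2 = (A (A - B) + (A - B) B) / 2\<close>. Bounding the factors reproduces the
  recursion for the differences of \<open>sq_bound\<close>. The second summand calls for the
  induction hypothesis at the vector \<open>B x\<close>.\<close>

lemma Y_step:
  "x \<in> carrier H \<Longrightarrow> hnorm H (Y (Suc n) x \<ominus> Y n x) \<le> (sq_bound (Suc n) - sq_bound n) * hnorm H x"
proof (induction n arbitrary: x)
  case 0
  have "Y (Suc 0) x \<ominus> Y 0 x = (1/2) \<odot> P x"
    using 0 by (intro inner_ext) (simp_all add: ip_simps)
  then show ?case using P_contr[OF 0] 0 by (simp add: hnorm_smult del: sq_iter.simps)
next
  case (Suc n)
  let ?A = "Y (Suc n)" and ?B = "Y n" and ?d = "Y (Suc n) x \<ominus> Y n x"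
  let ?a = "sq_bound (Suc n)" and ?b = "sq_bound n"
  have x: "x \<in> carrier H" by (rule Suc.prems)
  have d: "?d \<in> carrier H" and Ax: "?A x \<in> carrier H" and Bx: "?B x \<in> carrier H"
    using x by (blast intro: minus_in Y_in)+
  have e: "Y (Suc (Suc n)) x \<ominus> ?A x = (1/2) \<odot> (?A ?d \<oplus> (?A (?B x) \<ominus> ?B (?B x)))"
  proof -
    have r: "Y (Suc (Suc n)) x = (1/2) \<odot> (P x \<oplus> ?A (?A x))"
      "?A x = (1/2) \<odot> (P x \<oplus> ?B (?B x))" by simp_all
    have "Y (Suc (Suc n)) x \<ominus> ?A x = (1/2) \<odot> (?A (?A x) \<ominus> ?B (?B x))"
      by (rule inner_ext) (simp_all add: ip_simps r(1) r(2)[symmetric] x Ax Bx d algebra_simps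
          del: sq_iter.simps, simp add: r(2) ip_simps x Ax Bx del: sq_iter.simps)
    also have "\<dots> = (1/2) \<odot> (?A ?d \<oplus> (?A (?B x) \<ominus> ?B (?B x)))"
      by (rule inner_ext) (simp_all add: ip_simps Y_diff x Ax Bx d algebra_simps del: sq_iter.simps)
    finally show ?thesis .
  qed
  have "hnorm H (?A ?d) \<le> ?a * hnorm H ?d" by (rule Y_bound[OF d])
  also have "\<dots> \<le> ?a * ((?a - ?b) * hnorm H x)"
    using Suc.IH[OF x] sq_bound_range[of "Suc n"] by (intro mult_left_mono) blast+
  finally have 1: "hnorm H (?A ?d) \<le> ?a * ((?a - ?b) * hnorm H x)" .
  have "hnorm H (?A (?B x) \<ominus> ?B (?B x)) \<le> (?a - ?b) * hnorm H (?B x)" by (rule Suc.IH[OF Bx])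
  also have "\<dots> \<le> (?a - ?b) * (?b * hnorm H x)"
    using Y_bound[OF x, of n] sq_bound_mono[of n] by (intro mult_left_mono) simp_all
  finally have 2: "hnorm H (?A (?B x) \<ominus> ?B (?B x)) \<le> (?a - ?b) * (?b * hnorm H x)" .
  have "hnorm H (Y (Suc (Suc n)) x \<ominus> ?A x)
      \<le> (1/2) * (hnorm H (?A ?d) + hnorm H (?A (?B x) \<ominus> ?B (?B x)))"
    unfolding e using hnorm_triangle[of "?A ?d" "?A (?B x) \<ominus> ?B (?B x)"] d Ax Bx
    by (simp add: hnorm_smult del: sq_iter.simps)
  also have "\<dots> \<le> (1/2) * (?a * ((?a - ?b) * hnorm H x) + (?a - ?b) * (?b * hnorm H x))"
    using 1 2 by simp
  also have "\<dots> = (1/2) * (?a\<^sup>2 - ?b\<^sup>2) * hnorm H x"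
    by (simp add: power2_eq_square algebra_simps del: sq_bound.simps)
  also have "(1/2) * (?a\<^sup>2 - ?b\<^sup>2) = sq_bound (Suc (Suc n)) - sq_bound (Suc n)"
    unfolding sq_bound.simps(2)[of "Suc n"] sq_bound.simps(2)[of n] by (simp add: field_simps)
  finally show ?case .
qed

lemma Y_cauchy:
  assumes x: "x \<in> carrier H" and "n \<le> k"
  shows "hnorm H (Y k x \<ominus> Y n x) \<le> (sq_bound k - sq_bound n) * hnorm H x"
  using \<open>n \<le> k\<close>
proof (induction k rule: dec_induct)
  case base
  have "Y n x \<ominus> Y n x = \<zero>" using x by (simp add: a_minus_def r_neg)
  then show ?case by simp
next
  case (step k)
  have "hnorm H (Y (Suc k) x \<ominus> Y n x) \<le> hnorm H (Y (Suc k) x \<ominus> Y k x) + hnorm H (Y k x \<ominus> Y n x)"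
    using x by (intro hnorm_triangle_diff Y_in)
  also have "\<dots> \<le> (sq_bound (Suc k) - sq_bound k) * hnorm H x + (sq_bound k - sq_bound n) * hnorm H x"
    using step.IH Y_step[OF x] by (intro add_mono)
  finally show ?case by (simp only: left_diff_distrib)
qed

lemma sq_lim: "x \<in> carrier H \<Longrightarrow> sq_lim H P x \<in> carrier H"
  and sq_lim_tendsto: "x \<in> carrier H \<Longrightarrow> (\<lambda>n. hnorm H (Y n x \<ominus> sq_lim H P x)) \<longlonglongrightarrow> 0"
proof -
  assume x: "x \<in> carrier H"
  have cau: "\<exists>M. \<forall>i\<ge>M. \<forall>j\<ge>M. hnorm H (Y i x \<ominus> Y j x) < e" if e: "0 < e" for e
  proof -
    have "Cauchy sq_bound" using sq_bound_convergent by (simp add: Cauchy_convergent_iff)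
    moreover have pos: "0 < e / (hnorm H x + 1)" using e x by (simp add: add_nonneg_pos)
    ultimately obtain M where M: "\<And>i j. i \<ge> M \<Longrightarrow> j \<ge> M \<Longrightarrow> dist (sq_bound i) (sq_bound j) < e / (hnorm H x + 1)"
      unfolding Cauchy_def by blast
    have key: "hnorm H (Y i x \<ominus> Y j x) < e" if "i \<ge> M" "j \<ge> M" "j \<le> i" for i j
    proof -
      have "hnorm H (Y i x \<ominus> Y j x) \<le> (sq_bound i - sq_bound j) * hnorm H x"
        by (rule Y_cauchy[OF x that(3)])
      also have "\<dots> \<le> (e / (hnorm H x + 1)) * hnorm H x"
        using M[OF that(1,2)] x by (intro mult_right_mono) (auto simp: dist_real_def)
      also have "\<dots> < e"
        using e hnorm_ge[OF x] by (simp add: pos_divide_less_eq add_nonneg_pos distrib_left)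
      finally show ?thesis .
    qed
    then show ?thesis using hnorm_minus_commute[OF Y_in[OF x] Y_in[OF x]] by (metis nle_le)
  qed
  have "\<exists>l\<in>carrier H. (\<lambda>n. hnorm H (Y n x \<ominus> l)) \<longlonglongrightarrow> 0"
    by (rule complete[OF Y_in[OF x] cau])
  then have "\<exists>l. l \<in> carrier H \<and> (\<lambda>n. hnorm H (Y n x \<ominus> l)) \<longlonglongrightarrow> 0" by blast
  from someI_ex[OF this]
  show "sq_lim H P x \<in> carrier H" "(\<lambda>n. hnorm H (Y n x \<ominus> sq_lim H P x)) \<longlonglongrightarrow> 0"
    unfolding sq_lim_def by blast+
qed

lemma tendsto_const_vec: "x \<in> carrier H \<Longrightarrow> (\<lambda>n. hnorm H (x \<ominus> x)) \<longlonglongrightarrow> 0"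
  by (simp add: a_minus_def r_neg)

lemma sq_lim_sa:
  assumes x: "x \<in> carrier H" and y: "y \<in> carrier H"
  shows "cinner H (sq_lim H P x) y = cinner H x (sq_lim H P y)"
proof (rule LIMSEQ_unique)
  show "(\<lambda>n. cinner H (Y n x) y) \<longlonglongrightarrow> cinner H (sq_lim H P x) y"
    by (rule cinner_tendsto) (use x y sq_lim sq_lim_tendsto tendsto_const_vec in auto)
  have "(\<lambda>n. cinner H x (Y n y)) \<longlonglongrightarrow> cinner H x (sq_lim H P y)"
    by (rule cinner_tendsto) (use x y sq_lim sq_lim_tendsto tendsto_const_vec in auto)
  then show "(\<lambda>n. cinner H (Y n x) y) \<longlonglongrightarrow> cinner H x (sq_lim H P y)"
    by (simp add: Y_sa x y)
qed

text \<open>The recursion passes to the limit in inner products: moving one factor to the other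
  argument turns \<open><Y n (Y n x), y>\<close> into a product of two convergent sequences.\<close>

lemma sq_lim_eq:
  assumes x: "x \<in> carrier H" and y: "y \<in> carrier H"
  shows "2 * cinner H (sq_lim H P x) y = cinner H (P x) y + cinner H (sq_lim H P x) (sq_lim H P y)"
proof (rule LIMSEQ_unique)
  have "(\<lambda>n. cinner H (Y (Suc n) x) y) \<longlonglongrightarrow> cinner H (sq_lim H P x) y"
    by (rule LIMSEQ_Suc, rule cinner_tendsto) (use x y sq_lim sq_lim_tendsto tendsto_const_vec in auto)
  then show "(\<lambda>n. 2 * cinner H (Y (Suc n) x) y) \<longlonglongrightarrow> 2 * cinner H (sq_lim H P x) y"
    by (intro tendsto_mult tendsto_const)
  have "(\<lambda>n. cinner H (Y n x) (Y n y)) \<longlonglongrightarrow> cinner H (sq_lim H P x) (sq_lim H P y)"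
    by (rule cinner_tendsto) (use x y sq_lim sq_lim_tendsto in auto)
  then show "(\<lambda>n. 2 * cinner H (Y (Suc n) x) y)
      \<longlonglongrightarrow> cinner H (P x) y + cinner H (sq_lim H P x) (sq_lim H P y)"
    using x y by (simp add: ip_simps Y_sa[symmetric] tendsto_add add_divide_distrib)
qed

lemma sq_lim_bound:
  assumes x: "x \<in> carrier H"
  shows "hnorm H (sq_lim H P x) \<le> hnorm H x"
proof (rule power2_le_imp_le)
  have "(\<lambda>n. Re (cinner H (Y n x) (Y n x))) \<longlonglongrightarrow> Re (cinner H (sq_lim H P x) (sq_lim H P x))"
    by (intro tendsto_Re cinner_tendsto) (use x sq_lim sq_lim_tendsto in auto)
  then have "Re (cinner H (sq_lim H P x) (sq_lim H P x)) \<le> (hnorm H x)\<^sup>2"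
  proof (rule LIMSEQ_le_const2, intro exI allI impI)
    fix n
    have "hnorm H (Y n x) \<le> hnorm H x"
      using Y_bound[OF x, of n] mult_right_mono[of "sq_bound n" 1 "hnorm H x"] sq_bound_range[of n] x
      by simp
    then show "Re (cinner H (Y n x) (Y n x)) \<le> (hnorm H x)\<^sup>2"
      using x by (simp add: hnorm_sq[symmetric] power_mono)
  qed
  then show "(hnorm H (sq_lim H P x))\<^sup>2 \<le> (hnorm H x)\<^sup>2" using x sq_lim by (simp add: hnorm_sq)
qed (use x in simp)

lemma defect_root_app: "x \<in> carrier H \<Longrightarrow> defect_root H P x = x \<ominus> sq_lim H P x"
  by (simp add: defect_root_def)

lemma defect_root_carrier [simp]: "x \<in> carrier H \<Longrightarrow> defect_root H P x \<in> carrier H"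
  using sq_lim by (simp add: defect_root_app)

lemma defect_root_sa:
  "x \<in> carrier H \<Longrightarrow> y \<in> carrier H \<Longrightarrow> cinner H (defect_root H P x) y = cinner H x (defect_root H P y)"
  using sq_lim by (simp add: defect_root_app ip_simps sq_lim_sa)

lemma defect_root_in: "defect_root H P \<in> bounded_ops H H"
  unfolding defect_root_def
proof (rule HH.bop_adjointI)
  show "cinner H (x \<ominus> sq_lim H P x) y = cinner H x (y \<ominus> sq_lim H P y)"
    if "x \<in> carrier H" "y \<in> carrier H" for x y
    using that sq_lim by (simp add: ip_simps sq_lim_sa)
  show "hnorm H (x \<ominus> sq_lim H P x) \<le> 2 * hnorm H x" if "x \<in> carrier H" for x
    using hnorm_triangle_sub[OF that sq_lim[OF that]] sq_lim_bound[OF that] by simp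
qed (use sq_lim in auto)

lemma defect_root_cinner:
  assumes "x \<in> carrier H" "y \<in> carrier H"
  shows "cinner H (defect_root H P x) (defect_root H P y) = cinner H x y - cinner H (P x) y"
  using assms sq_lim_eq[OF assms] sq_lim sq_lim_sa[OF assms]
  by (simp add: defect_root_app ip_simps)

end

text \<open>\<open>T P = Q T\<close> carries \<open>T\<close> through every iterate, and the limit
  is taken after \<open>T\<close> has been moved over as its adjoint. For \<open>P = T^* T\<close>
  and \<open>Q = T T^*\<close> this intertwines the two defect operators of
  \<open>T\<close>.\<close>

lemma defect_root_intertwine:
  assumes "sa_contraction H P" "sa_contraction H Q" and T: "T \<in> bounded_ops H H"
    and c: "\<And>x. x \<in> carrier H \<Longrightarrow> T (P x) = Q (T x)" and x: "x \<in> carrier H"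
  shows "T (defect_root H P x) = defect_root H Q (T x)"
proof -
  interpret P: sa_contraction H P by fact
  interpret Q: sa_contraction H Q by fact
  have it: "T (sq_iter H P n x) = sq_iter H Q n (T x)" if "x \<in> carrier H" for n x
    using that
  proof (induction n arbitrary: x)
    case 0
    then show ?case using P.HH.bop_zero[OF T] by simp
  next
    case (Suc n)
    then show ?case using T c by (simp add: bop_add bop_smult)
  qed
  have "T (sq_lim H P x) = sq_lim H Q (T x)"
  proof (rule P.inner_ext)
    fix z assume z: "z \<in> carrier H"
    show "cinner H (T (sq_lim H P x)) z = cinner H (sq_lim H Q (T x)) z"
    proof (rule LIMSEQ_unique)
      show "(\<lambda>n. cinner H (sq_iter H Q n (T x)) z) \<longlonglongrightarrow> cinner H (sq_lim H Q (T x)) z"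
        by (rule P.cinner_tendsto) (use x T z Q.sq_lim Q.sq_lim_tendsto P.tendsto_const_vec in auto)
      have "(\<lambda>n. cinner H (sq_iter H P n x) (op_adj H H T z)) \<longlonglongrightarrow> cinner H (sq_lim H P x) (op_adj H H T z)"
        by (rule P.cinner_tendsto) (use x T z P.sq_lim P.sq_lim_tendsto P.tendsto_const_vec in auto)
      then show "(\<lambda>n. cinner H (sq_iter H Q n (T x)) z) \<longlonglongrightarrow> cinner H (T (sq_lim H P x)) z"
        using x z T P.sq_lim by (simp add: P.HH.cinner_op_adj it[symmetric])
    qed
  qed (use x T P.sq_lim Q.sq_lim in auto)
  then show ?thesis
    using x T P.sq_lim by (simp add: P.defect_root_app Q.defect_root_app P.HH.bop_diff)
qed

section \<open>Positive operator valued measures for self-adjoint contractions\<close>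

lemma sum_lessThan_plus: "(\<Sum>s<a+b. f s) = (\<Sum>s<a. f s) + (\<Sum>s<b. f (a + s))"
  for f :: "nat \<Rightarrow> 'b::comm_monoid_add"
  by (induction b) (simp_all add: add.assoc)

text \<open>A finite sample of sign vectors whose moments up to order three are those of independent
  fair signs. Order three enters because a quadratic expression in the signs is later averaged
  against a further sign.\<close>

definition sign_design :: "nat \<Rightarrow> nat \<Rightarrow> (nat \<Rightarrow> nat \<Rightarrow> real) \<Rightarrow> bool" where
  "sign_design m k \<epsilon> \<longleftrightarrow> 0 < k \<and> (\<forall>s j. \<epsilon> s j = 1 \<or> \<epsilon> s j = - 1) \<and>
     (\<forall>j<m. (\<Sum>s<k. \<epsilon> s j) = 0) \<and>
     (\<forall>i<m. \<forall>j<m. (\<Sum>s<k. \<epsilon> s i * \<epsilon> s j) = (if i = j then real k else 0)) \<and>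
     (\<forall>h<m. \<forall>i<m. \<forall>j<m. (\<Sum>s<k. \<epsilon> s h * \<epsilon> s i * \<epsilon> s j) = 0)"

lemma
  assumes "sign_design m k \<epsilon>"
  shows sign_design_pos: "0 < k"
    and sign_design_pm: "\<epsilon> s j = 1 \<or> \<epsilon> s j = - 1"
    and sign_design_1: "j < m \<Longrightarrow> (\<Sum>s<k. \<epsilon> s j) = 0"
    and sign_design_2: "i < m \<Longrightarrow> j < m \<Longrightarrow> (\<Sum>s<k. \<epsilon> s i * \<epsilon> s j) = (if i = j then real k else 0)"
    and sign_design_3: "h < m \<Longrightarrow> i < m \<Longrightarrow> j < m \<Longrightarrow> (\<Sum>s<k. \<epsilon> s h * \<epsilon> s i * \<epsilon> s j) = 0"
  using assms by (simp_all add: sign_design_def)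

text \<open>The sample is doubled, with the new coordinate 1 on the first copy and -1 on the second.
  A moment containing the new coordinate an odd number of times cancels between the copies;
  otherwise it is twice a moment of the old sample.\<close>

lemma ex_sign_design: "\<exists>k \<epsilon>. sign_design m k \<epsilon>"
proof (induction m)
  case 0
  show ?case by (intro exI[of _ 1] exI[of _ "\<lambda>s j. 1"]) (simp add: sign_design_def)
next
  case (Suc m)
  then obtain k \<epsilon> where des: "sign_design m k \<epsilon>" by blast
  note k = sign_design_pos[OF des] and pm = sign_design_pm[OF des] and s1 = sign_design_1[OF des]
    and s2 = sign_design_2[OF des] and s3 = sign_design_3[OF des]
  define \<delta> where "\<delta> s j = (if j < m then \<epsilon> (if s < k then s else s - k) j else if s < k then 1 else - 1)"
    for s j
  have a: "\<delta> s j = (if j < m then \<epsilon> s j else 1)" if "s < k" for s j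
    using that by (simp add: \<delta>_def)
  have b: "\<delta> (k + s) j = (if j < m then \<epsilon> s j else - 1)" for s j
    by (simp add: \<delta>_def)
  have sm: "(\<Sum>s<k+k. F (\<delta> s)) = (\<Sum>s<k. F (\<lambda>j. if j < m then \<epsilon> s j else 1))
      + (\<Sum>s<k. F (\<lambda>j. if j < m then \<epsilon> s j else - 1))" for F :: "(nat \<Rightarrow> real) \<Rightarrow> real"
  proof -
    have "(\<Sum>s<k. F (\<delta> s)) = (\<Sum>s<k. F (\<lambda>j. if j < m then \<epsilon> s j else 1))"
      by (rule sum.cong[OF refl], rule arg_cong[of _ _ F]) (auto simp: a)
    moreover have "(\<Sum>s<k. F (\<delta> (k + s))) = (\<Sum>s<k. F (\<lambda>j. if j < m then \<epsilon> s j else - 1))"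
      by (rule sum.cong[OF refl], rule arg_cong[of _ _ F]) (auto simp: b)
    ultimately show ?thesis by (simp add: sum_lessThan_plus)
  qed
  have "sign_design (Suc m) (k + k) \<delta>"
    unfolding sign_design_def
  proof (intro conjI allI impI)
    show "\<delta> s j = 1 \<or> \<delta> s j = - 1" for s j using pm by (simp add: \<delta>_def)
    show "(\<Sum>s<k+k. \<delta> s j) = 0" if "j < Suc m" for j
      using sm[of "\<lambda>v. v j"] s1 by (cases "j < m") (simp_all add: sum_negf)
    show "(\<Sum>s<k+k. \<delta> s i * \<delta> s j) = (if i = j then real (k + k) else 0)"
      if "i < Suc m" "j < Suc m" for i j
      using sm[of "\<lambda>v. v i * v j"] s1 s2 that by (auto simp: sum_negf less_Suc_eq)
    show "(\<Sum>s<k+k. \<delta> s h * \<delta> s i * \<delta> s j) = 0"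
      if "h < Suc m" "i < Suc m" "j < Suc m" for h i j
      using sm[of "\<lambda>v. v h * v i * v j"] s1 s2 s3 that by (auto simp: sum_negf less_Suc_eq)
  qed (use k in simp)
  then show ?case by blast
qed

text \<open>\<open>F\<close> is a quadratic polynomial in the signs. Averaging retains its constant
  term and the diagonal of its quadratic part, whereas averaging against one sign retains the
  matching linear coefficient and kills the rest by the first and third moments.\<close>

lemma sign_design_sums:
  fixes p :: complex and q :: "nat \<Rightarrow> complex" and r :: "nat \<Rightarrow> nat \<Rightarrow> complex"
  assumes des: "sign_design m k \<epsilon>"
  defines "F \<equiv> \<lambda>s. p + (\<Sum>j<m. complex_of_real (\<epsilon> s j) * q j)
      + (\<Sum>j<m. \<Sum>i<m. complex_of_real (\<epsilon> s j * \<epsilon> s i) * r j i)"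
  shows "(\<Sum>s<k. F s) = of_nat k * p + of_nat k * (\<Sum>j<m. r j j)"
    and "l < m \<Longrightarrow> (\<Sum>s<k. complex_of_real (\<epsilon> s l) * F s) = of_nat k * q l"
proof -
  note s1 = sign_design_1[OF des] and s2 = sign_design_2[OF des] and s3 = sign_design_3[OF des]
  have c1: "j < m \<Longrightarrow> (\<Sum>s<k. complex_of_real (\<epsilon> s j)) = 0" for j
    by (metis s1 of_real_sum of_real_0)
  have c2: "i < m \<Longrightarrow> j < m \<Longrightarrow> (\<Sum>s<k. complex_of_real (\<epsilon> s i * \<epsilon> s j)) = (if i = j then of_nat k else 0)" for i j
    by (simp only: of_real_sum[symmetric] s2) simp
  have c3: "h < m \<Longrightarrow> i < m \<Longrightarrow> j < m \<Longrightarrow> (\<Sum>s<k. complex_of_real (\<epsilon> s h * \<epsilon> s i * \<epsilon> s j)) = 0" for h i j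
    by (simp only: of_real_sum[symmetric] s3) simp
  have sw1: "(\<Sum>s<k. \<Sum>j<m. f s j * q j) = (\<Sum>j<m. (\<Sum>s<k. f s j) * q j)" for f :: "nat \<Rightarrow> nat \<Rightarrow> complex"
    by (subst sum.swap) (simp add: sum_distrib_right)
  have sw2: "(\<Sum>s<k. \<Sum>j<m. \<Sum>i<m. f s j i * r j i) = (\<Sum>j<m. \<Sum>i<m. (\<Sum>s<k. f s j i) * r j i)"
    for f :: "nat \<Rightarrow> nat \<Rightarrow> nat \<Rightarrow> complex"
    by (subst sum.swap, rule sum.cong[OF refl], subst sum.swap) (simp add: sum_distrib_right)
  have "(\<Sum>s<k. F s) = of_nat k * p + (\<Sum>j<m. (\<Sum>s<k. complex_of_real (\<epsilon> s j)) * q j)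
      + (\<Sum>j<m. \<Sum>i<m. (\<Sum>s<k. complex_of_real (\<epsilon> s j * \<epsilon> s i)) * r j i)"
    unfolding F_def by (simp only: sum.distrib sw1 sw2) simp
  also have "(\<Sum>j<m. (\<Sum>s<k. complex_of_real (\<epsilon> s j)) * q j) = 0"
    by (simp add: c1)
  also have "(\<Sum>j<m. \<Sum>i<m. (\<Sum>s<k. complex_of_real (\<epsilon> s j * \<epsilon> s i)) * r j i)
      = (\<Sum>j<m. \<Sum>i<m. (if j = i then of_nat k * r j i else 0))"
    by (intro sum.cong refl) (simp add: c2 del: of_real_mult)
  also have "\<dots> = of_nat k * (\<Sum>j<m. r j j)"
    by (simp add: sum_distrib_left)
  finally show "(\<Sum>s<k. F s) = of_nat k * p + of_nat k * (\<Sum>j<m. r j j)" by simp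
  assume l: "l < m"
  have "(\<Sum>s<k. complex_of_real (\<epsilon> s l) * F s) = (\<Sum>s<k. complex_of_real (\<epsilon> s l)) * p
      + (\<Sum>s<k. \<Sum>j<m. complex_of_real (\<epsilon> s l * \<epsilon> s j) * q j)
      + (\<Sum>s<k. \<Sum>j<m. \<Sum>i<m. complex_of_real (\<epsilon> s l * \<epsilon> s j * \<epsilon> s i) * r j i)"
    unfolding F_def
    by (simp add: distrib_left sum.distrib sum_distrib_left sum_distrib_right mult.assoc)
  also have "\<dots> = (\<Sum>j<m. (\<Sum>s<k. complex_of_real (\<epsilon> s l * \<epsilon> s j)) * q j)
      + (\<Sum>j<m. \<Sum>i<m. (\<Sum>s<k. complex_of_real (\<epsilon> s l * \<epsilon> s j * \<epsilon> s i)) * r j i)"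
    by (simp only: sw1 sw2 c1[OF l]) simp
  also have "(\<Sum>j<m. (\<Sum>s<k. complex_of_real (\<epsilon> s l * \<epsilon> s j)) * q j) = (\<Sum>j<m. if l = j then of_nat k * q j else 0)"
    by (intro sum.cong refl) (simp add: c2 l del: of_real_mult)
  also have "\<dots> = of_nat k * q l" using l by simp
  also have "(\<Sum>j<m. \<Sum>i<m. (\<Sum>s<k. complex_of_real (\<epsilon> s l * \<epsilon> s j * \<epsilon> s i)) * r j i) = 0"
    by (intro sum.neutral ballI) (simp add: c3 l del: of_real_mult)
  finally show "(\<Sum>s<k. complex_of_real (\<epsilon> s l) * F s) = of_nat k * q l" by simp
qed

text \<open>
  The operators \<open>V\<^sub>s\<^sup>*V\<^sub>s\<close> form a positive operator valued measure with barycentre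
  \<open>X / \<surd>m\<close> on the points of \<open>{0, \<plusminus>1}\<^sup>m\<close> given by \<open>lam\<close>: for a sign vector \<open>\<epsilon>\<close> the square of
  \<open>1 + m\<^sup>-\<^sup>1\<^sup>/\<^sup>2 \<Sum> \<epsilon>\<^sub>j X\<^sub>j\<close> is positive for free and has the correct first moments, since odd
  moments of the signs vanish, and the deficit in total mass is a multiple of
  \<open>\<Sum> (1 - X\<^sub>j\<^sup>2)\<close>, which is placed at the origin.
\<close>

definition sign_dilation ::
  "'a cinner_space \<Rightarrow> nat \<Rightarrow> (nat \<Rightarrow> 'a \<Rightarrow> 'a) \<Rightarrow> nat \<Rightarrow> (nat \<Rightarrow> 'a \<Rightarrow> 'a) \<Rightarrow> (nat \<Rightarrow> nat \<Rightarrow> real) \<Rightarrow> bool" where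
  "sign_dilation H m X k V lam \<longleftrightarrow> (\<forall>s<k. V s \<in> bounded_ops H H) \<and> (\<forall>s j. lam s j \<in> {0, 1, - 1}) \<and>
     (\<forall>x\<in>carrier H. \<forall>y\<in>carrier H. (\<Sum>s<k. cinner H (V s x) (V s y)) = cinner H x y) \<and>
     (\<forall>j<m. \<forall>x\<in>carrier H. \<forall>y\<in>carrier H.
        (\<Sum>s<k. complex_of_real (lam s j) * cinner H (V s x) (V s y))
          = cinner H (X j x) y / complex_of_real (sqrt (real m)))"

lemma
  assumes "sign_dilation H m X k V lam"
  shows sign_dilation_in: "s < k \<Longrightarrow> V s \<in> bounded_ops H H"
    and sign_dilation_sign: "lam s j \<in> {0, 1, - 1}"
    and sign_dilation_one: "x \<in> carrier H \<Longrightarrow> y \<in> carrier H \<Longrightarrow>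
      (\<Sum>s<k. cinner H (V s x) (V s y)) = cinner H x y"
    and sign_dilation_moment: "j < m \<Longrightarrow> x \<in> carrier H \<Longrightarrow> y \<in> carrier H \<Longrightarrow>
      (\<Sum>s<k. complex_of_real (lam s j) * cinner H (V s x) (V s y))
        = cinner H (X j x) y / complex_of_real (sqrt (real m))"
  using assms unfolding sign_dilation_def by blast+

context hilbert_space
begin

text \<open>The linear combination is recorded through its inner products, the form in which the
  moment computation consumes it.\<close>

lemma op_lincomb:
  fixes m :: nat
  assumes "\<And>j. j < m \<Longrightarrow> X j \<in> bounded_ops H H"
  shows "\<exists>S\<in>bounded_ops H H. \<forall>x\<in>carrier H. \<forall>y\<in>carrier H.
     cinner H (S x) y = (\<Sum>j<m. a j * cinner H (X j x) y)"
  using assms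
proof (induction m)
  case 0
  have "op_scale H 0 (op_id H) \<in> bounded_ops H H" by simp
  then show ?case by (intro bexI[of _ "op_scale H 0 (op_id H)"]) (simp_all add: ip_simps)
next
  case (Suc m)
  then obtain S where S: "S \<in> bounded_ops H H"
    "\<And>x y. x \<in> carrier H \<Longrightarrow> y \<in> carrier H \<Longrightarrow> cinner H (S x) y = (\<Sum>j<m. a j * cinner H (X j x) y)"
    by auto
  have X: "X m \<in> bounded_ops H H" by (rule Suc.prems) simp
  have "op_add H S (op_scale H (a m) (X m)) \<in> bounded_ops H H" using S X by simp
  then show ?case using S X
    by (intro bexI[of _ "op_add H S (op_scale H (a m) (X m))"]) (simp_all add: ip_simps)
qed

lemma ex_sign_dilation:
  fixes m :: nat
  assumes m: "m \<ge> 1"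
    and X: "\<And>j. j < m \<Longrightarrow> X j \<in> bounded_ops H H"
    and sa: "\<And>j x y. j < m \<Longrightarrow> x \<in> carrier H \<Longrightarrow> y \<in> carrier H \<Longrightarrow> cinner H (X j x) y = cinner H x (X j y)"
    and con: "\<And>j x. j < m \<Longrightarrow> x \<in> carrier H \<Longrightarrow> hnorm H (X j x) \<le> hnorm H x"
  shows "\<exists>k V lam. sign_dilation H m X k V lam"
proof -
  obtain k \<epsilon> where des: "sign_design m k \<epsilon>" using ex_sign_design by blast
  note k = sign_design_pos[OF des] and pm = sign_design_pm[OF des]
  define rm where "rm = complex_of_real (sqrt (real m))"
  have rm: "rm \<noteq> 0" "cnj rm = rm" "rm * rm = of_nat m"
    using m by (simp_all add: rm_def flip: of_real_mult)
  \<comment> \<open>\<open>B s\<close> will be \<open>c\<close> times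
    \<open>1 + m^(-1/2) \<Sum> \<epsilon>_j X_j\<close>. The squares of the latter average to at
    most 2, so the weight \<open>c^2 = 1 / (2 k)\<close> keeps the total mass at most 1.\<close>
  define c where "c = complex_of_real (1 / sqrt (2 * real k))"
  have "c * c = complex_of_real (1 / (2 * real k))"
    unfolding c_def of_real_mult[symmetric] using k by simp
  then have c: "cnj c = c" "c * c = 1 / (2 * of_nat k)"
    by (simp_all add: c_def)
  \<comment> \<open>The \<open>m\<close> operators \<open>D j\<close> will have squares
    \<open>(1 - X_j^2) / (2 m)\<close>, whose sum is exactly the mass that the \<open>B s\<close>
    leave over.\<close>
  define e where "e = complex_of_real (1 / sqrt (2 * real m))"
  have "e * e = complex_of_real (1 / (2 * real m))"
    unfolding e_def of_real_mult[symmetric] using m by simp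
  then have e: "cnj e = e" "e * e = 1 / (2 * of_nat m)"
    by (simp_all add: e_def)
  have "\<forall>s. \<exists>S\<in>bounded_ops H H. \<forall>x\<in>carrier H. \<forall>y\<in>carrier H.
     cinner H (S x) y = (\<Sum>j<m. (complex_of_real (\<epsilon> s j) / rm) * cinner H (X j x) y)"
    by (intro allI op_lincomb X)
  then obtain S where S': "\<forall>s. S s \<in> bounded_ops H H \<and> (\<forall>x\<in>carrier H. \<forall>y\<in>carrier H.
      cinner H (S s x) y = (\<Sum>j<m. (complex_of_real (\<epsilon> s j) / rm) * cinner H (X j x) y))"
    unfolding Bex_def by (rule exE[OF choice])
  have S [simp]: "S s \<in> bounded_ops H H" for s using S' by simp
  have S_l: "cinner H (S s x) y = (\<Sum>j<m. (complex_of_real (\<epsilon> s j) / rm) * cinner H (X j x) y)"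
    if "x \<in> carrier H" "y \<in> carrier H" for s x y
    using S' that by simp
  have S_r: "cinner H y (S s x) = (\<Sum>j<m. (complex_of_real (\<epsilon> s j) / rm) * cinner H y (X j x))"
    if x: "x \<in> carrier H" and y: "y \<in> carrier H" for s x y
  proof -
    have "cinner H y (S s x) = cnj (cinner H (S s x) y)"
      using x y by (intro cinner_commute) simp_all
    also have "\<dots> = (\<Sum>j<m. (complex_of_real (\<epsilon> s j) / rm) * cnj (cinner H (X j x) y))"
      using rm by (simp add: S_l x y)
    also have "\<dots> = (\<Sum>j<m. (complex_of_real (\<epsilon> s j) / rm) * cinner H y (X j x))"
      using X x y by (intro sum.cong refl) (simp add: cinner_commute[of "X _ x" y])
    finally show ?thesis .
  qed
  define B where "B s = op_scale H c (op_add H (op_id H) (S s))" for s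
  have B [simp]: "B s \<in> bounded_ops H H" for s by (simp add: B_def)
  define F where "F x y s = cinner H x y + (\<Sum>j<m. complex_of_real (\<epsilon> s j) * (2 * cinner H (X j x) y / rm))
      + (\<Sum>j<m. \<Sum>i<m. complex_of_real (\<epsilon> s j * \<epsilon> s i) * (cinner H (X j x) (X i y) / of_nat m))" for x y s
  have BB: "cinner H (B s x) (B s y) = F x y s / (2 * of_nat k)"
    if x: "x \<in> carrier H" and y: "y \<in> carrier H" for s x y
  proof -
    have "cinner H (S s x) (S s y) = (\<Sum>j<m. \<Sum>i<m. complex_of_real (\<epsilon> s j * \<epsilon> s i) * (cinner H (X j x) (X i y) / of_nat m))"
      using x y X by (simp add: S_l S_r sum_distrib_left rm(3)[symmetric] mult_ac, subst sum.swap)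
        (simp add: mult_ac)
    moreover have "cinner H (S s x) y + cinner H x (S s y) = (\<Sum>j<m. complex_of_real (\<epsilon> s j) * (2 * cinner H (X j x) y / rm))"
      using x y X by (simp add: S_l S_r sa sum_distrib_left mult_ac flip: sum.distrib)
    moreover have "cinner H (B s x) (B s y) = (c * c) *
       (cinner H x y + (cinner H (S s x) y + cinner H x (S s y)) + cinner H (S s x) (S s y))"
      using x y by (simp add: B_def ip_simps c(1) algebra_simps)
    ultimately show ?thesis by (simp add: c F_def)
  qed
  have sX: "sa_contraction H (op_comp H (X j) (X j))" if j: "j < m" for j
  proof
    show "hnorm H (op_comp H (X j) (X j) x) \<le> hnorm H x" if "x \<in> carrier H" for x
      using con[OF j that] con[OF j, of "X j x"] X[OF j] that by simp
  qed (use X[OF j] sa[OF j] in simp_all)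
  define D where "D j = op_scale H e (defect_root H (op_comp H (X j) (X j)))" for j
  have D: "D j \<in> bounded_ops H H" if "j < m" for j
    using sa_contraction.defect_root_in[OF sX[OF that]] by (simp add: D_def)
  have DD: "cinner H (D j x) (D j y) = (cinner H x y - cinner H (X j x) (X j y)) / (2 * of_nat m)"
    if j: "j < m" and x: "x \<in> carrier H" and y: "y \<in> carrier H" for j x y
    using sa_contraction.defect_root_cinner[OF sX[OF j] x y] sa_contraction.defect_root_in[OF sX[OF j]]
      x y sa[OF j, of "X j x" y] X[OF j]
    by (simp add: D_def ip_simps e mult.assoc[symmetric])
  \<comment> \<open>Indices below \<open>k\<close> carry the sign vectors and the next
    \<open>m\<close> indices the defect; there \<open>lam\<close> is 0, so mass is added without any
    first moment.\<close>
  define V where "V s = (if s < k then B s else D (s - k))" for s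
  define lam where "lam s j = (if s < k then \<epsilon> s j else 0)" for s j
  have tot: "(\<Sum>s<k+m. cinner H (V s x) (V s y)) = cinner H x y"
    if x: "x \<in> carrier H" and y: "y \<in> carrier H" for x y
  proof -
    have "(\<Sum>s<k+m. cinner H (V s x) (V s y)) = (\<Sum>s<k. F x y s) / (2 * of_nat k)
       + (\<Sum>j<m. (cinner H x y - cinner H (X j x) (X j y)) / (2 * of_nat m))"
      by (simp add: sum_lessThan_plus V_def BB DD x y sum_divide_distrib)
    also have "(\<Sum>s<k. F x y s) = of_nat k * cinner H x y
        + of_nat k * (\<Sum>j<m. cinner H (X j x) (X j y) / of_nat m)"
      unfolding F_def by (rule sign_design_sums(1)[OF des])
    also have "(\<Sum>j<m. (cinner H x y - cinner H (X j x) (X j y)) / (2 * of_nat m))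
        = cinner H x y / 2 - (\<Sum>j<m. cinner H (X j x) (X j y) / of_nat m) / 2"
      using m by (simp add: diff_divide_distrib sum_subtractf sum_divide_distrib mult.commute)
    finally show ?thesis using k by (simp add: field_simps)
  qed
  have mom: "(\<Sum>s<k+m. complex_of_real (lam s l) * cinner H (V s x) (V s y)) = cinner H (X l x) y / rm"
    if l: "l < m" and x: "x \<in> carrier H" and y: "y \<in> carrier H" for l x y
  proof -
    have "(\<Sum>s<k+m. complex_of_real (lam s l) * cinner H (V s x) (V s y))
       = (\<Sum>s<k. complex_of_real (\<epsilon> s l) * F x y s) / (2 * of_nat k)"
      by (simp add: sum_lessThan_plus V_def lam_def BB x y sum_divide_distrib)
    also have "(\<Sum>s<k. complex_of_real (\<epsilon> s l) * F x y s) = of_nat k * (2 * cinner H (X l x) y / rm)"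
      unfolding F_def by (rule sign_design_sums(2)[OF des l])
    finally show ?thesis using k by simp
  qed
  have Vin: "V s \<in> bounded_ops H H" if "s < k + m" for s using D that by (simp add: V_def)
  have lin: "lam s j \<in> {0, 1, - 1}" for s j using pm[of s j] by (auto simp: lam_def)
  have "sign_dilation H m X (k + m) V lam"
    unfolding sign_dilation_def using Vin lin tot mom[unfolded rm_def] by simp
  then show ?thesis by blast
qed

end

section \<open>Finite powers of a Hilbert space and diagonal dilations\<close>

text \<open>The \<open>k\<close>-fold direct sum, known only through its coordinate maps
  \<open>p\<close>. This abstraction lets the same proofs serve sequences in \<open>H\<close>,
  coordinate space over the scalars, and the flattened copy inside
  \<open>nat => complex\<close>.\<close>

locale hilbert_power = H: hilbert_space H + K: vectorspace class_ring K
  for H :: "'a cinner_space" and K :: "'b cinner_space" +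
  fixes k :: nat and p :: "nat \<Rightarrow> 'b \<Rightarrow> 'a"
  assumes p_in: "s < k \<Longrightarrow> x \<in> carrier K \<Longrightarrow> p s x \<in> carrier H"
    and p_add: "s < k \<Longrightarrow> x \<in> carrier K \<Longrightarrow> y \<in> carrier K \<Longrightarrow> p s (x \<oplus>\<^bsub>K\<^esub> y) = p s x \<oplus>\<^bsub>H\<^esub> p s y"
    and p_smult: "s < k \<Longrightarrow> x \<in> carrier K \<Longrightarrow> p s (c \<odot>\<^bsub>K\<^esub> x) = c \<odot>\<^bsub>H\<^esub> p s x"
    and cinner_K: "x \<in> carrier K \<Longrightarrow> y \<in> carrier K \<Longrightarrow> cinner K x y = (\<Sum>s<k. cinner H (p s x) (p s y))"
    and p_inj: "x \<in> carrier K \<Longrightarrow> y \<in> carrier K \<Longrightarrow> (\<And>s. s < k \<Longrightarrow> p s x = p s y) \<Longrightarrow> x = y"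
    and p_surj: "(\<And>s. s < k \<Longrightarrow> f s \<in> carrier H) \<Longrightarrow> \<exists>x\<in>carrier K. \<forall>s<k. p s x = f s"
begin

lemma smult_K_in: "x \<in> carrier K \<Longrightarrow> c \<odot>\<^bsub>K\<^esub> x \<in> carrier K"
  by (rule K.smult_closed) auto

lemma p_zero: "s < k \<Longrightarrow> p s \<zero>\<^bsub>K\<^esub> = \<zero>\<^bsub>H\<^esub>"
  using p_add[of s "\<zero>\<^bsub>K\<^esub>" "\<zero>\<^bsub>K\<^esub>"] p_in[of s "\<zero>\<^bsub>K\<^esub>"]
  by (metis K.M.l_zero K.M.zero_closed H.M.add.l_cancel_one')

lemma p_uminus:
  assumes s: "s < k" and x: "x \<in> carrier K"
  shows "p s (\<ominus>\<^bsub>K\<^esub> x) = \<ominus>\<^bsub>H\<^esub> p s x"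
proof -
  have "p s (\<ominus>\<^bsub>K\<^esub> x) \<oplus>\<^bsub>H\<^esub> p s x = \<zero>\<^bsub>H\<^esub>"
    using s x by (simp add: p_add[symmetric] K.M.l_neg p_zero)
  then show ?thesis using p_in[OF s] x by (simp add: H.M.minus_equality)
qed

lemma p_diff: "s < k \<Longrightarrow> x \<in> carrier K \<Longrightarrow> y \<in> carrier K \<Longrightarrow> p s (x \<ominus>\<^bsub>K\<^esub> y) = p s x \<ominus>\<^bsub>H\<^esub> p s y"
  by (simp add: a_minus_def p_add p_uminus)

lemma Re_cinner_K: "x \<in> carrier K \<Longrightarrow> Re (cinner K x x) = (\<Sum>s<k. (hnorm H (p s x))\<^sup>2)"
  by (simp add: cinner_K p_in H.hnorm_sq)

lemma hnorm_K_sq: "x \<in> carrier K \<Longrightarrow> (hnorm K x)\<^sup>2 = (\<Sum>s<k. (hnorm H (p s x))\<^sup>2)"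
  by (simp add: hnorm_def[of K] Re_cinner_K sum_nonneg)

lemma hnorm_p_le:
  assumes s: "s < k" and x: "x \<in> carrier K"
  shows "hnorm H (p s x) \<le> hnorm K x"
proof (rule power2_le_imp_le)
  show "(hnorm H (p s x))\<^sup>2 \<le> (hnorm K x)\<^sup>2"
    unfolding hnorm_K_sq[OF x] using s by (intro member_le_sum) auto
  show "0 \<le> hnorm K x" using x by (simp add: hnorm_def[of K] Re_cinner_K sum_nonneg)
qed

lemma K_complete:
  assumes s: "\<And>n. f n \<in> carrier K"
    and cau: "\<And>e. 0 < e \<Longrightarrow> \<exists>M. \<forall>i\<ge>M. \<forall>j\<ge>M. hnorm K (f i \<ominus>\<^bsub>K\<^esub> f j) < e"
  shows "\<exists>l\<in>carrier K. (\<lambda>n. hnorm K (f n \<ominus>\<^bsub>K\<^esub> l)) \<longlonglongrightarrow> 0"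
proof -
  have "\<exists>l\<in>carrier H. (\<lambda>n. hnorm H (p t (f n) \<ominus>\<^bsub>H\<^esub> l)) \<longlonglongrightarrow> 0" if t: "t < k" for t
  proof (rule H.complete)
    show "p t (f n) \<in> carrier H" for n by (rule p_in[OF t s])
    fix e :: real assume "0 < e"
    then obtain M where M: "\<And>i j. i \<ge> M \<Longrightarrow> j \<ge> M \<Longrightarrow> hnorm K (f i \<ominus>\<^bsub>K\<^esub> f j) < e" using cau by blast
    have "hnorm H (p t (f i) \<ominus>\<^bsub>H\<^esub> p t (f j)) < e" if "i \<ge> M" "j \<ge> M" for i j
      using hnorm_p_le[OF t, of "f i \<ominus>\<^bsub>K\<^esub> f j"] M[OF that] s by (simp add: p_diff t)
    then show "\<exists>M. \<forall>i\<ge>M. \<forall>j\<ge>M. hnorm H (p t (f i) \<ominus>\<^bsub>H\<^esub> p t (f j)) < e" by blast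
  qed
  then obtain l where l: "\<And>t. t < k \<Longrightarrow> l t \<in> carrier H"
    and lim: "\<And>t. t < k \<Longrightarrow> (\<lambda>n. hnorm H (p t (f n) \<ominus>\<^bsub>H\<^esub> l t)) \<longlonglongrightarrow> 0"
    by metis
  obtain x where x: "x \<in> carrier K" and px: "\<And>t. t < k \<Longrightarrow> p t x = l t"
    using p_surj[of l] l by blast
  have "(\<lambda>n. sqrt (\<Sum>t<k. (hnorm H (p t (f n) \<ominus>\<^bsub>H\<^esub> l t))\<^sup>2)) \<longlonglongrightarrow> sqrt (\<Sum>t<k. 0\<^sup>2)"
    by (intro tendsto_real_sqrt tendsto_sum tendsto_power lim) simp
  moreover have "hnorm K (f n \<ominus>\<^bsub>K\<^esub> x) = sqrt (\<Sum>t<k. (hnorm H (p t (f n) \<ominus>\<^bsub>H\<^esub> l t))\<^sup>2)" for n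
    using s x by (simp add: hnorm_def[of K] Re_cinner_K p_diff px)
  ultimately have "(\<lambda>n. hnorm K (f n \<ominus>\<^bsub>K\<^esub> x)) \<longlonglongrightarrow> 0" by simp
  then show ?thesis using x by blast
qed

sublocale K: hilbert_space K
proof
  show "cinner K (x \<oplus>\<^bsub>K\<^esub> y) z = cinner K x z + cinner K y z"
    if "x \<in> carrier K" "y \<in> carrier K" "z \<in> carrier K" for x y z
    using that by (simp add: cinner_K p_add p_in H.ip_simps sum.distrib)
  show "cinner K (c \<odot>\<^bsub>K\<^esub> x) y = c * cinner K x y"
    if "x \<in> carrier K" "y \<in> carrier K" for c x y
    using that by (simp add: cinner_K smult_K_in p_smult p_in H.ip_simps sum_distrib_left)
  show "cinner K y x = cnj (cinner K x y)"
    if "x \<in> carrier K" "y \<in> carrier K" for x y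
  proof -
    have "cinner H (p s y) (p s x) = cnj (cinner H (p s x) (p s y))" if "s < k" for s
      using \<open>x \<in> carrier K\<close> \<open>y \<in> carrier K\<close> that by (intro H.cinner_commute p_in)
    then show ?thesis using that by (simp add: cinner_K)
  qed
  show "0 < Re (cinner K x x)" if x: "x \<in> carrier K" and nz: "x \<noteq> \<zero>\<^bsub>K\<^esub>" for x
  proof -
    obtain s where s: "s < k" "p s x \<noteq> \<zero>\<^bsub>H\<^esub>"
      using p_inj[OF x K.M.zero_closed] nz p_zero by metis
    have "0 < (hnorm H (p s x))\<^sup>2" using s x p_in H.hnorm_eq_0 by simp
    also have "\<dots> \<le> Re (cinner K x x)"
      unfolding Re_cinner_K[OF x] using s by (intro member_le_sum) auto
    finally show ?thesis .
  qed
qed (rule K_complete)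

sublocale HK: hilbert_pair H K ..

definition mk :: "(nat \<Rightarrow> 'a) \<Rightarrow> 'b" where
  "mk f = (SOME x. x \<in> carrier K \<and> (\<forall>s<k. p s x = f s))"

lemma mk_in: "(\<And>s. s < k \<Longrightarrow> f s \<in> carrier H) \<Longrightarrow> mk f \<in> carrier K"
  and p_mk: "(\<And>s. s < k \<Longrightarrow> f s \<in> carrier H) \<Longrightarrow> s < k \<Longrightarrow> p s (mk f) = f s"
proof -
  assume "\<And>s. s < k \<Longrightarrow> f s \<in> carrier H"
  from p_surj[of f, OF this] have "\<exists>x. x \<in> carrier K \<and> (\<forall>s<k. p s x = f s)" by blast
  from someI_ex[OF this]
  show "mk f \<in> carrier K" "s < k \<Longrightarrow> p s (mk f) = f s" unfolding mk_def by blast+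
qed

definition emb :: "(nat \<Rightarrow> 'a \<Rightarrow> 'a) \<Rightarrow> 'a \<Rightarrow> 'b" where
  "emb V = (\<lambda>x\<in>carrier H. mk (\<lambda>s. V s x))"

lemma emb_in: "(\<And>s. s < k \<Longrightarrow> V s \<in> bounded_ops H H) \<Longrightarrow> x \<in> carrier H \<Longrightarrow> emb V x \<in> carrier K"
  and p_emb: "(\<And>s. s < k \<Longrightarrow> V s \<in> bounded_ops H H) \<Longrightarrow> x \<in> carrier H \<Longrightarrow> s < k \<Longrightarrow> p s (emb V x) = V s x"
  by (simp_all add: emb_def mk_in p_mk)

lemma emb_isometry:
  assumes V: "\<And>s. s < k \<Longrightarrow> V s \<in> bounded_ops H H"
    and one: "\<And>x y. x \<in> carrier H \<Longrightarrow> y \<in> carrier H \<Longrightarrow>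
       (\<Sum>s<k. cinner H (V s x) (V s y)) = cinner H x y"
  shows "isometry H K (emb V)"
proof (rule HK.isometryI)
  have *: "cinner K (emb V x) (emb V y) = cinner H x y" if "x \<in> carrier H" "y \<in> carrier H" for x y
    using that V by (simp add: cinner_K emb_in p_emb one)
  then show "x \<in> carrier H \<Longrightarrow> y \<in> carrier H \<Longrightarrow> cinner K (emb V x) (emb V y) = cinner H x y" for x y .
  have "(\<lambda>x\<in>carrier H. emb V x) \<in> bounded_ops H K"
  proof (rule HK.bopI)
    show "emb V (x \<oplus>\<^bsub>H\<^esub> y) = emb V x \<oplus>\<^bsub>K\<^esub> emb V y" if "x \<in> carrier H" "y \<in> carrier H" for x y
      using that V by (intro p_inj) (simp_all add: emb_in p_emb p_add bop_add)
    show "emb V (a \<odot>\<^bsub>H\<^esub> x) = a \<odot>\<^bsub>K\<^esub> emb V x" if "x \<in> carrier H" for a x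
      using that V by (intro p_inj) (simp_all add: emb_in p_emb p_smult bop_smult)
    show "hnorm K (emb V x) \<le> 1 * hnorm H x" if "x \<in> carrier H" for x
      using *[OF that that] by (simp add: hnorm_def)
  qed (use V emb_in in auto)
  then show "emb V \<in> bounded_ops H K" by (simp add: emb_def restrict_def cong: if_cong)
qed

definition diag :: "(nat \<Rightarrow> complex) \<Rightarrow> 'b \<Rightarrow> 'b" where
  "diag w = (\<lambda>x\<in>carrier K. mk (\<lambda>s. w s \<odot>\<^bsub>H\<^esub> p s x))"

lemma diag_carrier [simp]: "x \<in> carrier K \<Longrightarrow> diag w x \<in> carrier K"
  and p_diag: "x \<in> carrier K \<Longrightarrow> s < k \<Longrightarrow> p s (diag w x) = w s \<odot>\<^bsub>H\<^esub> p s x"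
  by (simp_all add: diag_def mk_in p_mk p_in)

lemma hnorm_diag:
  assumes M: "0 \<le> M" "\<And>s. s < k \<Longrightarrow> cmod (w s) \<le> M" and x: "x \<in> carrier K"
  shows "hnorm K (diag w x) \<le> M * hnorm K x"
proof (rule power2_le_imp_le)
  have "(hnorm K (diag w x))\<^sup>2 = (\<Sum>s<k. (cmod (w s) * hnorm H (p s x))\<^sup>2)"
    using x by (simp add: hnorm_K_sq p_diag H.hnorm_smult p_in)
  also have "\<dots> \<le> (\<Sum>s<k. (M * hnorm H (p s x))\<^sup>2)"
    using M x by (intro sum_mono power_mono mult_right_mono) (auto simp: p_in)
  also have "\<dots> = (M * hnorm K x)\<^sup>2"
    using x by (simp add: power_mult_distrib hnorm_K_sq sum_distrib_left)
  finally show "(hnorm K (diag w x))\<^sup>2 \<le> (M * hnorm K x)\<^sup>2" .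
qed (use M x in simp)

lemma cinner_diag:
  "x \<in> carrier K \<Longrightarrow> y \<in> carrier K \<Longrightarrow> cinner K (diag w x) y = cinner K x (diag (\<lambda>s. cnj (w s)) y)"
  by (simp add: cinner_K p_diag p_in H.ip_simps)

lemma diag_in: "diag w \<in> bounded_ops K K"
proof -
  have M: "cmod (w s) \<le> (\<Sum>t<k. cmod (w t))" if "s < k" for s
    using that by (intro member_le_sum) auto
  have "(\<lambda>x\<in>carrier K. diag w x) \<in> bounded_ops K K"
    by (rule K.HH.bop_adjointI[OF _ _ cinner_diag hnorm_diag[OF _ M]]) (auto simp: sum_nonneg)
  then show ?thesis by (simp add: diag_def restrict_def cong: if_cong)
qed

lemma diag_adj: "op_adj K K (diag w) = diag (\<lambda>s. cnj (w s))"
  by (rule K.HH.op_adj_eqI[OF diag_in cinner_diag])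

lemma diag_comp: "op_comp K (diag w) (diag v) = diag (\<lambda>s. w s * v s)"
proof (rule bop_eqI[OF K.op_comp_in[OF diag_in diag_in] diag_in])
  fix x assume x: "x \<in> carrier K"
  have "w s \<odot>\<^bsub>H\<^esub> (v s \<odot>\<^bsub>H\<^esub> p s x) = (w s * v s) \<odot>\<^bsub>H\<^esub> p s x" if "s < k" for s
    using p_in[OF that x] by (intro H.inner_ext) (simp_all add: H.ip_simps)
  then show "op_comp K (diag w) (diag v) x = diag (\<lambda>s. w s * v s) x"
    using x by (intro p_inj) (simp_all add: p_diag)
qed

lemma diag_scale: "op_scale K c (diag v) = diag (\<lambda>s. c * v s)"
proof (rule bop_eqI[OF K.op_scale_in[OF diag_in] diag_in])
  fix x assume x: "x \<in> carrier K"
  have "c \<odot>\<^bsub>H\<^esub> (v s \<odot>\<^bsub>H\<^esub> p s x) = (c * v s) \<odot>\<^bsub>H\<^esub> p s x" if "s < k" for s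
    using p_in[OF that x] by (intro H.inner_ext) (simp_all add: H.ip_simps)
  then show "op_scale K c (diag v) x = diag (\<lambda>s. c * v s) x"
    using x by (intro p_inj) (simp_all add: p_diag p_smult)
qed

lemma diag_normal_tuple: "normal_tuple K (map (\<lambda>j. diag (w j)) [0..<m])"
  by (auto simp: normal_tuple_def normal_op_def diag_in diag_adj diag_comp mult.commute)

text \<open>The Naimark dilation of a finite positive operator valued measure. The column
  \<open>emb V\<close> is an isometry because the \<open>V_s^* V_s\<close> sum to 1; the coordinate
  projections of \<open>K\<close> dilate these operators, and \<open>diag (w j)\<close> is their
  combination with coefficients \<open>w j s\<close>.\<close>

lemma diag_dilation:
  assumes V: "\<And>s. s < k \<Longrightarrow> V s \<in> bounded_ops H H"
    and one: "\<And>x y. x \<in> carrier H \<Longrightarrow> y \<in> carrier H \<Longrightarrow>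
       (\<Sum>s<k. cinner H (V s x) (V s y)) = cinner H x y"
    and X: "\<And>j. j < length X \<Longrightarrow> X ! j \<in> bounded_ops H H"
    and w: "\<And>j x y. j < length X \<Longrightarrow> x \<in> carrier H \<Longrightarrow> y \<in> carrier H \<Longrightarrow>
       (\<Sum>s<k. w j s * cinner H (V s x) (V s y)) = cinner H ((X ! j) x) y"
  shows "dilation H K X (map (\<lambda>j. diag (w j)) [0..<length X])"
proof (rule HK.dilationI[where V = "emb V"])
  show "isometry H K (emb V)" by (rule emb_isometry[OF V one])
  show "cinner K ((map (\<lambda>j. diag (w j)) [0..<length X] ! i) (emb V x)) (emb V y) = cinner H ((X ! i) x) y"
    if "i < length X" "x \<in> carrier H" "y \<in> carrier H" for i x y
    using that V by (simp add: cinner_K emb_in p_emb p_diag H.ip_simps w)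
qed (simp_all add: X diag_in)

text \<open>\<open>N = diag w\<close> satisfies \<open>N^3 = a^2 N\<close>. A character carries this
  relation over to its value at \<open>N\<close>, and the roots of \<open>z^3 = a^2 z\<close> are
  the three listed numbers.\<close>

lemma character_diag:
  assumes \<chi>: "character K (cstar_generated K G) \<chi>" and G: "G \<subseteq> bounded_ops K K" "diag w \<in> G"
    and w: "\<And>s. w s \<in> {0, a, - a}"
  shows "\<chi> (diag w) \<in> {0, a, - a}"
proof -
  let ?A = "cstar_generated K G"
  note A = K.cstar_generated_cstar[OF G(1)]
  have N: "diag w \<in> ?A" using G K.cstar_generated_incl by blast
  have NN: "op_comp K (diag w) (diag w) \<in> ?A" by (rule cstar_comp[OF A N N])
  have w3: "(\<lambda>s. w s * (w s * w s)) = (\<lambda>s. (a * a) * w s)" using w by (intro ext) fastforce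
  then have e: "op_comp K (diag w) (op_comp K (diag w) (diag w)) = op_scale K (a * a) (diag w)"
    by (simp only: diag_comp diag_scale w3)
  have "\<chi> (op_comp K (diag w) (op_comp K (diag w) (diag w))) = \<chi> (diag w) * (\<chi> (diag w) * \<chi> (diag w))"
    using \<chi> N NN by (simp add: character_def)
  moreover have "\<chi> (op_scale K (a * a) (diag w)) = (a * a) * \<chi> (diag w)"
    using \<chi> N by (simp add: character_def linear_functional_def)
  ultimately have "\<chi> (diag w) * ((\<chi> (diag w) - a) * (\<chi> (diag w) + a)) = 0"
    by (auto simp: e algebra_simps)
  then show ?thesis by (auto simp: eq_neg_iff_add_eq_0)
qed

end

section \<open>Concrete powers: sequences in a Hilbert space, coordinate space, flattened
  powers\<close>

lemma vectorspaceI: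
  fixes K (structure)
  assumes "\<And>x y. x \<in> carrier K \<Longrightarrow> y \<in> carrier K \<Longrightarrow> x \<oplus> y \<in> carrier K"
    and "\<zero> \<in> carrier K"
    and "\<And>x y z. x \<in> carrier K \<Longrightarrow> y \<in> carrier K \<Longrightarrow> z \<in> carrier K \<Longrightarrow> (x \<oplus> y) \<oplus> z = x \<oplus> (y \<oplus> z)"
    and "\<And>x y. x \<in> carrier K \<Longrightarrow> y \<in> carrier K \<Longrightarrow> x \<oplus> y = y \<oplus> x"
    and "\<And>x. x \<in> carrier K \<Longrightarrow> \<zero> \<oplus> x = x"
    and "\<And>x. x \<in> carrier K \<Longrightarrow> \<exists>y\<in>carrier K. y \<oplus> x = \<zero>"
    and "\<And>a x. x \<in> carrier K \<Longrightarrow> (a::'c::field) \<odot>\<^bsub>K\<^esub> x \<in> carrier K"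
    and "\<And>a b x. x \<in> carrier K \<Longrightarrow> (a + b) \<odot>\<^bsub>K\<^esub> x = (a \<odot>\<^bsub>K\<^esub> x) \<oplus> (b \<odot>\<^bsub>K\<^esub> x)"
    and "\<And>a x y. x \<in> carrier K \<Longrightarrow> y \<in> carrier K \<Longrightarrow> a \<odot>\<^bsub>K\<^esub> (x \<oplus> y) = (a \<odot>\<^bsub>K\<^esub> x) \<oplus> (a \<odot>\<^bsub>K\<^esub> y)"
    and "\<And>a b x. x \<in> carrier K \<Longrightarrow> (a * b) \<odot>\<^bsub>K\<^esub> x = a \<odot>\<^bsub>K\<^esub> (b \<odot>\<^bsub>K\<^esub> x)"
    and "\<And>x. x \<in> carrier K \<Longrightarrow> 1 \<odot>\<^bsub>K\<^esub> x = x"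
  shows "vectorspace class_ring K"
proof -
  have "Module.module class_ring K"
  proof (rule moduleI)
    show "cring (class_ring :: 'c ring)" by (rule class_cring.cring_axioms)
    show "abelian_group K" by (rule abelian_groupI) (use assms in auto)
  qed (use assms in auto)
  then show ?thesis using class_field by (rule vectorspace.intro)
qed

text \<open>Padding with zero from \<open>k\<close> on makes equality of functions the same as
  equality of the first \<open>k\<close> coordinates.\<close>

definition hpow :: "'a cinner_space \<Rightarrow> nat \<Rightarrow> (nat \<Rightarrow> 'a) cinner_space" where
  "hpow H k = \<lparr>carrier = {f. (\<forall>s<k. f s \<in> carrier H) \<and> (\<forall>s\<ge>k. f s = \<zero>\<^bsub>H\<^esub>)},
     monoid.mult = undefined, one = undefined, zero = (\<lambda>s. \<zero>\<^bsub>H\<^esub>), add = (\<lambda>f g s. f s \<oplus>\<^bsub>H\<^esub> g s),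
     module.smult = (\<lambda>c f s. c \<odot>\<^bsub>H\<^esub> f s), cinner = (\<lambda>f g. \<Sum>s<k. cinner H (f s) (g s))\<rparr>"

text \<open>The scalars as a Hilbert space: coordinate space is then one of the powers and inherits
  its completeness.\<close>

definition Cc :: "complex cinner_space" where
  "Cc = \<lparr>carrier = UNIV, monoid.mult = (*), one = 1, zero = 0, add = (+), module.smult = (*),
     cinner = (\<lambda>x y. x * cnj y)\<rparr>"

lemma (in hilbert_space) smult_zero_vec: "c \<odot> \<zero> = \<zero>"
  by (rule inner_ext) (simp_all add: ip_simps)

lemma (in hilbert_space) hpow_power: "hilbert_power H (hpow H k) k (\<lambda>s f. f s)"
proof -
  have "vectorspace class_ring (hpow H k)"
  proof (rule vectorspaceI)
    show "\<exists>y\<in>carrier (hpow H k). y \<oplus>\<^bsub>hpow H k\<^esub> x = \<zero>\<^bsub>hpow H k\<^esub>" if "x \<in> carrier (hpow H k)" for x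
      using that by (intro bexI[of _ "\<lambda>s. if s < k then \<ominus> x s else \<zero>"]) (auto simp: hpow_def l_neg fun_eq_iff)
  next
    fix x y z assume "x \<in> carrier (hpow H k)" "y \<in> carrier (hpow H k)" "z \<in> carrier (hpow H k)"
    then have "x s \<in> carrier H" "y s \<in> carrier H" "z s \<in> carrier H" for s
      by (cases "s < k"; simp add: hpow_def)+
    then show "(x \<oplus>\<^bsub>hpow H k\<^esub> y) \<oplus>\<^bsub>hpow H k\<^esub> z = x \<oplus>\<^bsub>hpow H k\<^esub> (y \<oplus>\<^bsub>hpow H k\<^esub> z)"
      by (simp add: hpow_def a_assoc)
  next
    fix x y and a b :: complex assume "x \<in> carrier (hpow H k)" "y \<in> carrier (hpow H k)"
    then have c: "x s \<in> carrier H" "y s \<in> carrier H" for s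
      by (cases "s < k"; simp add: hpow_def)+
    then show "x \<oplus>\<^bsub>hpow H k\<^esub> y = y \<oplus>\<^bsub>hpow H k\<^esub> x" by (simp add: hpow_def a_comm)
    show "a \<odot>\<^bsub>hpow H k\<^esub> (x \<oplus>\<^bsub>hpow H k\<^esub> y) = (a \<odot>\<^bsub>hpow H k\<^esub> x) \<oplus>\<^bsub>hpow H k\<^esub> (a \<odot>\<^bsub>hpow H k\<^esub> y)"
      using c smult_r_distr by (simp add: hpow_def)
  next
    fix x and a b :: complex assume "x \<in> carrier (hpow H k)"
    then have c: "x s \<in> carrier H" for s
      by (cases "s < k"; simp add: hpow_def)+
    show "(a + b) \<odot>\<^bsub>hpow H k\<^esub> x = (a \<odot>\<^bsub>hpow H k\<^esub> x) \<oplus>\<^bsub>hpow H k\<^esub> (b \<odot>\<^bsub>hpow H k\<^esub> x)"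
      using c smult_l_distr by (simp add: hpow_def)
    show "(a * b) \<odot>\<^bsub>hpow H k\<^esub> x = a \<odot>\<^bsub>hpow H k\<^esub> (b \<odot>\<^bsub>hpow H k\<^esub> x)"
      using c smult_assoc1 by (simp add: hpow_def)
    show "1 \<odot>\<^bsub>hpow H k\<^esub> x = x" using c smult_one by (simp add: hpow_def)
    show "\<zero>\<^bsub>hpow H k\<^esub> \<oplus>\<^bsub>hpow H k\<^esub> x = x" using c by (simp add: hpow_def)
  qed (auto simp: hpow_def smult_zero_vec)
  then interpret K: vectorspace class_ring "hpow H k" .
  show ?thesis
  proof
    show "\<exists>x\<in>carrier (hpow H k). \<forall>s<k. x s = f s" if "\<And>s. s < k \<Longrightarrow> f s \<in> carrier H" for f
      using that by (intro bexI[of _ "\<lambda>s. if s < k then f s else \<zero>"]) (auto simp: hpow_def)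
    show "x = y" if "x \<in> carrier (hpow H k)" "y \<in> carrier (hpow H k)" "\<And>s. s < k \<Longrightarrow> x s = y s" for x y
    proof
      show "x s = y s" for s using that by (cases "s < k") (auto simp: hpow_def)
    qed
  qed (auto simp: hpow_def)
qed

lemma Cc_hilbert: "hilbert_space Cc"
proof -
  have "vectorspace class_ring Cc"
  proof (rule vectorspaceI)
    show "\<exists>y\<in>carrier Cc. y \<oplus>\<^bsub>Cc\<^esub> x = \<zero>\<^bsub>Cc\<^esub>" if "x \<in> carrier Cc" for x
      by (intro bexI[of _ "- x"]) (auto simp: Cc_def)
  qed (auto simp: Cc_def algebra_simps)
  then interpret vectorspace class_ring Cc .
  have minus: "x \<ominus>\<^bsub>Cc\<^esub> y = x - y" for x y
  proof -
    have "\<ominus>\<^bsub>Cc\<^esub> y = - y" by (rule M.minus_equality) (simp_all add: Cc_def)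
    then show ?thesis by (simp add: a_minus_def) (simp add: Cc_def)
  qed
  have hn: "hnorm Cc x = cmod x" for x
    by (simp add: hnorm_def Cc_def cmod_def power2_eq_square)
  show ?thesis
  proof
    show "\<exists>l\<in>carrier Cc. (\<lambda>n. hnorm Cc (s n \<ominus>\<^bsub>Cc\<^esub> l)) \<longlonglongrightarrow> 0"
      if "\<And>e. 0 < e \<Longrightarrow> \<exists>M. \<forall>i\<ge>M. \<forall>j\<ge>M. hnorm Cc (s i \<ominus>\<^bsub>Cc\<^esub> s j) < e" for s
    proof -
      have "Cauchy s" using that by (simp add: Cauchy_def minus hn dist_norm)
      then obtain l where "s \<longlonglongrightarrow> l" by (auto simp: Cauchy_convergent_iff convergent_def)
      then show ?thesis
        by (intro bexI[of _ l]) (simp_all add: minus hn tendsto_norm_zero_iff LIM_zero_iff, simp add: Cc_def)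
    qed
    show "0 < Re (cinner Cc x x)" if "x \<noteq> \<zero>\<^bsub>Cc\<^esub>" for x
      using that by (simp add: Cc_def mult_cnj_cmod flip: of_real_power)
  qed (auto simp: Cc_def algebra_simps)
qed

lemma Cn_simps [simp]:
  "carrier (Cn n) = carrier_vec n" "x \<oplus>\<^bsub>Cn n\<^esub> y = x + y" "\<zero>\<^bsub>Cn n\<^esub> = 0\<^sub>v n"
  "c \<odot>\<^bsub>Cn n\<^esub> x = c \<cdot>\<^sub>v x" "cinner (Cn n) x y = x \<bullet>c y"
  by (simp_all add: Cn_def module.extend_def module_vec_def)

lemma Cn_power: "hilbert_power Cc (Cn n) n (\<lambda>s v. v $ s)"
proof -
  interpret Cc: hilbert_space Cc by (rule Cc_hilbert)
  interpret K: vectorspace class_ring "Cn n"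
  proof (rule vectorspaceI)
    show "\<exists>y\<in>carrier (Cn n). y \<oplus>\<^bsub>Cn n\<^esub> x = \<zero>\<^bsub>Cn n\<^esub>" if "x \<in> carrier (Cn n)" for x
      using that by (intro bexI[of _ "- x"]) auto
  qed (auto simp: smult_add_distrib_vec add_smult_distrib_vec comm_add_vec)
  show ?thesis
  proof
    show "\<exists>x\<in>carrier (Cn n). \<forall>s<n. x $ s = f s" for f :: "nat \<Rightarrow> complex"
      by (intro bexI[of _ "vec n f"]) auto
  qed (auto simp: Cc_def scalar_prod_def atLeast0LessThan)
qed

lemma Cn_hilbert: "hilbert_space (Cn n)"
proof -
  interpret hilbert_power Cc "Cn n" n "\<lambda>s v. v $ s" by (rule Cn_power)
  show ?thesis by (rule K.hilbert_space_axioms)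
qed

text \<open>The \<open>k\<close> copies are laid end to end, entry \<open>r\<close> of copy
  \<open>s\<close> at index \<open>s n + r\<close>. This places the dilation space of a matrix tuple
  in the type \<open>nat => complex\<close>.\<close>

lemma Cn_flat_power: "hilbert_power (Cn n) (hpow Cc (k * n)) k (\<lambda>s f. vec n (\<lambda>r. f (s * n + r)))"
proof -
  interpret Cc: hilbert_space Cc by (rule Cc_hilbert)
  interpret P: hilbert_power Cc "hpow Cc (k * n)" "k * n" "\<lambda>s f. f s" by (rule Cc.hpow_power)
  interpret Cn: hilbert_space "Cn n" by (rule Cn_hilbert)
  have idx: "s * n + r < k * n" if "s < k" "r < n" for s r
  proof -
    have "s * n + r < Suc s * n" using that by simp
    also have "\<dots> \<le> k * n" using that by (intro mult_le_mono1) simp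
    finally show ?thesis .
  qed
  show ?thesis
  proof
    show "cinner (hpow Cc (k * n)) x y =
        (\<Sum>s<k. cinner (Cn n) (vec n (\<lambda>r. x (s * n + r))) (vec n (\<lambda>r. y (s * n + r))))" for x y
    proof -
      have "(\<Sum>s<k. \<Sum>r<n. x (s * n + r) * cnj (y (s * n + r))) = (\<Sum>i<k * n. x i * cnj (y i))"
      proof -
        have "(\<Sum>r<n. x (s * n + r) * cnj (y (s * n + r))) = (\<Sum>i = s*n..<s*n+n. x i * cnj (y i))" for s
          using sum.shift_bounds_nat_ivl[of "\<lambda>i. x i * cnj (y i)" 0 "s * n" n]
          by (simp add: atLeast0LessThan add.commute)
        then show ?thesis using sum.nat_group[of "\<lambda>i. x i * cnj (y i)" n k] by simp
      qed
      then show ?thesis by (simp add: hpow_def Cc_def scalar_prod_def atLeast0LessThan)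
    qed
    show "\<exists>x\<in>carrier (hpow Cc (k * n)). \<forall>s<k. vec n (\<lambda>r. x (s * n + r)) = f s"
      if f: "\<And>s. s < k \<Longrightarrow> f s \<in> carrier (Cn n)" for f
    proof (intro bexI[of _ "\<lambda>i. if i < k * n then f (i div n) $ (i mod n) else 0"] allI impI)
      fix s assume s: "s < k"
      show "vec n (\<lambda>r. if s * n + r < k * n then f ((s * n + r) div n) $ ((s * n + r) mod n) else 0) = f s"
        using f[OF s] idx[OF s] by (intro eq_vecI) auto
    qed (auto simp: hpow_def Cc_def)
    show "x = y" if x: "x \<in> carrier (hpow Cc (k * n))" and y: "y \<in> carrier (hpow Cc (k * n))"
      and e: "\<And>s. s < k \<Longrightarrow> vec n (\<lambda>r. x (s * n + r)) = vec n (\<lambda>r. y (s * n + r))" for x y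
    proof (rule P.p_inj[OF x y])
      fix i assume i: "i < k * n"
      then have n: "0 < n" by (cases n) auto
      have "i div n < k" using i by (simp add: less_mult_imp_div_less)
      from arg_cong[OF e[OF this], of "\<lambda>v. v $ (i mod n)"] show "x i = y i" using n by simp
    qed
  qed (auto simp: hpow_def Cc_def)
qed

section \<open>Tuples with numerical range in the polydisk\<close>

lemma polydisk_iff:
  "v \<in> map_vec complex_of_real ` closed_polydisk d \<longleftrightarrow>
     v \<in> carrier_vec (2 * d) \<and> (\<forall>i<2*d. Im (v $ i) = 0) \<and>
     (\<forall>j<d. (Re (v $ (2 * j)))\<^sup>2 + (Re (v $ (2 * j + 1)))\<^sup>2 \<le> 1)" (is "?L \<longleftrightarrow> ?R")
proof
  assume ?L
  then obtain z where z: "z \<in> carrier_vec d" "\<And>j. j < d \<Longrightarrow> cmod (z $ j) \<le> 1"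
    and v: "v = map_vec complex_of_real (realify z)"
    by (auto simp: closed_polydisk_def)
  have "(Re (z $ j))\<^sup>2 + (Im (z $ j))\<^sup>2 \<le> 1" if "j < d" for j
    using z(2)[OF that] by (simp add: cmod_power2[symmetric] power_le_one)
  then show ?R using z(1) by (auto simp: v realify_def)
next
  assume R: ?R
  define z where "z = vec d (\<lambda>j. Complex (Re (v $ (2 * j))) (Re (v $ (2 * j + 1))))"
  have "cmod (z $ j) \<le> 1" if "j < d" for j
  proof -
    have "(cmod (z $ j))\<^sup>2 \<le> 1" using R that by (simp add: cmod_power2 z_def)
    then show ?thesis by (simp add: abs_square_le_1)
  qed
  moreover have "v = map_vec complex_of_real (realify z)"
  proof (rule eq_vecI)
    fix i assume "i < dim_vec (map_vec complex_of_real (realify z))"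
    then have i: "i < 2 * d" by (simp add: realify_def z_def)
    have "2 * (i div 2) + (if even i then 0 else 1) = i" by presburger
    then show "v $ i = map_vec complex_of_real (realify z) $ i"
      using i R by (auto simp: realify_def z_def complex_eq_iff split: if_splits)
  qed (use R in \<open>simp add: realify_def z_def\<close>)
  moreover have "z \<in> carrier_vec d" by (simp add: z_def)
  ultimately show ?L unfolding closed_polydisk_def by blast
qed

context hilbert_space
begin

lemma vector_state:
  assumes G: "G \<subseteq> bounded_ops H H" and h: "h \<in> carrier H" "hnorm H h = 1"
  shows "state H (cstar_generated H G) (\<lambda>S. cinner H (S h) h)"
proof -
  have B: "S \<in> bounded_ops H H" if "S \<in> cstar_generated H G" for S
    using that cstar_generated_subset[OF G] by blast
  have "cinner H (op_adj H H S (S h)) h = complex_of_real ((hnorm H (S h))\<^sup>2)"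
    if "S \<in> cstar_generated H G" for S
    using B[OF that] h by (simp add: HH.cinner_op_adj_left cinner_self del: of_real_power)
  then show ?thesis
    using h B cinner_self[OF h(1)]
    by (auto simp: state_def linear_functional_def ip_simps simp del: of_real_power)
qed

text \<open>For self-adjoint \<open>X\<close> the numerical radius is the norm: polarisation
  expresses \<open>4 Re <X x, y>\<close> by the quadratic form at \<open>x + y\<close> and
  \<open>x - y\<close>, and the parallelogram law bounds the result.\<close>

lemma sa_numerical_bound:
  assumes X: "X \<in> bounded_ops H H"
    and sa: "\<And>x y. x \<in> carrier H \<Longrightarrow> y \<in> carrier H \<Longrightarrow> cinner H (X x) y = cinner H x (X y)"
    and num: "\<And>h. h \<in> carrier H \<Longrightarrow> hnorm H h = 1 \<Longrightarrow> \<bar>Re (cinner H (X h) h)\<bar> \<le> 1"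
    and x: "x \<in> carrier H"
  shows "hnorm H (X x) \<le> hnorm H x"
proof -
  have q: "\<bar>Re (cinner H (X h) h)\<bar> \<le> (hnorm H h)\<^sup>2" if h: "h \<in> carrier H" for h
  proof (cases "hnorm H h = 0")
    case True
    then show ?thesis using h X HH.bop_zero[OF X] by (simp add: hnorm_eq_0 cinner_zero_left)
  next
    case False
    let ?c = "complex_of_real (inverse (hnorm H h))"
    have "hnorm H (?c \<odot> h) = 1" using False h by (simp add: hnorm_smult norm_inverse)
    from num[OF _ this] have "\<bar>Re (?c * (?c * cinner H (X h) h))\<bar> \<le> 1"
      using h X by (simp add: bop_smult ip_simps)
    moreover have "\<bar>hnorm H h\<bar> = hnorm H h" using h by simp
    ultimately have "(inverse (hnorm H h))\<^sup>2 * \<bar>Re (cinner H (X h) h)\<bar> \<le> 1"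
      by (simp add: power2_eq_square abs_mult del: of_real_inverse)
    moreover have "0 < hnorm H h" using False hnorm_ge[OF h] by linarith
    ultimately show ?thesis by (simp add: field_simps power2_eq_square)
  qed
  have key: "2 * Re (cinner H (X x) y) \<le> (hnorm H x)\<^sup>2 + (hnorm H y)\<^sup>2"
    if x: "x \<in> carrier H" and y: "y \<in> carrier H" for x y
  proof -
    have "cinner H (X y) x = cnj (cinner H (X x) y)"
      using sa[OF y x] cinner_commute[of "X x" y] X x y by simp
    then have "4 * Re (cinner H (X x) y)
        = Re (cinner H (X (x \<oplus> y)) (x \<oplus> y)) - Re (cinner H (X (x \<ominus> y)) (x \<ominus> y))"
      using x y X by (simp add: bop_add HH.bop_diff ip_simps)
    also have "\<dots> \<le> (hnorm H (x \<oplus> y))\<^sup>2 + (hnorm H (x \<ominus> y))\<^sup>2"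
      using q[of "x \<oplus> y"] q[of "x \<ominus> y"] x y by (simp add: abs_le_iff)
    also have "\<dots> = 2 * ((hnorm H x)\<^sup>2 + (hnorm H y)\<^sup>2)"
      using x y by (simp add: hnorm_add_sq hnorm_diff_sq)
    finally show ?thesis by simp
  qed
  show ?thesis
  proof (rule ccontr)
    assume n: "\<not> hnorm H (X x) \<le> hnorm H x"
    define a where "a = hnorm H x"
    define b where "b = hnorm H (X x)"
    have ab: "0 \<le> a" "a < b" using n x by (auto simp: a_def b_def)
    \<comment> \<open>The vectors \<open>b x\<close> and \<open>a X x\<close> have the common norm
      \<open>a b\<close>, which makes the bound sharpest: it becomes
      \<open>a b^3 \<le> a^2 b^2\<close>, impossible for \<open>0 < a < b\<close>.\<close>
    have "2 * Re (cinner H (X (complex_of_real b \<odot> x)) (complex_of_real a \<odot> X x))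
        \<le> (hnorm H (complex_of_real b \<odot> x))\<^sup>2 + (hnorm H (complex_of_real a \<odot> X x))\<^sup>2"
      using x X by (intro key) auto
    moreover have "Re (cinner H (X (complex_of_real b \<odot> x)) (complex_of_real a \<odot> X x)) = b * (a * b\<^sup>2)"
      using x X by (simp add: bop_smult ip_simps b_def hnorm_sq)
    moreover have "hnorm H (complex_of_real b \<odot> x) = b * a" "hnorm H (complex_of_real a \<odot> X x) = a * b"
      using x X ab by (simp_all add: hnorm_smult a_def[symmetric] b_def[symmetric])
    ultimately have "b * (a * b\<^sup>2) \<le> (a * b)\<^sup>2" by (simp add: mult.commute)
    then have "a * b\<^sup>2 * (b - a) \<le> 0" by (simp add: algebra_simps power2_eq_square)
    then have "a = 0" using ab by (auto simp: mult_le_0_iff)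
    then have "x = \<zero>" using x by (simp add: a_def hnorm_eq_0)
    then show False using n HH.bop_zero[OF X] by simp
  qed
qed

end

section \<open>Matrices as operators on coordinate space\<close>

lemma cscalar_prod_sum: "x \<in> carrier_vec n \<Longrightarrow> y \<in> carrier_vec n \<Longrightarrow> x \<bullet>c y = (\<Sum>i<n. x $ i * cnj (y $ i))"
  for x y :: "complex vec"
  by (simp add: scalar_prod_def atLeast0LessThan)

lemma mult_mat_vec_index:
  "A \<in> carrier_mat n n \<Longrightarrow> v \<in> carrier_vec n \<Longrightarrow> i < n \<Longrightarrow> (A *\<^sub>v v) $ i = (\<Sum>j<n. A $$ (i, j) * v $ j)"
  by (simp add: scalar_prod_def atLeast0LessThan)

lemma mat_op_app [simp]: "v \<in> carrier_vec n \<Longrightarrow> mat_op n A v = A *\<^sub>v v"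
  by (simp add: mat_op_def)

lemma mat_op_in:
  assumes A: "A \<in> carrier_mat n n"
  shows "mat_op n A \<in> bounded_ops (Cn n) (Cn n)"
proof -
  interpret P: hilbert_power Cc "Cn n" n "\<lambda>s v. v $ s" by (rule Cn_power)
  have Cc: "hnorm Cc z = cmod z" for z
    by (simp add: hnorm_def Cc_def cmod_def power2_eq_square)
  define c where "c = (\<Sum>i<n. \<Sum>j<n. cmod (A $$ (i, j)))"
  have c: "0 \<le> c" by (simp add: c_def sum_nonneg)
  show ?thesis
    unfolding mat_op_def Cn_simps(1)[symmetric]
  proof (rule P.K.HH.bopI)
    fix v assume v: "v \<in> carrier (Cn n)"
    have "cmod ((A *\<^sub>v v) $ i) \<le> c * hnorm (Cn n) v" if i: "i < n" for i
    proof -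
      have "cmod ((A *\<^sub>v v) $ i) = cmod (\<Sum>j<n. A $$ (i, j) * v $ j)"
        using A v i by (simp only: Cn_simps mult_mat_vec_index)
      also have "\<dots> \<le> (\<Sum>j<n. cmod (A $$ (i, j)) * hnorm (Cn n) v)"
        using P.hnorm_p_le[OF _ v] by (intro sum_norm_le) (auto simp: norm_mult Cc intro!: mult_left_mono)
      also have "\<dots> \<le> c * hnorm (Cn n) v"
        unfolding sum_distrib_right[symmetric] c_def
        using i v by (intro mult_right_mono member_le_sum[of i "{..<n}" "\<lambda>i. \<Sum>j<n. cmod (A $$ (i, j))"])
            (auto simp: sum_nonneg)
      finally show ?thesis .
    qed
    then have "(\<Sum>i<n. (cmod ((A *\<^sub>v v) $ i))\<^sup>2) \<le> (\<Sum>i<n. (c * hnorm (Cn n) v)\<^sup>2)"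
      by (intro sum_mono power_mono) auto
    also have "\<dots> = real n * (c * hnorm (Cn n) v)\<^sup>2" by simp
    \<comment> \<open>Weakening \<open>n\<close> to \<open>n^2\<close> turns the right-hand side
      into a perfect square.\<close>
    also have "\<dots> \<le> (real n)\<^sup>2 * (c * hnorm (Cn n) v)\<^sup>2"
      by (intro mult_right_mono, cases "n = 0") (auto simp: power2_eq_square)
    finally have "(hnorm (Cn n) (A *\<^sub>v v))\<^sup>2 \<le> (real n * c * hnorm (Cn n) v)\<^sup>2"
      using A v by (subst P.hnorm_K_sq) (auto simp: Cc power_mult_distrib mult.assoc)
    then show "hnorm (Cn n) (A *\<^sub>v v) \<le> (real n * c) * hnorm (Cn n) v"
      by (rule power2_le_imp_le) (use c v in simp)
  qed (use A in \<open>auto simp: mult_add_distrib_mat_vec mult_mat_vec\<close>)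
qed

lemma mat_adjoint_index:
  "A \<in> carrier_mat n n \<Longrightarrow> i < n \<Longrightarrow> j < n \<Longrightarrow> mat_adjoint A $$ (i, j) = cnj (A $$ (j, i))"
  for A :: "complex mat"
  by (simp add: mat_adjoint_def mat_of_rows_def)

lemma mat_sa_cinner:
  fixes A :: "complex mat"
  assumes A: "A \<in> carrier_mat n n" "mat_adjoint A = A" and x: "x \<in> carrier_vec n" and y: "y \<in> carrier_vec n"
  shows "(A *\<^sub>v x) \<bullet>c y = x \<bullet>c (A *\<^sub>v y)"
proof -
  have "(A *\<^sub>v x) \<bullet>c y = (\<Sum>i<n. \<Sum>j<n. A $$ (i, j) * x $ j * cnj (y $ i))"
    using A x y by (subst cscalar_prod_sum[of _ n]) (auto simp: mult_mat_vec_index sum_distrib_right simp del: index_mult_mat_vec)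
  also have "\<dots> = (\<Sum>j<n. \<Sum>i<n. A $$ (i, j) * x $ j * cnj (y $ i))" by (rule sum.swap)
  also have "\<dots> = (\<Sum>j<n. \<Sum>i<n. x $ j * (cnj (A $$ (j, i)) * cnj (y $ i)))"
  proof (intro sum.cong refl)
    fix i j assume "i \<in> {..<n}" "j \<in> {..<n}"
    then have "A $$ (i, j) = cnj (A $$ (j, i))" using mat_adjoint_index[OF A(1), of i j] A(2) by simp
    then show "A $$ (i, j) * x $ j * cnj (y $ i) = x $ j * (cnj (A $$ (j, i)) * cnj (y $ i))" by simp
  qed
  also have "\<dots> = x \<bullet>c (A *\<^sub>v y)"
    using A x y by (subst cscalar_prod_sum[of _ n]) (auto simp: mult_mat_vec_index sum_distrib_left simp del: index_mult_mat_vec)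
  finally show ?thesis .
qed

text \<open>Vector states belong to the matrix range. Both real coordinates of a point of the disk
  are at most 1 in modulus, so every \<open><X_j h, h>\<close> with \<open>h\<close> a unit vector
  lies in \<open>[-1, 1]\<close>, which bounds the norm of the self-adjoint
  \<open>X_j\<close>.\<close>

lemma W_max_contractions:
  assumes X: "X \<in> W_max_level (2 * d) n (closed_polydisk d)" and j: "j < 2 * d"
  shows "X ! j \<in> carrier_mat n n" "mat_adjoint (X ! j) = X ! j"
    and "x \<in> carrier_vec n \<Longrightarrow> hnorm (Cn n) (X ! j *\<^sub>v x) \<le> hnorm (Cn n) x"
proof -
  interpret Cn: hilbert_space "Cn n" by (rule Cn_hilbert)
  have len: "length X = 2 * d" and sa: "\<And>A. A \<in> set X \<Longrightarrow> A \<in> carrier_mat n n \<and> mat_adjoint A = A"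
    using X by (auto simp: W_max_level_def sa_tuples_def)
  have Xj: "X ! j \<in> set X" using len j by simp
  show 1: "X ! j \<in> carrier_mat n n" "mat_adjoint (X ! j) = X ! j" using sa[OF Xj] by auto
  have G: "set (map (mat_op n) X) \<subseteq> bounded_ops (Cn n) (Cn n)" using sa mat_op_in by auto
  have num: "\<bar>Re (cinner (Cn n) (mat_op n (X ! j) h) h)\<bar> \<le> 1"
    if h: "h \<in> carrier (Cn n)" "hnorm (Cn n) h = 1" for h
  proof -
    define v where "v = vec (2 * d) (\<lambda>i. cinner (Cn n) (mat_op n (X ! i) h) h)"
    have "v \<in> W1 (Cn n) (map (mat_op n) X)"
      unfolding W1_def v_def using Cn.vector_state[OF G h] len
      by (intro CollectI exI[of _ "\<lambda>S. cinner (Cn n) (S h) h"] conjI) (auto intro!: eq_vecI)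
    then have "v \<in> map_vec complex_of_real ` closed_polydisk d"
      using X by (auto simp: W_max_level_def)
    \<comment> \<open>\<open>j div 2\<close> numbers the disk to which the \<open>j\<close>-th of
      the \<open>2 d\<close> real coordinates belongs.\<close>
    then have "(Re (v $ (2 * (j div 2))))\<^sup>2 + (Re (v $ (2 * (j div 2) + 1)))\<^sup>2 \<le> 1"
      using j by (auto simp: polydisk_iff)
    then have "(Re (v $ (2 * (j div 2))))\<^sup>2 \<le> 1" "(Re (v $ (2 * (j div 2) + 1)))\<^sup>2 \<le> 1"
      using zero_le_power2[of "Re (v $ (2 * (j div 2)))"] zero_le_power2[of "Re (v $ (2 * (j div 2) + 1))"]
      by linarith+
    moreover have "j = 2 * (j div 2) \<or> j = 2 * (j div 2) + 1" by presburger
    ultimately have "(Re (v $ j))\<^sup>2 \<le> 1" by (elim disjE) simp_all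
    then have "\<bar>Re (v $ j)\<bar> \<le> 1" by (simp add: abs_square_le_1)
    then show ?thesis using j by (simp add: v_def)
  qed
  assume x: "x \<in> carrier_vec n"
  have "hnorm (Cn n) (mat_op n (X ! j) x) \<le> hnorm (Cn n) x"
  proof (rule Cn.sa_numerical_bound[OF mat_op_in[OF 1(1)] _ num])
    show "cinner (Cn n) (mat_op n (X ! j) x) y = cinner (Cn n) x (mat_op n (X ! j) y)"
      if "x \<in> carrier (Cn n)" "y \<in> carrier (Cn n)" for x y
      using mat_sa_cinner[OF 1, of x y] that by simp
  qed (use x in simp_all)
  then show "hnorm (Cn n) (X ! j *\<^sub>v x) \<le> hnorm (Cn n) x" using x by simp
qed

lemma mat_adjoint_smult_real:
  "A \<in> carrier_mat n n \<Longrightarrow> mat_adjoint (complex_of_real c \<cdot>\<^sub>m A) = complex_of_real c \<cdot>\<^sub>m mat_adjoint A"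
  by (rule eq_matI) (auto simp: mat_adjoint_def mat_of_rows_def)

theorem W_max_subset_scaled_W_min:
  assumes d: "d \<ge> 1"
  shows "W_max (2 * d) (closed_polydisk d)
       \<subseteq> scale_tuples (2 * sqrt (real d))
            (W_min TYPE(nat \<Rightarrow> complex) (2 * d) (closed_polydisk d))"
proof
  fix X assume "X \<in> W_max (2 * d) (closed_polydisk d)"
  then obtain n where n: "n \<ge> 1" and X: "X \<in> W_max_level (2 * d) n (closed_polydisk d)"
    by (auto simp: W_max_def)
  have len: "length X = 2 * d" using X by (auto simp: W_max_level_def sa_tuples_def)
  interpret Cn: hilbert_space "Cn n" by (rule Cn_hilbert)
  note XM = W_max_contractions(1)[OF X] and Xsa = W_max_contractions(2)[OF X]
    and Xc = W_max_contractions(3)[OF X]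
  let ?X = "\<lambda>j. mat_op n (X ! j)"
  have m1: "1 \<le> 2 * d" using d by simp
  have X1: "?X j \<in> bounded_ops (Cn n) (Cn n)" if "j < 2 * d" for j
    by (rule mat_op_in[OF XM[OF that]])
  have X2: "cinner (Cn n) (?X j x) y = cinner (Cn n) x (?X j y)"
    if "j < 2 * d" "x \<in> carrier (Cn n)" "y \<in> carrier (Cn n)" for j x y
    using mat_sa_cinner[OF XM[OF that(1)] Xsa[OF that(1)]] that by simp
  have X3: "hnorm (Cn n) (?X j x) \<le> hnorm (Cn n) x" if "j < 2 * d" "x \<in> carrier (Cn n)" for j x
    using Xc[OF that(1)] that by simp
  have "\<exists>k V lam. sign_dilation (Cn n) (2 * d) ?X k V lam"
    by (rule Cn.ex_sign_dilation) (rule m1 X1 X2 X3 | assumption)+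
  then obtain k V lam where dil: "sign_dilation (Cn n) (2 * d) ?X k V lam" by blast
  note V = sign_dilation_in[OF dil] and lam = sign_dilation_sign[OF dil]
    and one = sign_dilation_one[OF dil] and mom = sign_dilation_moment[OF dil]
  let ?K = "hpow Cc (k * n)"
  interpret P: hilbert_power "Cn n" ?K k "\<lambda>s f. vec n (\<lambda>r. f (s * n + r))" by (rule Cn_flat_power)
  define c where "c = 2 * sqrt (real d)"
  have c: "c > 0" using d by (simp add: c_def)
  define Y where "Y = map (\<lambda>A. complex_of_real (1 / c) \<cdot>\<^sub>m A) X"
  \<comment> \<open>Dividing the signs by \<open>\<surd>2\<close> puts every pair of coordinates
    into the closed unit disk. Together with the factor \<open>1 / \<surd>(2 d)\<close> in the
    moments of \<open>lam\<close> this produces the barycentre \<open>X / c\<close>.\<close>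
  define w where "w j s = complex_of_real (lam s j / sqrt 2)" for j s
  define N where "N = map (\<lambda>j. P.diag (w j)) [0..<length (map (mat_op n) Y)]"
  have lenY: "length Y = 2 * d" by (simp add: Y_def len)
  have YM: "Y ! j \<in> carrier_mat n n" and Yj: "Y ! j = complex_of_real (1 / c) \<cdot>\<^sub>m (X ! j)" if "j < 2 * d" for j
    using XM[OF that] that len by (auto simp: Y_def)
  have wr: "w j s \<in> {0, complex_of_real (1 / sqrt 2), - complex_of_real (1 / sqrt 2)}" for j s
    using lam[of s j] by (auto simp: w_def)
  have "dilation (Cn n) ?K (map (mat_op n) Y) N"
    unfolding N_def
  proof (rule P.diag_dilation[of V])
    fix j x y assume "j < length (map (mat_op n) Y)" and x: "x \<in> carrier (Cn n)" and y: "y \<in> carrier (Cn n)"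
    then have j: "j < 2 * d" by (simp add: lenY)
    have "(\<Sum>s<k. w j s * cinner (Cn n) (V s x) (V s y))
        = (\<Sum>s<k. complex_of_real (lam s j) * cinner (Cn n) (V s x) (V s y)) / complex_of_real (sqrt 2)"
      by (simp add: w_def sum_divide_distrib)
    also have "\<dots> = cinner (Cn n) (?X j x) y / complex_of_real (sqrt (real (2 * d)) * sqrt 2)"
      using mom x y j by simp
    also have "sqrt (real (2 * d)) * sqrt 2 = c"
      by (simp add: c_def real_sqrt_mult)
    also have "cinner (Cn n) (?X j x) y / complex_of_real c = cinner (Cn n) ((map (mat_op n) Y ! j) x) y"
    proof -
      have "(complex_of_real (1 / c) \<cdot>\<^sub>m (X ! j)) *\<^sub>v x = complex_of_real (1 / c) \<cdot>\<^sub>v (X ! j *\<^sub>v x)"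
        using XM[OF j] x by (intro eq_vecI) auto
      then show ?thesis using x y j lenY XM[OF j] by (simp add: Yj)
    qed
    finally show "(\<Sum>s<k. w j s * cinner (Cn n) (V s x) (V s y)) = cinner (Cn n) ((map (mat_op n) Y ! j) x) y" .
  qed (use V one YM mat_op_in lenY in auto)
  moreover have "normal_tuple ?K N" unfolding N_def by (rule P.diag_normal_tuple)
  moreover have "joint_spectrum ?K N \<subseteq> map_vec complex_of_real ` closed_polydisk d"
  proof
    fix v assume "v \<in> joint_spectrum ?K N"
    then obtain \<chi> where \<chi>: "character ?K (cstar_generated ?K (set N)) \<chi>"
      and v: "v = vec (length N) (\<lambda>i. \<chi> (N ! i))" by (auto simp: joint_spectrum_def)
    have lenN: "length N = 2 * d" by (simp add: N_def lenY)
    have "v $ i \<in> {0, complex_of_real (1 / sqrt 2), - complex_of_real (1 / sqrt 2)}" if i: "i < 2 * d" for i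
    proof -
      have "N ! i = P.diag (w i)" using i by (simp add: N_def lenY)
      moreover have "\<chi> (P.diag (w i)) \<in> {0, complex_of_real (1 / sqrt 2), - complex_of_real (1 / sqrt 2)}"
      proof (rule P.character_diag[OF \<chi>])
        show "set N \<subseteq> bounded_ops ?K ?K" by (auto simp: N_def P.diag_in)
        show "P.diag (w i) \<in> set N" using i by (auto simp: N_def lenY)
      qed (rule wr)
      ultimately show ?thesis using i by (simp add: v lenN)
    qed
    then have "Im (v $ i) = 0 \<and> (Re (v $ i))\<^sup>2 \<le> 1 / 2" if "i < 2 * d" for i
      using that by (fastforce simp: power_divide)
    then have "Im (v $ i) = 0" "(Re (v $ i))\<^sup>2 \<le> 1 / 2" if "i < 2 * d" for i
      using that by blast+
    note vi = this
    have "(Re (v $ (2 * j)))\<^sup>2 + (Re (v $ (2 * j + 1)))\<^sup>2 \<le> 1" if "j < d" for j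
      using vi(2)[of "2 * j"] vi(2)[of "2 * j + 1"] that by simp
    then show "v \<in> map_vec complex_of_real ` closed_polydisk d"
      using vi(1) by (simp add: polydisk_iff v lenN)
  qed
  moreover have "Y \<in> sa_tuples (2 * d) n"
  proof -
    have "A \<in> carrier_mat n n \<and> mat_adjoint A = A" if "A \<in> set Y" for A
    proof -
      obtain j where j: "j < 2 * d" "A = Y ! j" using \<open>A \<in> set Y\<close> lenY by (metis in_set_conv_nth)
      then show ?thesis using YM[OF j(1)] mat_adjoint_smult_real[OF XM[OF j(1)]] Xsa[OF j(1)]
        by (simp add: Yj del: of_real_divide)
    qed
    then show ?thesis by (simp add: sa_tuples_def lenY)
  qed
  ultimately have "Y \<in> W_min_level TYPE(nat \<Rightarrow> complex) (2 * d) n (closed_polydisk d)"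
    using P.K.hilbert_space_axioms by (auto simp: W_min_level_def)
  then have "Y \<in> W_min TYPE(nat \<Rightarrow> complex) (2 * d) (closed_polydisk d)"
    using n by (auto simp: W_min_def)
  moreover have "X = map (\<lambda>A. complex_of_real c \<cdot>\<^sub>m A) Y"
  proof (rule nth_equalityI)
    fix j assume j: "j < length X"
    have "complex_of_real c \<cdot>\<^sub>m (complex_of_real (1 / c) \<cdot>\<^sub>m X ! j) = X ! j"
      using c by (intro eq_matI) auto
    then show "X ! j = map (\<lambda>A. complex_of_real c \<cdot>\<^sub>m A) Y ! j"
      using j by (simp add: Y_def)
  qed (simp add: Y_def)
  ultimately show "X \<in> scale_tuples (2 * sqrt (real d)) (W_min TYPE(nat \<Rightarrow> complex) (2 * d) (closed_polydisk d))"
    by (auto simp: scale_tuples_def c_def)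
qed

section \<open>Normal dilations of contractions\<close>

context hilbert_space
begin

lemma contraction_in: "contraction H T \<Longrightarrow> T \<in> bounded_ops H H"
  by (simp add: contraction_def)

lemma contraction_bound: "contraction H T \<Longrightarrow> x \<in> carrier H \<Longrightarrow> hnorm H (T x) \<le> hnorm H x"
  using HH.hnorm_le_op_norm[of T x] mult_right_mono[of "op_norm H H T" 1 "hnorm H x"]
  by (simp add: contraction_def)

lemma contraction_adj: "contraction H T \<Longrightarrow> contraction H (op_adj H H T)"
  using HH.hnorm_op_adj[of T 1] contraction_in[of T] contraction_bound[of T]
  unfolding contraction_def[of H "op_adj H H T"]
  by (intro conjI HH.op_norm_le) simp_all

lemma ex_dilation_2_sqrt:
  assumes d: "d \<ge> 1" and len: "length T = d" and T: "\<And>S. S \<in> set T \<Longrightarrow> contraction H S"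
  shows "\<exists>(K :: (nat \<Rightarrow> 'a) cinner_space) N. hilbert_space K \<and> normal_tuple K N \<and> dilation H K T N \<and>
           (\<forall>S\<in>set N. op_norm K K S \<le> 2 * sqrt (real d))"
proof -
  have Tc: "contraction H (T ! j)" if "j < d" for j using T len that by simp
  note Tin = contraction_in[OF Tc] and Tb = contraction_bound[OF Tc]
  have Tb': "hnorm H (op_adj H H (T ! j) x) \<le> hnorm H x" if "j < d" "x \<in> carrier H" for j x
    using contraction_bound[OF contraction_adj[OF Tc[OF that(1)]] that(2)] .
  \<comment> \<open>Real and imaginary parts of \<open>T ! (i div 2)\<close>, interleaved like the
    real coordinates of the polydisk.\<close>
  define X where "X i = (if even i
      then op_scale H (1/2) (op_add H (T ! (i div 2)) (op_adj H H (T ! (i div 2))))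
      else op_scale H (- \<i> / 2) (op_add H (T ! (i div 2)) (op_scale H (- 1) (op_adj H H (T ! (i div 2))))))" for i
  have i2: "i div 2 < d" if "i < 2 * d" for i using that by simp
  have m1: "1 \<le> 2 * d" using d by simp
  have X1: "X i \<in> bounded_ops H H" if "i < 2 * d" for i
    using Tin[OF i2[OF that]] by (simp add: X_def)
  have X2: "cinner H (X i x) y = cinner H x (X i y)"
    if "i < 2 * d" "x \<in> carrier H" "y \<in> carrier H" for i x y
    using Tin[OF i2[OF that(1)]] that(2,3)
    by (simp add: X_def ip_simps HH.cinner_op_adj HH.cinner_op_adj_left algebra_simps)
  have X3: "hnorm H (X i x) \<le> hnorm H x" if i: "i < 2 * d" and x: "x \<in> carrier H" for i x
  proof -
    let ?S = "T ! (i div 2)"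
    have S: "?S x \<in> carrier H" "op_adj H H ?S x \<in> carrier H" using Tin[OF i2[OF i]] x by simp_all
    have "hnorm H (op_scale H (- 1) (op_adj H H ?S) x) = hnorm H (op_adj H H ?S x)"
      using S x by (simp add: hnorm_smult)
    then show ?thesis
      using hnorm_triangle[of "?S x" "op_adj H H ?S x"] hnorm_triangle[of "?S x" "op_scale H (- 1) (op_adj H H ?S) x"]
        Tb[OF i2[OF i] x] Tb'[OF i2[OF i] x] S x
      by (simp add: X_def hnorm_smult norm_divide)
  qed
  have "\<exists>k V lam. sign_dilation H (2 * d) X k V lam"
    by (rule ex_sign_dilation) (rule m1 X1 X2 X3 | assumption)+
  then obtain k V lam where dil: "sign_dilation H (2 * d) X k V lam" by blast
  note V = sign_dilation_in[OF dil] and lam = sign_dilation_sign[OF dil]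
    and one = sign_dilation_one[OF dil] and mom = sign_dilation_moment[OF dil]
  interpret P: hilbert_power H "hpow H k" k "\<lambda>s f. f s" by (rule hpow_power)
  define r where "r = sqrt (real (2 * d))"
  have r: "r > 0" using d by (simp add: r_def)
  \<comment> \<open>The moments of \<open>lam\<close> are those of \<open>X / r\<close>, so the
    factor \<open>r\<close> restores \<open>T\<close>. A sum of a sign and \<open>\<i>\<close> times
    a sign has modulus at most \<open>\<surd>2\<close>, whence the bound
    \<open>r \<surd>2 = 2 \<surd>d\<close>.\<close>
  define w where "w j s = complex_of_real r * (complex_of_real (lam s (2 * j)) + \<i> * complex_of_real (lam s (2 * j + 1)))" for j s
  define N where "N = map (\<lambda>j. P.diag (w j)) [0..<length T]"
  have wb: "cmod (w j s) \<le> 2 * sqrt (real d)" for j s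
  proof -
    have "(lam s i)\<^sup>2 \<le> 1" for i using lam[of s i] by auto
    then have "(cmod (complex_of_real (lam s (2 * j)) + \<i> * complex_of_real (lam s (2 * j + 1))))\<^sup>2 \<le> 2"
      by (simp add: cmod_power2) (smt (verit))
    then have "cmod (complex_of_real (lam s (2 * j)) + \<i> * complex_of_real (lam s (2 * j + 1))) \<le> sqrt 2"
      by (rule real_le_rsqrt)
    then have "cmod (w j s) \<le> r * sqrt 2"
      using r by (simp add: w_def norm_mult)
    also have "r * sqrt 2 = 2 * sqrt (real d)" by (simp add: r_def real_sqrt_mult)
    finally show ?thesis .
  qed
  have "dilation H (hpow H k) T N"
    unfolding N_def
  proof (rule P.diag_dilation[OF V one])
    fix j x y assume "j < length T" and x: "x \<in> carrier H" and y: "y \<in> carrier H"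
    then have j: "j < d" using len by simp
    have "(\<Sum>s<k. w j s * cinner H (V s x) (V s y))
       = complex_of_real r * ((\<Sum>s<k. complex_of_real (lam s (2 * j)) * cinner H (V s x) (V s y))
          + \<i> * (\<Sum>s<k. complex_of_real (lam s (2 * j + 1)) * cinner H (V s x) (V s y)))"
      unfolding sum_distrib_left sum.distrib[symmetric]
      by (intro sum.cong refl) (simp add: w_def algebra_simps)
    also have "\<dots> = complex_of_real r * (cinner H (X (2 * j) x) y / complex_of_real r
          + \<i> * (cinner H (X (2 * j + 1) x) y / complex_of_real r))"
      using j x y by (simp only: mom r_def)
    also have "\<dots> = cinner H (X (2 * j) x) y + \<i> * cinner H (X (2 * j + 1) x) y"
      using r by (simp add: field_simps)
    also have "\<dots> = cinner H ((T ! j) x) y"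
      using Tin[OF j] x y by (simp add: X_def ip_simps HH.cinner_op_adj_left algebra_simps)
    finally show "(\<Sum>s<k. w j s * cinner H (V s x) (V s y)) = cinner H ((T ! j) x) y" .
  qed (use Tin len in auto)
  moreover have "op_norm (hpow H k) (hpow H k) S \<le> 2 * sqrt (real d)" if "S \<in> set N" for S
  proof -
    obtain j where S: "S = P.diag (w j)" using \<open>S \<in> set N\<close> by (auto simp: N_def)
    show ?thesis unfolding S
      by (rule P.K.HH.op_norm_le[OF _ P.hnorm_diag[OF _ wb]]) simp_all
  qed
  moreover have "normal_tuple (hpow H k) N" unfolding N_def by (rule P.diag_normal_tuple)
  ultimately show ?thesis using P.K.hilbert_space_axioms by blast
qed

section \<open>Defect operators, Halmos matrices and the bound \<open>d\<close>\<close>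

abbreviation "defect T \<equiv> defect_root H (op_comp H (op_adj H H T) T)"

lemma sa_contraction_defect:
  assumes T: "contraction H T"
  shows "sa_contraction H (op_comp H (op_adj H H T) T)"
proof
  note Tin = contraction_in[OF T]
  show "hnorm H (op_comp H (op_adj H H T) T x) \<le> hnorm H x" if "x \<in> carrier H" for x
    using contraction_bound[OF T that] contraction_bound[OF contraction_adj[OF T], of "T x"] Tin that by simp
  show "cinner H (op_comp H (op_adj H H T) T x) y = cinner H x (op_comp H (op_adj H H T) T y)"
    if "x \<in> carrier H" "y \<in> carrier H" for x y
    using that Tin by (simp add: adj_simps)
qed (use contraction_in[OF T] in simp)

lemma defect_intertwine:
  assumes T: "contraction H T" and x: "x \<in> carrier H"
  shows "T (defect T x) = defect (op_adj H H T) (T x)"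
  by (rule defect_root_intertwine[OF sa_contraction_defect[OF T]
        sa_contraction_defect[OF contraction_adj[OF T]] contraction_in[OF T] _ x])
    (use contraction_in[OF T] in \<open>simp add: op_adj_invol\<close>)

lemma defect_in: "contraction H T \<Longrightarrow> defect T \<in> bounded_ops H H"
  by (rule sa_contraction.defect_root_in[OF sa_contraction_defect])

lemma defect_sa:
  "contraction H T \<Longrightarrow> x \<in> carrier H \<Longrightarrow> y \<in> carrier H \<Longrightarrow> cinner H (defect T x) y = cinner H x (defect T y)"
  by (rule sa_contraction.defect_root_sa[OF sa_contraction_defect])

lemma defect_cinner:
  assumes T: "contraction H T" and x: "x \<in> carrier H" and y: "y \<in> carrier H"
  shows "cinner H (T x) (T y) + cinner H (defect T x) (defect T y) = cinner H x y"
  using sa_contraction.defect_root_cinner[OF sa_contraction_defect[OF T] x y] contraction_in[OF T] x y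
  by (simp add: HH.cinner_op_adj_left)

text \<open>The Halmos matrix has rows \<open>T, D'\<close> and \<open>D, - T^*\<close>, where
  \<open>D\<close> is the square root of \<open>1 - T^* T\<close> and \<open>D'\<close> that of
  \<open>1 - T T^*\<close>. The diagonal terms are \<open>defect_cinner\<close> for \<open>T\<close>
  and for its adjoint; the mixed terms cancel because \<open>T D = D' T\<close>.\<close>

lemma halmos_unitary:
  assumes T: "contraction H T" and v: "u \<in> carrier H" "v \<in> carrier H" "u' \<in> carrier H" "v' \<in> carrier H"
  shows "cinner H (T u \<oplus> defect (op_adj H H T) v) (T u' \<oplus> defect (op_adj H H T) v')
     + cinner H (defect T u \<ominus> op_adj H H T v) (defect T u' \<ominus> op_adj H H T v')
     = cinner H u u' + cinner H v v'"
proof -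
  note T' = contraction_adj[OF T]
  note Tin [simp] = contraction_in[OF T]
  have D [simp]: "defect T \<in> bounded_ops H H" "defect (op_adj H H T) \<in> bounded_ops H H"
    using defect_in[OF T] defect_in[OF T'] by blast+
  have c1: "cinner H (T u) (defect (op_adj H H T) v') = cinner H (defect T u) (op_adj H H T v')"
  proof -
    have "cinner H (T u) (defect (op_adj H H T) v') = cinner H (defect (op_adj H H T) (T u)) v'"
      using v by (intro defect_sa[OF T', symmetric]) simp_all
    also have "\<dots> = cinner H (T (defect T u)) v'" by (simp only: defect_intertwine[OF T v(1)])
    also have "\<dots> = cinner H (defect T u) (op_adj H H T v')"
      using v HH.bop_in_pair[OF D(1) v(1)] by (simp only: HH.cinner_op_adj[OF Tin])
    finally show ?thesis .
  qed
  have c2: "cinner H (defect (op_adj H H T) v) (T u') = cinner H (op_adj H H T v) (defect T u')"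
  proof -
    have "cinner H (defect (op_adj H H T) v) (T u') = cinner H v (defect (op_adj H H T) (T u'))"
      using v by (intro defect_sa[OF T']) simp_all
    also have "\<dots> = cinner H v (T (defect T u'))" by (simp only: defect_intertwine[OF T v(3)])
    also have "\<dots> = cinner H (op_adj H H T v) (defect T u')"
      using v HH.bop_in_pair[OF D(1) v(3)] by (simp only: HH.cinner_op_adj_left[OF Tin])
    finally show ?thesis .
  qed
  have in1: "T u \<in> carrier H" "T u' \<in> carrier H" "op_adj H H T v \<in> carrier H" "op_adj H H T v' \<in> carrier H"
    "defect T u \<in> carrier H" "defect T u' \<in> carrier H" "defect (op_adj H H T) v \<in> carrier H"
    "defect (op_adj H H T) v' \<in> carrier H"
    using v by simp_all
  \<comment> \<open>The eight terms are regrouped so that two groups are instances of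
    \<open>defect_cinner\<close> and the other two vanish by \<open>c1\<close> and
    \<open>c2\<close>.\<close>
  have ex: "cinner H (a \<oplus> b) (a' \<oplus> b') + cinner H (e \<ominus> f) (e' \<ominus> f')
      = (cinner H a a' + cinner H e e') + (cinner H f f' + cinner H b b')
        + (cinner H a b' - cinner H e f') + (cinner H b a' - cinner H f e')"
    if "a \<in> carrier H" "a' \<in> carrier H" "b \<in> carrier H" "b' \<in> carrier H"
      "e \<in> carrier H" "e' \<in> carrier H" "f \<in> carrier H" "f' \<in> carrier H" for a a' b b' e e' f f'
    using that by (simp add: ip_simps)
  show ?thesis
    unfolding ex[OF in1(1,2,7,8,5,6,3,4)] defect_cinner[OF T v(1,3)] defect_cinner[OF T' v(2,4)] c1 c2
    by simp
qed

end

context hilbert_power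
begin

abbreviation "adj \<equiv> op_adj H H"

text \<open>The scaled Halmos matrix occupies the coordinates \<open>2 j\<close> and
  \<open>2 j + 1\<close>. Zero elsewhere, rather than the identity, makes blocks with different
  \<open>j\<close> annihilate each other.\<close>

definition halmos :: "nat \<Rightarrow> real \<Rightarrow> ('a \<Rightarrow> 'a) \<Rightarrow> 'b \<Rightarrow> 'b" where
  "halmos j c T = (\<lambda>x\<in>carrier K. mk (\<lambda>s.
     if s = 2 * j then complex_of_real c \<odot>\<^bsub>H\<^esub> (T (p (2 * j) x) \<oplus>\<^bsub>H\<^esub> H.defect (adj T) (p (2 * j + 1) x))
     else if s = 2 * j + 1 then complex_of_real c \<odot>\<^bsub>H\<^esub> (H.defect T (p (2 * j) x) \<ominus>\<^bsub>H\<^esub> adj T (p (2 * j + 1) x))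
     else \<zero>\<^bsub>H\<^esub>))"

context
  fixes T and j :: nat and c :: real
  assumes T: "contraction H T" and j: "2 * j + 1 < k"
begin

lemma halmos_comp:
  assumes x: "x \<in> carrier K"
  shows "halmos j c T x \<in> carrier K"
    and "p (2 * j) (halmos j c T x) = complex_of_real c \<odot>\<^bsub>H\<^esub> (T (p (2 * j) x) \<oplus>\<^bsub>H\<^esub> H.defect (adj T) (p (2 * j + 1) x))"
    and "p (2 * j + 1) (halmos j c T x) = complex_of_real c \<odot>\<^bsub>H\<^esub> (H.defect T (p (2 * j) x) \<ominus>\<^bsub>H\<^esub> adj T (p (2 * j + 1) x))"
    and "s < k \<Longrightarrow> s \<noteq> 2 * j \<Longrightarrow> s \<noteq> 2 * j + 1 \<Longrightarrow> p s (halmos j c T x) = \<zero>\<^bsub>H\<^esub>"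
proof -
  have q: "p (2 * j) x \<in> carrier H" "p (2 * j + 1) x \<in> carrier H" using j by (intro p_in x; simp)+
  have "T (p (2 * j) x) \<in> carrier H" "H.defect (adj T) (p (2 * j + 1) x) \<in> carrier H"
    "H.defect T (p (2 * j) x) \<in> carrier H" "adj T (p (2 * j + 1) x) \<in> carrier H"
    using q H.HH.bop_in_pair[OF H.contraction_in[OF T]] H.HH.bop_in_pair[OF H.defect_in[OF T]]
      H.HH.bop_in_pair[OF H.defect_in[OF H.contraction_adj[OF T]]] H.HH.op_adj_app_in[OF H.contraction_in[OF T]]
    by blast+
  then have c: "(if s = 2 * j then complex_of_real c \<odot>\<^bsub>H\<^esub> (T (p (2 * j) x) \<oplus>\<^bsub>H\<^esub> H.defect (adj T) (p (2 * j + 1) x))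
     else if s = 2 * j + 1 then complex_of_real c \<odot>\<^bsub>H\<^esub> (H.defect T (p (2 * j) x) \<ominus>\<^bsub>H\<^esub> adj T (p (2 * j + 1) x))
     else \<zero>\<^bsub>H\<^esub>) \<in> carrier H" for s
    by simp
  show "halmos j c T x \<in> carrier K" unfolding halmos_def using x mk_in[OF c] by simp
  have p: "p s (halmos j c T x) = (if s = 2 * j then complex_of_real c \<odot>\<^bsub>H\<^esub> (T (p (2 * j) x) \<oplus>\<^bsub>H\<^esub> H.defect (adj T) (p (2 * j + 1) x))
     else if s = 2 * j + 1 then complex_of_real c \<odot>\<^bsub>H\<^esub> (H.defect T (p (2 * j) x) \<ominus>\<^bsub>H\<^esub> adj T (p (2 * j + 1) x))
     else \<zero>\<^bsub>H\<^esub>)" if "s < k" for s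
    unfolding halmos_def using x p_mk[OF c that] by simp
  show "p (2 * j) (halmos j c T x) = complex_of_real c \<odot>\<^bsub>H\<^esub> (T (p (2 * j) x) \<oplus>\<^bsub>H\<^esub> H.defect (adj T) (p (2 * j + 1) x))"
    and "p (2 * j + 1) (halmos j c T x) = complex_of_real c \<odot>\<^bsub>H\<^esub> (H.defect T (p (2 * j) x) \<ominus>\<^bsub>H\<^esub> adj T (p (2 * j + 1) x))"
    and "s < k \<Longrightarrow> s \<noteq> 2 * j \<Longrightarrow> s \<noteq> 2 * j + 1 \<Longrightarrow> p s (halmos j c T x) = \<zero>\<^bsub>H\<^esub>"
    using j by (simp_all add: p)
qed

lemma cinner_halmos:
  assumes x: "x \<in> carrier K" and y: "y \<in> carrier K"
  shows "cinner K (halmos j c T x) y =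
     cinner H (p (2 * j) (halmos j c T x)) (p (2 * j) y) + cinner H (p (2 * j + 1) (halmos j c T x)) (p (2 * j + 1) y)"
proof -
  have "cinner K (halmos j c T x) y = (\<Sum>s\<in>{2 * j, 2 * j + 1}. cinner H (p s (halmos j c T x)) (p s y))"
    unfolding cinner_K[OF halmos_comp(1)[OF x] y]
  proof (rule sum.mono_neutral_right)
    show "\<forall>s\<in>{..<k} - {2 * j, 2 * j + 1}. cinner H (p s (halmos j c T x)) (p s y) = 0"
      using halmos_comp(4)[OF x] y by (auto simp: p_in H.cinner_zero_left)
  qed (use j in auto)
  then show ?thesis by simp
qed

text \<open>Unitarity of the block removes \<open>T\<close> from the right-hand side. Since the
  adjoint is the same construction for the adjoint of \<open>T\<close>, both have the same form, and
  normality follows.\<close>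

lemma cinner_halmos_halmos:
  assumes x: "x \<in> carrier K" and y: "y \<in> carrier K"
  shows "cinner K (halmos j c T x) (halmos j c T y) = complex_of_real (c\<^sup>2) *
     (cinner H (p (2 * j) x) (p (2 * j) y) + cinner H (p (2 * j + 1) x) (p (2 * j + 1) y))"
proof -
  have q: "p (2 * j) x \<in> carrier H" "p (2 * j + 1) x \<in> carrier H" "p (2 * j) y \<in> carrier H" "p (2 * j + 1) y \<in> carrier H"
    using j by (intro p_in x y; simp)+
  have i: "T u \<in> carrier H" "H.defect (adj T) u \<in> carrier H"
    "H.defect T u \<in> carrier H" "adj T u \<in> carrier H" if "u \<in> carrier H" for u
    using that H.HH.bop_in_pair[OF H.contraction_in[OF T]] H.HH.bop_in_pair[OF H.defect_in[OF T]]
      H.HH.bop_in_pair[OF H.defect_in[OF H.contraction_adj[OF T]]] H.HH.op_adj_app_in[OF H.contraction_in[OF T]]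
    by blast+
  have sm: "cinner H (complex_of_real c \<odot>\<^bsub>H\<^esub> a) (complex_of_real c \<odot>\<^bsub>H\<^esub> b) = complex_of_real (c\<^sup>2) * cinner H a b"
    if "a \<in> carrier H" "b \<in> carrier H" for a b
    using that by (simp add: H.ip_simps power2_eq_square)
  have "cinner K (halmos j c T x) (halmos j c T y) = complex_of_real (c\<^sup>2) *
    (cinner H (T (p (2 * j) x) \<oplus>\<^bsub>H\<^esub> H.defect (adj T) (p (2 * j + 1) x)) (T (p (2 * j) y) \<oplus>\<^bsub>H\<^esub> H.defect (adj T) (p (2 * j + 1) y))
     + cinner H (H.defect T (p (2 * j) x) \<ominus>\<^bsub>H\<^esub> adj T (p (2 * j + 1) x)) (H.defect T (p (2 * j) y) \<ominus>\<^bsub>H\<^esub> adj T (p (2 * j + 1) y)))"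
    unfolding cinner_halmos[OF x halmos_comp(1)[OF y]] halmos_comp(2,3)[OF x] halmos_comp(2,3)[OF y]
    using i[OF q(1)] i[OF q(2)] i[OF q(3)] i[OF q(4)]
    by (simp only: sm distrib_left H.M.a_closed H.minus_in)
  then show ?thesis by (simp only: H.halmos_unitary[OF T q])
qed

lemma hnorm_halmos:
  assumes c: "0 \<le> c" and x: "x \<in> carrier K"
  shows "hnorm K (halmos j c T x) \<le> c * hnorm K x"
proof (rule power2_le_imp_le)
  have q: "p (2 * j) x \<in> carrier H" "p (2 * j + 1) x \<in> carrier H" using j by (intro p_in x; simp)+
  have "(hnorm K (halmos j c T x))\<^sup>2 = c\<^sup>2 * (\<Sum>s\<in>{2 * j, 2 * j + 1}. (hnorm H (p s x))\<^sup>2)"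
    unfolding K.hnorm_sq[OF halmos_comp(1)[OF x]] cinner_halmos_halmos[OF x x]
    using q by (simp add: H.cinner_self flip: of_real_add of_real_mult of_real_power)
  also have "\<dots> \<le> c\<^sup>2 * (hnorm K x)\<^sup>2"
    unfolding hnorm_K_sq[OF x] using j by (intro mult_left_mono sum_mono2) auto
  finally show "(hnorm K (halmos j c T x))\<^sup>2 \<le> (c * hnorm K x)\<^sup>2" by (simp add: power_mult_distrib)
qed (use c x in simp)

end

text \<open>Taking adjoints exchanges the positions of the two defect operators, which are
  self-adjoint, and turns \<open>- T^*\<close> into \<open>- T\<close>: the result is the Halmos
  matrix of the adjoint of \<open>T\<close>.\<close>

lemma halmos_in_adj:
  assumes T: "contraction H T" and j: "2 * j + 1 < k" and c: "0 \<le> c"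
  shows "halmos j c T \<in> bounded_ops K K" "op_adj K K (halmos j c T) = halmos j c (adj T)"
proof -
  note T' = H.contraction_adj[OF T]
  have inv: "adj (adj T) = T" by (rule H.op_adj_invol[OF H.contraction_in[OF T]])
  have adj: "cinner K (halmos j c T x) y = cinner K x (halmos j c (adj T) y)"
    if x: "x \<in> carrier K" and y: "y \<in> carrier K" for x y
  proof -
    have q: "p (2 * j) x \<in> carrier H" "p (2 * j + 1) x \<in> carrier H" "p (2 * j) y \<in> carrier H" "p (2 * j + 1) y \<in> carrier H"
      using j by (intro p_in x y; simp)+
    have i: "T u \<in> carrier H" "H.defect (adj T) u \<in> carrier H"
      "H.defect T u \<in> carrier H" "adj T u \<in> carrier H" if "u \<in> carrier H" for u
      using that H.HH.bop_in_pair[OF H.contraction_in[OF T]] H.HH.bop_in_pair[OF H.defect_in[OF T]]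
        H.HH.bop_in_pair[OF H.defect_in[OF H.contraction_adj[OF T]]] H.HH.op_adj_app_in[OF H.contraction_in[OF T]]
      by blast+
    have "cinner K x (halmos j c (adj T) y) = cnj (cinner K (halmos j c (adj T) y) x)"
      by (rule K.cinner_commute[OF halmos_comp(1)[OF T' j y] x])
    also have "\<dots> = cinner H (p (2 * j) x) (p (2 * j) (halmos j c (adj T) y))
        + cinner H (p (2 * j + 1) x) (p (2 * j + 1) (halmos j c (adj T) y))"
      unfolding cinner_halmos[OF T' j y x] complex_cnj_add
      using q p_in[OF _ halmos_comp(1)[OF T' j y]] j
      by (simp only: H.cinner_commute[of "p (2 * j) (halmos j c (adj T) y)" "p (2 * j) x"]
          H.cinner_commute[of "p (2 * j + 1) (halmos j c (adj T) y)" "p (2 * j + 1) x"])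
    also have "\<dots> = complex_of_real c * (cinner H (p (2 * j) x) (adj T (p (2 * j) y)) + cinner H (p (2 * j) x) (H.defect T (p (2 * j + 1) y))
        + cinner H (p (2 * j + 1) x) (H.defect (adj T) (p (2 * j) y)) - cinner H (p (2 * j + 1) x) (T (p (2 * j + 1) y)))"
      unfolding halmos_comp(2,3)[OF T' j y] inv
      using q i[OF q(3), unfolded inv] i[OF q(4), unfolded inv] by (simp add: H.ip_simps algebra_simps)
    also have "cinner H (p (2 * j) x) (adj T (p (2 * j) y)) = cinner H (T (p (2 * j) x)) (p (2 * j) y)"
      by (rule H.HH.cinner_op_adj[OF H.contraction_in[OF T] q(1,3)])
    also have "cinner H (p (2 * j + 1) x) (T (p (2 * j + 1) y)) = cinner H (adj T (p (2 * j + 1) x)) (p (2 * j + 1) y)"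
      by (rule H.HH.cinner_op_adj_left[OF H.contraction_in[OF T] q(4,2), symmetric])
    also have "cinner H (p (2 * j) x) (H.defect T (p (2 * j + 1) y)) = cinner H (H.defect T (p (2 * j) x)) (p (2 * j + 1) y)"
      by (rule H.defect_sa[OF T q(1,4), symmetric])
    also have "cinner H (p (2 * j + 1) x) (H.defect (adj T) (p (2 * j) y)) = cinner H (H.defect (adj T) (p (2 * j + 1) x)) (p (2 * j) y)"
      by (rule H.defect_sa[OF T' q(2,3), symmetric])
    finally show ?thesis
      unfolding cinner_halmos[OF T j x y] halmos_comp(2,3)[OF T j x]
      using q i[OF q(1)] i[OF q(2)] by (simp add: H.ip_simps algebra_simps)
  qed
  \<comment> \<open>\<open>T\<close> is bound afresh so that this step serves the operator and then
    its adjoint.\<close>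
  have in_B: "halmos j c T \<in> bounded_ops K K" if T: "contraction H T"
    and adj: "\<And>x y. x \<in> carrier K \<Longrightarrow> y \<in> carrier K \<Longrightarrow> cinner K (halmos j c T x) y = cinner K x (halmos j c (adj T) y)" for T
  proof -
    have "(\<lambda>x\<in>carrier K. halmos j c T x) \<in> bounded_ops K K"
      by (rule K.HH.bop_adjointI[OF _ _ adj hnorm_halmos[OF T j c]])
        (auto intro: halmos_comp(1)[OF T j] halmos_comp(1)[OF H.contraction_adj[OF T] j])
    then show ?thesis by (simp add: halmos_def restrict_def cong: if_cong)
  qed
  show B: "halmos j c T \<in> bounded_ops K K" by (rule in_B[OF T adj])
  have "cinner K (halmos j c (adj T) x) y = cinner K x (halmos j c (adj (adj T)) y)"
    if x: "x \<in> carrier K" and y: "y \<in> carrier K" for x y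
  proof -
    have "cinner K (halmos j c (adj T) x) y = cnj (cinner K y (halmos j c (adj T) x))"
      by (rule K.cinner_commute[OF y halmos_comp(1)[OF T' j x]])
    also have "\<dots> = cnj (cinner K (halmos j c T y) x)" by (simp only: adj[OF y x])
    also have "\<dots> = cinner K x (halmos j c T y)"
      by (rule K.cinner_commute[OF halmos_comp(1)[OF T j y] x, symmetric])
    finally show ?thesis by (simp only: inv)
  qed
  then have B': "halmos j c (adj T) \<in> bounded_ops K K" by (rule in_B[OF T'])
  show "op_adj K K (halmos j c T) = halmos j c (adj T)"
    by (rule K.HH.op_adj_eqI[OF B' adj])
qed

lemma halmos_normal:
  assumes T: "contraction H T" and j: "2 * j + 1 < k" and c: "0 \<le> c"
  shows "normal_op K (halmos j c T)"
  by (rule K.normal_opI[OF halmos_in_adj(1)[OF T j c]])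
    (simp only: halmos_in_adj(2)[OF T j c] cinner_halmos_halmos[OF T j]
      cinner_halmos_halmos[OF H.contraction_adj[OF T] j])

lemma halmos_zero:
  assumes T: "contraction H T" and j: "2 * j + 1 < k" and x: "x \<in> carrier K"
    and z: "p (2 * j) x = \<zero>\<^bsub>H\<^esub>" "p (2 * j + 1) x = \<zero>\<^bsub>H\<^esub>"
  shows "halmos j c T x = \<zero>\<^bsub>K\<^esub>"
proof (rule p_inj[OF halmos_comp(1)[OF T j x] K.M.zero_closed])
  fix s assume s: "s < k"
  have "adj T \<zero>\<^bsub>H\<^esub> = \<zero>\<^bsub>H\<^esub>" "T \<zero>\<^bsub>H\<^esub> = \<zero>\<^bsub>H\<^esub>" "H.defect T \<zero>\<^bsub>H\<^esub> = \<zero>\<^bsub>H\<^esub>" "H.defect (adj T) \<zero>\<^bsub>H\<^esub> = \<zero>\<^bsub>H\<^esub>"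
    using H.contraction_in[OF T] H.contraction_in[OF H.contraction_adj[OF T]] H.defect_in[OF T]
      H.defect_in[OF H.contraction_adj[OF T]] by (intro H.HH.bop_zero; simp)+
  then show "p s (halmos j c T x) = p s \<zero>\<^bsub>K\<^esub>"
    using halmos_comp(2,3)[OF T j x, of c] halmos_comp(4)[OF T j x s, of c] s
    by (cases "s = 2 * j"; cases "s = 2 * j + 1") (simp_all add: z[simplified] p_zero H.smult_zero_vec H.diff_zero_carrier)
qed

text \<open>Different blocks live on disjoint coordinates, so both orders of multiplication give
  zero.\<close>

lemma halmos_commute:
  assumes "contraction H S" "contraction H T" "2 * i + 1 < k" "2 * j + 1 < k" "i \<noteq> j" "x \<in> carrier K"
  shows "halmos i c S (halmos j c T x) = \<zero>\<^bsub>K\<^esub>"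
proof (rule halmos_zero)
  have "2 * i \<noteq> 2 * j + 1" "2 * i + 1 \<noteq> 2 * j" by presburger+
  then show "p (2 * i) (halmos j c T x) = \<zero>\<^bsub>H\<^esub>" "p (2 * i + 1) (halmos j c T x) = \<zero>\<^bsub>H\<^esub>"
    using assms by (simp_all add: halmos_comp(4))
qed (use assms halmos_comp(1) in auto)

end

lemma (in hilbert_space) ex_dilation_d:
  assumes d: "d \<ge> 1" and len: "length T = d" and T: "\<And>S. S \<in> set T \<Longrightarrow> contraction H S"
  shows "\<exists>(K :: (nat \<Rightarrow> 'a) cinner_space) N. hilbert_space K \<and> normal_tuple K N \<and> dilation H K T N \<and>
           (\<forall>S\<in>set N. op_norm K K S \<le> real d)"
proof -
  have Tc: "contraction H (T ! j)" if "j < d" for j using T len that by simp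
  let ?K = "hpow H (2 * d)"
  interpret P: hilbert_power H ?K "2 * d" "\<lambda>s f. f s" by (rule hpow_power)
  have jk: "2 * j + 1 < 2 * d" if "j < d" for j using that by simp
  define N where "N = map (\<lambda>j. P.halmos j (real d) (T ! j)) [0..<d]"
  have NE: "\<exists>j<d. S = P.halmos j (real d) (T ! j)" if "S \<in> set N" for S
    using that by (auto simp: N_def)
  have "op_norm ?K ?K S \<le> real d" if "S \<in> set N" for S
  proof -
    obtain j where j: "j < d" "S = P.halmos j (real d) (T ! j)" using NE \<open>S \<in> set N\<close> by blast
    show ?thesis unfolding j(2)
      by (rule P.K.HH.op_norm_le[OF _ P.hnorm_halmos[OF Tc[OF j(1)] jk[OF j(1)]]]) simp_all
  qed
  moreover have "normal_tuple ?K N"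
    unfolding normal_tuple_def
  proof (intro conjI ballI)
    fix S assume "S \<in> set N"
    then obtain j where j: "j < d" "S = P.halmos j (real d) (T ! j)" using NE by blast
    show "normal_op ?K S" unfolding j(2) by (rule P.halmos_normal[OF Tc[OF j(1)] jk[OF j(1)]]) simp
  next
    fix S R assume "S \<in> set N" "R \<in> set N"
    then obtain i j where i: "i < d" "S = P.halmos i (real d) (T ! i)"
      and j: "j < d" "R = P.halmos j (real d) (T ! j)" using NE by blast
    show "op_comp ?K S R = op_comp ?K R S"
    proof (cases "i = j")
      case False
      have B: "S \<in> bounded_ops ?K ?K" "R \<in> bounded_ops ?K ?K"
        unfolding i(2) j(2) by (rule P.halmos_in_adj(1)[OF Tc jk]; simp add: i j)+
      show ?thesis
      proof (rule bop_eqI[OF P.K.op_comp_in[OF B] P.K.op_comp_in[OF B(2,1)]])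
        fix x assume x: "x \<in> carrier ?K"
        have "S (R x) = \<zero>\<^bsub>?K\<^esub>" unfolding i(2) j(2)
          using False by (intro P.halmos_commute[OF Tc[OF i(1)] Tc[OF j(1)] jk[OF i(1)] jk[OF j(1)] _ x])
        moreover have "R (S x) = \<zero>\<^bsub>?K\<^esub>" unfolding i(2) j(2)
          using False by (intro P.halmos_commute[OF Tc[OF j(1)] Tc[OF i(1)] jk[OF j(1)] jk[OF i(1)] _ x]) simp
        ultimately show "op_comp ?K S R x = op_comp ?K R S x" using x by simp
      qed
    qed (simp add: i j)
  qed
  moreover have "dilation H ?K T N"
  proof -
    define r where "r = complex_of_real (1 / sqrt (real d))"
    have "r * r = complex_of_real (1 / real d)"
      unfolding r_def of_real_mult[symmetric] using d by simp
    then have r: "cnj r = r" "r * r = 1 / of_nat d" by (simp_all add: r_def)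
    \<comment> \<open>Even coordinates are the first components of the Halmos pairs, where the
      compression of the block is \<open>T\<close>. With weight \<open>r^2 = 1 / d\<close> on each
      of the \<open>d\<close> pairs the embedding is isometric, and the factor \<open>d\<close> in
      the block offsets this weight.\<close>
    define V where "V s = op_scale H (if even s then r else 0) (op_id H)" for s :: nat
    have Vin: "V s \<in> bounded_ops H H" for s by (simp add: V_def)
    have Vapp: "V s x = (if even s then r else 0) \<odot> x" if "x \<in> carrier H" for s x
      using that by (simp add: V_def)
    have one: "(\<Sum>s<2*d. cinner H (V s x) (V s y)) = cinner H x y" if x: "x \<in> carrier H" and y: "y \<in> carrier H" for x y
    proof -
      \<comment> \<open>Generalising \<open>d\<close> to \<open>e\<close> lets the induction add one
        pair of coordinates at a time, with weights \<open>r^2\<close> and 0.\<close>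
      have "(\<Sum>s<2*e. cinner H (V s x) (V s y)) = of_nat e * (r * r * cinner H x y)" for e
        using x y by (induction e) (simp_all add: Vapp ip_simps r(1) algebra_simps)
      then show ?thesis using d by (simp add: r)
    qed
    have Vz: "V (2 * j + 1) x = \<zero>" if "x \<in> carrier H" for j x
      using that by (intro inner_ext) (simp_all add: Vapp ip_simps)
    show ?thesis
    proof (rule P.HK.dilationI[where V = "P.emb V"])
      show "isometry H ?K (P.emb V)" by (rule P.emb_isometry[OF Vin one])
      show "T ! i \<in> bounded_ops H H" if "i < length T" for i
        using contraction_in[OF Tc] that len by simp
      show "N ! i \<in> bounded_ops ?K ?K" if "i < length T" for i
        using P.halmos_in_adj(1)[OF Tc jk] that len by (simp add: N_def)
      fix i x y assume "i < length T" and x: "x \<in> carrier H" and y: "y \<in> carrier H"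
      then have i: "i < d" using len by simp
      note Ti = contraction_in[OF Tc[OF i]]
      have E: "P.emb V x \<in> carrier ?K" "P.emb V y \<in> carrier ?K" by (rule P.emb_in[OF Vin x], rule P.emb_in[OF Vin y])
      have pE: "P.emb V z s = V s z" if "z \<in> carrier H" "s < 2 * d" for s z using P.p_emb[OF Vin that] .
      have D0: "defect (op_adj H H (T ! i)) \<zero> = \<zero>"
        by (rule HH.bop_zero[OF defect_in[OF contraction_adj[OF Tc[OF i]]]])
      have i0: "2 * i < 2 * d" using i by simp
      have e0: "P.emb V z (2 * i) = r \<odot> z" if "z \<in> carrier H" for z
        using pE[OF that i0] Vapp[OF that] by simp
      have e1: "P.emb V z (2 * i + 1) = \<zero>" if "z \<in> carrier H" for z
        using pE[OF that jk[OF i]] Vz[OF that] by simp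
      have Trx: "(T ! i) (r \<odot> x) \<in> carrier H" using Ti x by simp
      have h0: "P.halmos i (real d) (T ! i) (P.emb V x) (2 * i) = complex_of_real (real d) \<odot> (T ! i) (r \<odot> x)"
        unfolding P.halmos_comp(2)[OF Tc[OF i] jk[OF i] E(1)] e0[OF x] e1[OF x] D0 r_zero[OF Trx] ..
      have h1: "P.halmos i (real d) (T ! i) (P.emb V x) (2 * i + 1) \<in> carrier H"
        by (rule P.p_in[OF jk[OF i] P.halmos_comp(1)[OF Tc[OF i] jk[OF i] E(1)]])
      have "cinner ?K (P.halmos i (real d) (T ! i) (P.emb V x)) (P.emb V y)
          = cinner H (complex_of_real (real d) \<odot> (T ! i) (r \<odot> x)) (r \<odot> y)"
        unfolding P.cinner_halmos[OF Tc[OF i] jk[OF i] E] h0 e0[OF y] e1[OF y] cinner_zero_right[OF h1]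
        by simp
      also have "\<dots> = of_nat d * (r * r) * cinner H ((T ! i) x) y"
        using Ti x y by (simp add: bop_smult ip_simps r(1))
      also have "\<dots> = cinner H ((T ! i) x) y" using d by (simp add: r(2))
      finally show "cinner ?K ((N ! i) (P.emb V x)) (P.emb V y) = cinner H ((T ! i) x) y"
        using i by (simp add: N_def)
    qed (simp add: N_def len)
  qed
  ultimately show ?thesis using P.K.hilbert_space_axioms by blast
qed

text \<open>The two bounds agree at \<open>d = 4\<close>; up to there the Halmos construction is at
  least as good, beyond it the sign construction is better.\<close>

theorem (in hilbert_space) ex_normal_dilation:
  assumes "d \<ge> 1" "length T = d" "\<And>S. S \<in> set T \<Longrightarrow> contraction H S"
  shows "\<exists>(K :: (nat \<Rightarrow> 'a) cinner_space) N. hilbert_space K \<and> normal_tuple K N \<and> dilation H K T N \<and>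
           (\<forall>S\<in>set N. op_norm K K S \<le> min (real d) (2 * sqrt (real d)))"
proof (cases "real d \<le> 2 * sqrt (real d)")
  case True
  then show ?thesis using ex_dilation_d[OF assms] by (simp add: min_absorb1)
next
  case False
  then show ?thesis using ex_dilation_2_sqrt[OF assms] by (simp add: min_absorb2)
qed

section \<open>Joint approximate eigenvectors\<close>

text \<open>If the squared ratio of successive terms grew by at least \<open>e\<close> at each of
  \<open>K\<close> consecutive steps, it would exceed \<open>M^2\<close>, although every ratio is at
  most \<open>M\<close>.\<close>

lemma geometric_ratio_step:
  fixes u :: "nat \<Rightarrow> real"
  assumes pos: "\<And>n. 0 < u n" and up: "\<And>n. u n \<le> u (Suc n)" and M: "\<And>n. u (Suc n) \<le> M * u n"
    and lc: "\<And>n. (u (Suc n))\<^sup>2 \<le> u n * u (Suc (Suc n))" and e: "0 < e" and K: "M\<^sup>2 < real K * e"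
  shows "\<exists>n<K. (u (Suc (Suc n)) / u (Suc n))\<^sup>2 - (u (Suc n) / u n)\<^sup>2 < e"
proof (rule ccontr)
  assume a: "\<not> ?thesis"
  define r where "r n = u (Suc n) / u n" for n
  have ge: "e \<le> (r (Suc n))\<^sup>2 - (r n)\<^sup>2" if "n < K" for n
    using a that unfolding r_def by (meson not_less)
  have "real n * e \<le> (r n)\<^sup>2 - (r 0)\<^sup>2" if "n \<le> K" for n
    using that
  proof (induction n)
    case (Suc n)
    then show ?case using ge[of n] by (simp add: algebra_simps)
  qed simp
  from this[of K] have "real K * e \<le> (r K)\<^sup>2" using zero_le_power2[of "r 0"] by linarith
  also have "(r K)\<^sup>2 \<le> M\<^sup>2"
    using M[of K] pos[of K] pos[of "Suc K"] by (intro power_mono) (simp_all add: r_def field_simps less_imp_le)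
  finally show False using K by simp
qed

context hilbert_space
begin

text \<open>One unit vector must serve all pairs at once. A set of pairs, rather than a tuple,
  allows auxiliary operators to be inserted and later discarded by
  \<open>approx_eigen_mono\<close>.\<close>

definition approx_eigen :: "(('a \<Rightarrow> 'a) \<times> complex) set \<Rightarrow> bool" where
  "approx_eigen S \<longleftrightarrow>
     (\<forall>e>0. \<exists>x\<in>carrier H. hnorm H x = 1 \<and> (\<forall>A \<mu>. (A, \<mu>) \<in> S \<longrightarrow> hnorm H (A x \<ominus> \<mu> \<odot> x) < e))"

lemma approx_eigenD:
  assumes "approx_eigen S" "0 < e"
  obtains x where "x \<in> carrier H" "hnorm H x = 1"
    "\<And>A \<mu>. (A, \<mu>) \<in> S \<Longrightarrow> hnorm H (A x \<ominus> \<mu> \<odot> x) < e"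
proof -
  have "\<exists>x\<in>carrier H. hnorm H x = 1 \<and> (\<forall>A \<mu>. (A, \<mu>) \<in> S \<longrightarrow> hnorm H (A x \<ominus> \<mu> \<odot> x) < e)"
    using assms unfolding approx_eigen_def by simp
  then show thesis using that by (elim bexE conjE) simp
qed

lemma approx_eigenI:
  assumes "\<And>e. 0 < e \<Longrightarrow> \<exists>x\<in>carrier H. hnorm H x = 1 \<and>
    (\<forall>A \<mu>. (A, \<mu>) \<in> S \<longrightarrow> hnorm H (A x \<ominus> \<mu> \<odot> x) < e)"
  shows "approx_eigen S"
  using assms unfolding approx_eigen_def by simp

lemma approx_eigen_mono: "approx_eigen S \<Longrightarrow> S' \<subseteq> S \<Longrightarrow> approx_eigen S'"
  unfolding approx_eigen_def by (meson subsetD)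

lemma approx_eigen_lin:
  assumes S: "approx_eigen S" and A: "(A, \<alpha>) \<in> S" "A \<in> bounded_ops H H"
    and B: "(B, \<beta>) \<in> S" "B \<in> bounded_ops H H"
    and C: "\<And>x. x \<in> carrier H \<Longrightarrow> C x = (a \<odot> A x) \<oplus> (b \<odot> B x)"
  shows "approx_eigen (insert (C, a * \<alpha> + b * \<beta>) S)"
proof (rule approx_eigenI)
  fix e :: real assume e: "0 < e"
  \<comment> \<open>The summand 1 keeps the denominator positive, makes the final estimate strict,
    and gives \<open>d \<le> e\<close> for the pairs already in \<open>S\<close>.\<close>
  define d where "d = e / (cmod a + cmod b + 1)"
  have q: "0 < cmod a + cmod b + 1" by (simp add: add_nonneg_pos)
  have d: "0 < d" using e q by (simp add: d_def)
  have de: "(cmod a + cmod b + 1) * d = e" using q by (simp add: d_def)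
  have "d \<le> e" unfolding de[symmetric] using d by (simp add: algebra_simps add_nonneg_pos)
  obtain x where x: "x \<in> carrier H" "hnorm H x = 1"
    and S: "\<And>A \<mu>. (A, \<mu>) \<in> S \<Longrightarrow> hnorm H (A x \<ominus> \<mu> \<odot> x) < d"
    using approx_eigenD[OF S d] by blast
  have Ax: "A x \<in> carrier H" "B x \<in> carrier H" using A B x by simp_all
  have "C x \<ominus> (a * \<alpha> + b * \<beta>) \<odot> x = (a \<odot> (A x \<ominus> \<alpha> \<odot> x)) \<oplus> (b \<odot> (B x \<ominus> \<beta> \<odot> x))"
    using x Ax by (intro inner_ext) (simp_all add: C ip_simps algebra_simps)
  then have "hnorm H (C x \<ominus> (a * \<alpha> + b * \<beta>) \<odot> x)
      \<le> cmod a * hnorm H (A x \<ominus> \<alpha> \<odot> x) + cmod b * hnorm H (B x \<ominus> \<beta> \<odot> x)"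
    using hnorm_triangle[of "a \<odot> (A x \<ominus> \<alpha> \<odot> x)" "b \<odot> (B x \<ominus> \<beta> \<odot> x)"] x Ax
    by (simp add: hnorm_smult)
  also have "\<dots> \<le> cmod a * d + cmod b * d"
    using S[OF A(1)] S[OF B(1)] by (intro add_mono mult_left_mono) auto
  also have "\<dots> < e" unfolding de[symmetric] using d by (simp add: algebra_simps)
  finally have "hnorm H (C x \<ominus> (a * \<alpha> + b * \<beta>) \<odot> x) < e" .
  then show "\<exists>x\<in>carrier H. hnorm H x = 1 \<and>
      (\<forall>A' \<mu>. (A', \<mu>) \<in> insert (C, a * \<alpha> + b * \<beta>) S \<longrightarrow> hnorm H (A' x \<ominus> \<mu> \<odot> x) < e)"
    using x S \<open>d \<le> e\<close> by (intro bexI[of _ x]) fastforce+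
qed

text \<open>The approximate eigenvalue \<open>r\<close> may depend on \<open>e\<close>. As it stays
  in a bounded interval, it converges along a subsequence, and the limit serves every
  \<open>e\<close>.\<close>

lemma approx_eigen_compact:
  assumes A: "A \<in> bounded_ops H H"
    and ex: "\<And>e. 0 < e \<Longrightarrow> \<exists>x\<in>carrier H. \<exists>r::real. hnorm H x = 1 \<and> \<bar>r\<bar> \<le> M \<and>
      hnorm H (A x \<ominus> complex_of_real r \<odot> x) < e \<and>
      (\<forall>B \<mu>. (B, \<mu>) \<in> S \<longrightarrow> hnorm H (B x \<ominus> \<mu> \<odot> x) < e)"
  shows "\<exists>r::real. approx_eigen (insert (A, complex_of_real r) S)"
proof -
  have "\<forall>n. \<exists>xr. fst xr \<in> carrier H \<and> hnorm H (fst xr) = 1 \<and> \<bar>snd xr\<bar> \<le> M \<and>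
      hnorm H (A (fst xr) \<ominus> complex_of_real (snd xr) \<odot> fst xr) < inverse (real (Suc n)) \<and>
      (\<forall>B \<mu>. (B, \<mu>) \<in> S \<longrightarrow> hnorm H (B (fst xr) \<ominus> \<mu> \<odot> fst xr) < inverse (real (Suc n)))"
  proof
    fix n
    have "0 < inverse (real (Suc n))" by simp
    from ex[OF this] obtain x and r :: real where "x \<in> carrier H" "hnorm H x = 1 \<and> \<bar>r\<bar> \<le> M \<and>
      hnorm H (A x \<ominus> complex_of_real r \<odot> x) < inverse (real (Suc n)) \<and>
      (\<forall>B \<mu>. (B, \<mu>) \<in> S \<longrightarrow> hnorm H (B x \<ominus> \<mu> \<odot> x) < inverse (real (Suc n)))" by blast
    then show "\<exists>xr. fst xr \<in> carrier H \<and> hnorm H (fst xr) = 1 \<and> \<bar>snd xr\<bar> \<le> M \<and>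
      hnorm H (A (fst xr) \<ominus> complex_of_real (snd xr) \<odot> fst xr) < inverse (real (Suc n)) \<and>
      (\<forall>B \<mu>. (B, \<mu>) \<in> S \<longrightarrow> hnorm H (B (fst xr) \<ominus> \<mu> \<odot> fst xr) < inverse (real (Suc n)))"
      by (intro exI[of _ "(x, r)"]) (simp only: fst_conv snd_conv, blast)
  qed
  from choice[OF this] obtain xr where xr: "\<forall>n. fst (xr n) \<in> carrier H \<and> hnorm H (fst (xr n)) = 1 \<and> \<bar>snd (xr n)\<bar> \<le> M \<and>
      hnorm H (A (fst (xr n)) \<ominus> complex_of_real (snd (xr n)) \<odot> fst (xr n)) < inverse (real (Suc n)) \<and>
      (\<forall>B \<mu>. (B, \<mu>) \<in> S \<longrightarrow> hnorm H (B (fst (xr n)) \<ominus> \<mu> \<odot> fst (xr n)) < inverse (real (Suc n)))" ..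
  define x where "x n = fst (xr n)" for n
  define r where "r n = snd (xr n)" for n
  have x: "x n \<in> carrier H" "hnorm H (x n) = 1" "\<bar>r n\<bar> \<le> M"
    and Ax: "hnorm H (A (x n) \<ominus> complex_of_real (r n) \<odot> x n) < inverse (real (Suc n))"
    and Sx: "\<And>B \<mu>. (B, \<mu>) \<in> S \<Longrightarrow> hnorm H (B (x n) \<ominus> \<mu> \<odot> x n) < inverse (real (Suc n))" for n
    using xr[rule_format, of n] unfolding x_def r_def by blast+
  obtain g :: "nat \<Rightarrow> nat" where g: "strict_mono g" "monoseq (\<lambda>n. r (g n))"
    using seq_monosub[of r] by blast
  have "convergent (\<lambda>n. r (g n))"
    using g(2) x(3) by (intro Bseq_monoseq_convergent BseqI'[of _ M]) simp_all
  then obtain l where l: "(\<lambda>n. r (g n)) \<longlonglongrightarrow> l" by (auto simp: convergent_def)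
  have "approx_eigen (insert (A, complex_of_real l) S)"
  proof (rule approx_eigenI)
    fix e :: real assume e: "0 < e"
    then have "\<forall>\<^sub>F n in sequentially. dist (r (g n)) l < e / 2"
      using tendstoD[OF l, of "e / 2"] by simp
    moreover have "\<forall>\<^sub>F n in sequentially. inverse (real (Suc n)) < e / 2"
      using order_tendstoD(2)[OF LIMSEQ_inverse_real_of_nat, of "e / 2"] e by simp
    ultimately have "\<forall>\<^sub>F n in sequentially. dist (r (g n)) l < e / 2 \<and> inverse (real (Suc n)) < e / 2"
      by (rule eventually_conj)
    then obtain n where n: "dist (r (g n)) l < e / 2" "inverse (real (Suc n)) < e / 2"
      unfolding eventually_sequentially by blast
    have "inverse (real (Suc (g n))) \<le> inverse (real (Suc n))"
      using seq_suble[OF g(1), of n] by (intro le_imp_inverse_le) simp_all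
    then have gn: "inverse (real (Suc (g n))) < e / 2" using n by linarith
    let ?x = "x (g n)"
    have xin: "?x \<in> carrier H" "A ?x \<in> carrier H" using x A by simp_all
    have "A ?x \<ominus> complex_of_real l \<odot> ?x =
        (A ?x \<ominus> complex_of_real (r (g n)) \<odot> ?x) \<oplus> complex_of_real (r (g n) - l) \<odot> ?x"
      using xin by (intro inner_ext) (simp_all add: ip_simps algebra_simps)
    then have "hnorm H (A ?x \<ominus> complex_of_real l \<odot> ?x)
        \<le> hnorm H (A ?x \<ominus> complex_of_real (r (g n)) \<odot> ?x) + hnorm H (complex_of_real (r (g n) - l) \<odot> ?x)"
      using hnorm_triangle[of "A ?x \<ominus> complex_of_real (r (g n)) \<odot> ?x" "complex_of_real (r (g n) - l) \<odot> ?x"] xin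
      by simp
    also have "hnorm H (complex_of_real (r (g n) - l) \<odot> ?x) = dist (r (g n)) l"
      using xin x(2)[of "g n"] by (simp only: hnorm_smult norm_of_real dist_real_def mult_1_right)
    also have "hnorm H (A ?x \<ominus> complex_of_real (r (g n)) \<odot> ?x) + dist (r (g n)) l < e"
      using Ax[of "g n"] gn n by linarith
    finally have "hnorm H (A ?x \<ominus> complex_of_real l \<odot> ?x) < e" .
    moreover have "hnorm H (B ?x \<ominus> \<mu> \<odot> ?x) < e" if "(B, \<mu>) \<in> S" for B \<mu>
      using Sx[OF that, of "g n"] gn e by linarith
    ultimately show "\<exists>x\<in>carrier H. hnorm H x = 1 \<and>
        (\<forall>B \<mu>. (B, \<mu>) \<in> insert (A, complex_of_real l) S \<longrightarrow> hnorm H (B x \<ominus> \<mu> \<odot> x) < e)"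
      using xin x(2) by (intro bexI[of _ ?x]) auto
  qed
  then show ?thesis by blast
qed

text \<open>
  The vectors \<open>c\<^sup>n y\<close> stay approximate eigenvectors for every operator that commutes with \<open>c\<close>,
  and since \<open>\<parallel>c\<^sup>n y\<parallel>\<close> is logarithmically convex with bounded growth, the growth rate is almost
  constant somewhere along the way; there \<open>c\<^sup>n y\<close> is nearly an eigenvector of \<open>c\<^sup>* c\<close>.
\<close>

lemma approx_eigen_modulus:
  assumes S: "approx_eigen S" and c: "normal_op H c"
    and lower: "\<And>x. x \<in> carrier H \<Longrightarrow> hnorm H x \<le> hnorm H (c x)"
    and SB: "\<And>A \<mu>. (A, \<mu>) \<in> S \<Longrightarrow> A \<in> bounded_ops H H"
    and com: "\<And>A \<mu> x. (A, \<mu>) \<in> S \<Longrightarrow> x \<in> carrier H \<Longrightarrow> A (c x) = c (A x)"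
  shows "\<exists>r::real. approx_eigen (insert (op_comp H (op_adj H H c) c, complex_of_real r) S)"
proof -
  have cB: "c \<in> bounded_ops H H" using c by (simp add: normal_op_def)
  obtain M0 where M0: "0 \<le> M0" "\<And>x. x \<in> carrier H \<Longrightarrow> hnorm H (c x) \<le> M0 * hnorm H x"
    using HH.bop_boundE[OF cB] by blast
  define M where "M = M0 + 1"
  have "hnorm H (c x) \<le> M * hnorm H x" if "x \<in> carrier H" for x
    unfolding M_def distrib_right using M0(2)[OF that] hnorm_ge[OF that] by linarith
  then have M: "1 \<le> M" "\<And>x. x \<in> carrier H \<Longrightarrow> hnorm H (c x) \<le> M * hnorm H x"
    using M0(1) by (simp_all add: M_def)
  show ?thesis
  proof (rule approx_eigen_compact[where M = "M\<^sup>2"])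
    fix e :: real assume e: "0 < e"
    have eM: "0 < e\<^sup>2 / M\<^sup>2" using e M by simp
    \<comment> \<open>\<open>K\<close> steps with increments of at least \<open>e^2 / M^2\<close>
      would take the squared growth rate beyond \<open>M^2\<close>. The division by
      \<open>M^2\<close> absorbs the factor \<open>\<rho>^2 \<le> M^2\<close> of the final
      estimate.\<close>
    obtain K :: nat where K: "M\<^sup>2 < real K * (e\<^sup>2 / M\<^sup>2)" using reals_Archimedean3[OF eM] by blast
    \<comment> \<open>Each application of \<open>c\<close> enlarges the error for a pair in
      \<open>S\<close> at most \<open>M\<close>-fold, and fewer than \<open>K\<close> applications
      will be made.\<close>
    define \<delta> where "\<delta> = e / M ^ K"
    have \<delta>: "0 < \<delta>" using e M by (simp add: \<delta>_def)
    obtain y where y: "y \<in> carrier H" "hnorm H y = 1"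
      and Sy: "\<And>A \<mu>. (A, \<mu>) \<in> S \<Longrightarrow> hnorm H (A y \<ominus> \<mu> \<odot> y) < \<delta>"
      using approx_eigenD[OF S \<delta>] by blast
    define v where "v n = (c ^^ n) y" for n
    have v0: "v 0 = y" and vS: "v (Suc n) = c (v n)" for n by (simp_all add: v_def)
    have v: "v n \<in> carrier H" for n using y cB by (induction n) (simp_all add: v0 vS)
    define u where "u n = hnorm H (v n)" for n
    have up: "u n \<le> u (Suc n)" for n using lower[OF v] by (simp add: u_def vS)
    have u1: "1 \<le> u n" for n
    proof (induction n)
      case (Suc n)
      then show ?case using up[of n] by linarith
    qed (simp add: u_def v0 y)
    have u0: "0 < u n" for n using u1[of n] by linarith
    have uM: "u (Suc n) \<le> M * u n" for n using M(2)[OF v] by (simp add: u_def vS)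
    \<comment> \<open>By normality, applying \<open>c\<close> or its adjoint to \<open>c x\<close>
      gives the same norm, so the next growth step also measures \<open>c^* c\<close>.\<close>
    have ccn: "hnorm H (op_adj H H c (c x)) = hnorm H (c (c x))" if "x \<in> carrier H" for x
      using normal_op_cinner[OF c, of "c x" "c x"] cB that by (simp add: hnorm_def)
    have lc: "(u (Suc n))\<^sup>2 \<le> u n * u (Suc (Suc n))" for n
    proof -
      have "(u (Suc n))\<^sup>2 = Re (cinner H (op_adj H H c (c (v n))) (v n))"
        using v cB by (simp add: u_def vS hnorm_sq HH.cinner_op_adj_left)
      also have "\<dots> \<le> hnorm H (op_adj H H c (c (v n))) * hnorm H (v n)"
        using v[of n] cB by (intro order_trans[OF complex_Re_le_cmod cauchy_schwarz]) simp_all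
      also have "\<dots> = u n * u (Suc (Suc n))" using ccn[OF v] by (simp add: u_def vS)
      finally show ?thesis .
    qed
    obtain n where n: "n < K" and small: "(u (Suc (Suc n)) / u (Suc n))\<^sup>2 - (u (Suc n) / u n)\<^sup>2 < e\<^sup>2 / M\<^sup>2"
      using geometric_ratio_step[of u M, OF u0 up uM lc eM K] by blast
    define \<rho> where "\<rho> = u (Suc n) / u n"
    have \<rho>: "0 \<le> \<rho>" "\<rho> \<le> M" using uM[of n] u0[of n] u0[of "Suc n"] by (simp_all add: \<rho>_def field_simps less_imp_le)
    have un: "u (Suc n) = \<rho> * u n" using u0[of n] by (simp add: \<rho>_def)
    define x where "x = complex_of_real (inverse (u n)) \<odot> v n"
    have x: "x \<in> carrier H" using v by (simp add: x_def)
    have "hnorm H x = 1" using v u0[of n] by (simp add: x_def hnorm_smult norm_inverse u_def[symmetric])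
    moreover have "\<bar>\<rho>\<^sup>2\<bar> \<le> M\<^sup>2" using \<rho> by (simp add: power_mono)
    moreover have "hnorm H (op_comp H (op_adj H H c) c x \<ominus> complex_of_real (\<rho>\<^sup>2) \<odot> x) < e"
    proof -
      let ?w = "op_adj H H c (c (v n)) \<ominus> complex_of_real (\<rho>\<^sup>2) \<odot> v n"
      have cv: "c (v n) \<in> carrier H" "op_adj H H c (c (v n)) \<in> carrier H" using v cB by simp_all
      have eq: "op_comp H (op_adj H H c) c x \<ominus> complex_of_real (\<rho>\<^sup>2) \<odot> x
          = complex_of_real (inverse (u n)) \<odot> ?w"
        using v[of n] cB cv
        by (intro inner_ext) (simp_all add: x_def bop_smult[OF cB] bop_smult[OF HH.op_adj_in[OF cB]]
            ip_simps algebra_simps)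
      have "Re (cinner H (op_adj H H c (c (v n))) (complex_of_real (\<rho>\<^sup>2) \<odot> v n)) = \<rho>\<^sup>2 * (u (Suc n))\<^sup>2"
        using v cB by (simp add: u_def vS hnorm_sq HH.cinner_op_adj_left ip_simps flip: of_real_power)
      moreover have "hnorm H (complex_of_real (\<rho>\<^sup>2) \<odot> v n) = \<rho>\<^sup>2 * u n"
        using v by (simp add: hnorm_smult u_def flip: of_real_power)
      moreover have "hnorm H (op_adj H H c (c (v n))) = u (Suc (Suc n))"
        using ccn[OF v] by (simp add: u_def vS)
      ultimately have "(hnorm H ?w)\<^sup>2 = (u (Suc (Suc n)))\<^sup>2 - 2 * (\<rho>\<^sup>2 * (u (Suc n))\<^sup>2) + (\<rho>\<^sup>2 * u n)\<^sup>2"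
        using hnorm_diff_sq[OF cv(2), of "complex_of_real (\<rho>\<^sup>2) \<odot> v n"] v[of n] by (simp only: smult_in)
      \<comment> \<open>With \<open>u (n + 1) = \<rho> u n\<close>, the error is governed by the
        increment of the squared growth rate, which the choice of \<open>n\<close> has made
        small.\<close>
      also have "\<dots> = (u n)\<^sup>2 * (\<rho>\<^sup>2 * ((u (Suc (Suc n)) / u (Suc n))\<^sup>2 - \<rho>\<^sup>2))"
      proof -
        have "u (Suc (Suc n)) = (u (Suc (Suc n)) / u (Suc n)) * (\<rho> * u n)"
          using u0[of "Suc n"] by (simp add: un[symmetric])
        then have "(u (Suc (Suc n)))\<^sup>2 = (u (Suc (Suc n)) / u (Suc n))\<^sup>2 * \<rho>\<^sup>2 * (u n)\<^sup>2"
          by (metis power_mult_distrib mult.assoc)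
        then show ?thesis by (simp add: un power_mult_distrib algebra_simps power2_eq_square)
      qed
      also have "\<dots> < (u n)\<^sup>2 * e\<^sup>2"
      proof -
        let ?g = "(u (Suc (Suc n)) / u (Suc n))\<^sup>2 - \<rho>\<^sup>2"
        have "\<rho>\<^sup>2 * ?g < e\<^sup>2"
        proof (cases "?g \<le> 0")
          case True
          then have "\<rho>\<^sup>2 * ?g \<le> 0" by (simp add: mult_le_0_iff)
          then show ?thesis using e by (smt (verit) zero_less_power)
        next
          case False
          then have "\<rho>\<^sup>2 * ?g \<le> M\<^sup>2 * ?g" using \<rho> by (intro mult_right_mono power_mono) auto
          also have "\<dots> < M\<^sup>2 * (e\<^sup>2 / M\<^sup>2)" using small M by (intro mult_strict_left_mono) (simp_all add: \<rho>_def)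
          finally show ?thesis using M by simp
        qed
        then show ?thesis using u0[of n] by (intro mult_strict_left_mono) simp_all
      qed
      finally have "(hnorm H ?w)\<^sup>2 < (u n * e)\<^sup>2" by (simp add: power_mult_distrib)
      then have "hnorm H ?w < u n * e" by (rule power2_less_imp_less) (use u0[of n] e in simp)
      then have "inverse (u n) * hnorm H ?w < e" using u0[of n] by (simp add: field_simps)
      then show ?thesis unfolding eq using cv v[of n] u0[of n]
        by (simp add: hnorm_smult norm_inverse del: of_real_inverse of_real_power)
    qed
    moreover have "hnorm H (A x \<ominus> \<mu> \<odot> x) < e" if A: "(A, \<mu>) \<in> S" for A \<mu>
    proof -
      have AB: "A \<in> bounded_ops H H" by (rule SB[OF A])
      define d where "d i = A (v i) \<ominus> \<mu> \<odot> v i" for i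
      have din: "d i \<in> carrier H" for i using v AB by (simp add: d_def)
      have dS: "d (Suc i) = c (d i)" for i
        using v[of i] AB cB com[OF A v[of i]] by (simp add: d_def vS HH.bop_diff bop_smult)
      have "hnorm H (d i) \<le> M ^ i * hnorm H (d 0)" for i
      proof (induction i)
        case (Suc i)
        have "hnorm H (d (Suc i)) \<le> M * hnorm H (d i)" unfolding dS by (rule M(2)[OF din])
        also have "\<dots> \<le> M * (M ^ i * hnorm H (d 0))" using Suc M by (intro mult_left_mono) simp_all
        finally show ?case by (simp add: mult.assoc)
      qed simp
      then have "hnorm H (d n) \<le> M ^ n * hnorm H (d 0)" .
      also have "\<dots> < M ^ n * \<delta>" using Sy[OF A] M by (intro mult_strict_left_mono) (simp_all add: d_def v0)
      also have "\<dots> \<le> M ^ K * \<delta>" using n M \<delta> by (intro mult_right_mono power_increasing) simp_all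
      also have "\<dots> = e" using M by (simp add: \<delta>_def)
      finally have dn: "hnorm H (d n) < e" .
      have "A x \<ominus> \<mu> \<odot> x = complex_of_real (inverse (u n)) \<odot> d n"
        using v[of n] AB by (intro inner_ext) (simp_all add: x_def d_def bop_smult ip_simps algebra_simps)
      then have "hnorm H (A x \<ominus> \<mu> \<odot> x) = inverse (u n) * hnorm H (d n)"
        using din[of n] u0[of n] by (simp add: hnorm_smult norm_inverse)
      \<comment> \<open>Since \<open>c\<close> does not shrink vectors, \<open>u n \<ge> 1\<close>,
        and normalising cannot enlarge the error.\<close>
      also have "\<dots> \<le> 1 * hnorm H (d n)"
        using u1[of n] din by (intro mult_right_mono) (simp_all add: inverse_le_1_iff)
      finally show ?thesis using dn by simp
    qed
    ultimately show "\<exists>x\<in>carrier H. \<exists>r::real. hnorm H x = 1 \<and> \<bar>r\<bar> \<le> M\<^sup>2 \<and>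
      hnorm H (op_comp H (op_adj H H c) c x \<ominus> complex_of_real r \<odot> x) < e \<and>
      (\<forall>B \<mu>. (B, \<mu>) \<in> S \<longrightarrow> hnorm H (B x \<ominus> \<mu> \<odot> x) < e)"
      using x by blast
  qed (use cB in simp)
qed

definition shift_op :: "('a \<Rightarrow> 'a) \<Rightarrow> complex \<Rightarrow> 'a \<Rightarrow> 'a" where
  "shift_op b z = op_add H b (op_scale H (- z) (op_id H))"

lemma shift_op_in: "b \<in> bounded_ops H H \<Longrightarrow> shift_op b z \<in> bounded_ops H H"
  by (simp add: shift_op_def)

lemma shift_op_app: "x \<in> carrier H \<Longrightarrow> b \<in> bounded_ops H H \<Longrightarrow> shift_op b z x = b x \<ominus> z \<odot> x"
  by (rule inner_ext) (simp_all add: shift_op_def ip_simps)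

lemma op_adj_shift:
  assumes b: "b \<in> bounded_ops H H"
  shows "op_adj H H (shift_op b z) = shift_op (op_adj H H b) (cnj z)"
  by (rule HH.op_adj_eqI) (use b in \<open>simp_all add: shift_op_in shift_op_app ip_simps adj_simps\<close>)

lemma shift_op_normal:
  assumes b: "normal_op H b"
  shows "normal_op H (shift_op b z)"
proof (rule normal_opI)
  have bB: "b \<in> bounded_ops H H" using b by (simp add: normal_op_def)
  then show "shift_op b z \<in> bounded_ops H H" by (rule shift_op_in)
  show "cinner H (shift_op b z x) (shift_op b z y)
      = cinner H (op_adj H H (shift_op b z) x) (op_adj H H (shift_op b z) y)"
    if "x \<in> carrier H" "y \<in> carrier H" for x y
    using that bB normal_op_cinner[OF b that] HH.cinner_op_adj[OF bB, of x y] HH.cinner_op_adj_left[OF bB, of y x]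
    by (simp add: op_adj_shift shift_op_app ip_simps algebra_simps)
qed

text \<open>As \<open>b - z\<close> is normal, an approximate eigenvector of \<open>b\<close> for
  \<open>z\<close> is also one of its adjoint for \<open>cnj z\<close>.\<close>

lemma normal_shift_norm:
  assumes b: "normal_op H b" and x: "x \<in> carrier H"
  shows "hnorm H (op_adj H H b x \<ominus> cnj z \<odot> x) = hnorm H (b x \<ominus> z \<odot> x)"
proof -
  have bB: "b \<in> bounded_ops H H" using b by (simp add: normal_op_def)
  show ?thesis
    using normal_op_cinner[OF shift_op_normal[OF b, of z] x x] x bB
    by (simp add: op_adj_shift shift_op_app hnorm_def)
qed

text \<open>A translate \<open>b - z\<close> with \<open>|z| = M + 1\<close> is bounded below by 1,
  so \<open>approx_eigen_modulus\<close> applies to it. The squared modulus of \<open>b - z\<close>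
  is \<open>b^* b - cnj z b - z b^* + |z|^2\<close>; a linear combination of those for
  \<open>z = R\<close>, \<open>- R\<close>, \<open>\<i> R\<close>, \<open>- \<i> R\<close> is
  \<open>b\<close> itself.\<close>

theorem approx_eigen_extend:
  assumes S: "approx_eigen S" and b: "normal_op H b"
    and SB: "\<And>A \<mu>. (A, \<mu>) \<in> S \<Longrightarrow> A \<in> bounded_ops H H"
    and com: "\<And>A \<mu> x. (A, \<mu>) \<in> S \<Longrightarrow> x \<in> carrier H \<Longrightarrow> A (b x) = b (A x)"
  shows "\<exists>\<mu>. approx_eigen (insert (b, \<mu>) S)"
proof -
  have bB [simp]: "b \<in> bounded_ops H H" using b by (simp add: normal_op_def)
  obtain M where M: "0 \<le> M" "\<And>x. x \<in> carrier H \<Longrightarrow> hnorm H (b x) \<le> M * hnorm H x"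
    using HH.bop_boundE[OF bB] by blast
  define R where "R = M + 1"
  have R: "R > 0" using M by (simp add: R_def)
  define D where "D z = op_comp H (op_adj H H (shift_op b z)) (shift_op b z)" for z
  have DB: "D z \<in> bounded_ops H H" for z by (simp add: D_def shift_op_in)
  have D_ip: "cinner H (D z x) y = cinner H (b x) (b y) - cnj z * cinner H (b x) y - z * cinner H x (b y)
       + z * cnj z * cinner H x y" if "x \<in> carrier H" "y \<in> carrier H" for z x y
    using that by (simp add: D_def shift_op_in HH.cinner_op_adj_left) (simp add: shift_op_app ip_simps algebra_simps)
  \<comment> \<open>The four moduli join the set one after another, so each of them must commute
    with \<open>b\<close>; normality of \<open>b\<close> provides this.\<close>
  have D_com: "D z (b x) = b (D z x)" if x: "x \<in> carrier H" for z x
  proof (rule inner_ext)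
    fix y assume y: "y \<in> carrier H"
    have "cinner H (b (D z x)) y = cinner H (D z x) (op_adj H H b y)"
      using x y bop_in[OF DB x] by (simp add: HH.cinner_op_adj)
    then show "cinner H (D z (b x)) y = cinner H (b (D z x)) y"
      using x y by (simp add: D_ip normal_op_app[OF b, symmetric] HH.cinner_op_adj)
  qed (use x bop_in[OF DB] in simp_all)
  have step: "\<exists>r::real. approx_eigen (insert (D z, complex_of_real r) S')"
    if z: "cmod z = R" and S': "approx_eigen S'"
      and SB': "\<And>A \<mu>. (A, \<mu>) \<in> S' \<Longrightarrow> A \<in> bounded_ops H H"
      and com': "\<And>A \<mu> x. (A, \<mu>) \<in> S' \<Longrightarrow> x \<in> carrier H \<Longrightarrow> A (b x) = b (A x)" for z S'
    unfolding D_def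
  proof (rule approx_eigen_modulus[OF S' shift_op_normal[OF b] _ SB'])
    show "hnorm H x \<le> hnorm H (shift_op b z x)" if x: "x \<in> carrier H" for x
    proof -
      have "z \<odot> x = b x \<ominus> (b x \<ominus> z \<odot> x)" using x by (intro inner_ext) (simp_all add: ip_simps)
      then have "R * hnorm H x \<le> hnorm H (b x) + hnorm H (shift_op b z x)"
        using hnorm_triangle_sub[of "b x" "b x \<ominus> z \<odot> x"] x hnorm_smult[OF x, of z] z by (simp add: shift_op_app)
      then show ?thesis using M(2)[OF x] by (simp add: R_def distrib_right)
    qed
    show "A (shift_op b z x) = shift_op b z (A x)" if "(A, \<mu>) \<in> S'" "x \<in> carrier H" for A \<mu> x
      using SB'[OF that(1)] com'[OF that] that(2) by (simp add: shift_op_app HH.bop_diff bop_smult)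
  qed
  let ?R = "complex_of_real R"
  obtain r1 :: real where S1: "approx_eigen (insert (D ?R, complex_of_real r1) S)" (is "approx_eigen ?S1")
    using step[of ?R S] R S SB com by auto
  obtain r2 :: real where S2: "approx_eigen (insert (D (- ?R), complex_of_real r2) ?S1)" (is "approx_eigen ?S2")
  proof -
    have "\<exists>r::real. approx_eigen (insert (D (- ?R), complex_of_real r) ?S1)"
      by (rule step[OF _ S1]) (use R SB com DB D_com in auto)
    then show ?thesis using that by blast
  qed
  obtain r3 :: real where S3: "approx_eigen (insert (D (\<i> * ?R), complex_of_real r3) ?S2)" (is "approx_eigen ?S3")
  proof -
    have "\<exists>r::real. approx_eigen (insert (D (\<i> * ?R), complex_of_real r) ?S2)"
      by (rule step[OF _ S2]) (use R SB com DB D_com in \<open>auto simp: norm_mult\<close>)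
    then show ?thesis using that by blast
  qed
  obtain r4 :: real where S4: "approx_eigen (insert (D (- (\<i> * ?R)), complex_of_real r4) ?S3)" (is "approx_eigen ?S4")
  proof -
    have "\<exists>r::real. approx_eigen (insert (D (- (\<i> * ?R)), complex_of_real r) ?S3)"
      by (rule step[OF _ S3]) (use R SB com DB D_com in \<open>auto simp: norm_mult\<close>)
    then show ?thesis using that by blast
  qed
  \<comment> \<open>\<open>C1\<close> is half of \<open>b\<close> plus its adjoint and
    \<open>C2\<close> half of \<open>b\<close> minus its adjoint, so that
    \<open>b = C1 + C2\<close>.\<close>
  define C1 where "C1 = op_add H (op_scale H (- 1 / (4 * ?R)) (D ?R)) (op_scale H (1 / (4 * ?R)) (D (- ?R)))"
  define C2 where "C2 = op_add H (op_scale H (1 / (4 * \<i> * ?R)) (D (\<i> * ?R))) (op_scale H (- 1 / (4 * \<i> * ?R)) (D (- (\<i> * ?R))))"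
  have C: "C1 \<in> bounded_ops H H" "C2 \<in> bounded_ops H H" by (simp_all add: C1_def C2_def DB)
  define \<mu>1 where "\<mu>1 = - 1 / (4 * ?R) * complex_of_real r1 + 1 / (4 * ?R) * complex_of_real r2"
  define \<mu>2 where "\<mu>2 = 1 / (4 * \<i> * ?R) * complex_of_real r3 + - 1 / (4 * \<i> * ?R) * complex_of_real r4"
  have S5: "approx_eigen (insert (C1, \<mu>1) ?S4)" (is "approx_eigen ?S5")
    unfolding \<mu>1_def
    by (rule approx_eigen_lin[OF S4, of "D ?R" _ "D (- ?R)"]) (simp_all add: DB C1_def)
  have S6: "approx_eigen (insert (C2, \<mu>2) ?S5)" (is "approx_eigen ?S6")
    unfolding \<mu>2_def
    by (rule approx_eigen_lin[OF S5, of "D (\<i> * ?R)" _ "D (- (\<i> * ?R))"]) (simp_all add: DB C2_def)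
  have bC: "b x = (1 \<odot> C1 x) \<oplus> (1 \<odot> C2 x)" if x: "x \<in> carrier H" for x
  proof (rule inner_ext)
    fix y assume y: "y \<in> carrier H"
    have Dx: "D z x \<in> carrier H" for z by (rule bop_in[OF DB x])
    show "cinner H (b x) y = cinner H ((1 \<odot> C1 x) \<oplus> (1 \<odot> C2 x)) y"
      using x y R Dx by (simp add: C1_def C2_def DB ip_simps D_ip field_simps)
  qed (use x bop_in[OF C(1)] bop_in[OF C(2)] in simp_all)
  have "approx_eigen (insert (b, 1 * \<mu>1 + 1 * \<mu>2) ?S6)"
    by (rule approx_eigen_lin[OF S6 _ C(1) _ C(2) bC]) auto
  then have "approx_eigen (insert (b, 1 * \<mu>1 + 1 * \<mu>2) S)" by (rule approx_eigen_mono) auto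
  then show ?thesis by blast
qed

end

section \<open>Characters and the joint spectrum\<close>

context hilbert_space
begin

definition unit_seq :: "(nat \<Rightarrow> 'a) \<Rightarrow> bool" where
  "unit_seq x \<longleftrightarrow> (\<forall>n. x n \<in> carrier H \<and> hnorm H (x n) = 1)"

definition aev :: "(nat \<Rightarrow> 'a) \<Rightarrow> ('a \<Rightarrow> 'a) \<Rightarrow> complex \<Rightarrow> bool" where
  "aev x T c \<longleftrightarrow> (\<lambda>n. hnorm H (T (x n) \<ominus> c \<odot> x n)) \<longlonglongrightarrow> 0"

lemma unit_seqD [simp]: "unit_seq x \<Longrightarrow> x n \<in> carrier H" "unit_seq x \<Longrightarrow> hnorm H (x n) = 1"
  by (simp_all add: unit_seq_def)

lemma approx_eigen_seq:
  assumes S: "approx_eigen S" and SB: "\<And>A \<mu>. (A, \<mu>) \<in> S \<Longrightarrow> A \<in> bounded_ops H H"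
  shows "\<exists>x. unit_seq x \<and> (\<forall>A \<mu>. (A, \<mu>) \<in> S \<longrightarrow> aev x A \<mu>)"
proof -
  have "\<forall>n. \<exists>x. x \<in> carrier H \<and> hnorm H x = 1 \<and>
      (\<forall>A \<mu>. (A, \<mu>) \<in> S \<longrightarrow> hnorm H (A x \<ominus> \<mu> \<odot> x) < inverse (real (Suc n)))"
  proof
    fix n
    have "0 < inverse (real (Suc n))" by simp
    then show "\<exists>x. x \<in> carrier H \<and> hnorm H x = 1 \<and>
      (\<forall>A \<mu>. (A, \<mu>) \<in> S \<longrightarrow> hnorm H (A x \<ominus> \<mu> \<odot> x) < inverse (real (Suc n)))"
      using S unfolding approx_eigen_def Bex_def by blast
  qed
  from choice[OF this] obtain x where x: "\<forall>n. x n \<in> carrier H \<and> hnorm H (x n) = 1 \<and>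
      (\<forall>A \<mu>. (A, \<mu>) \<in> S \<longrightarrow> hnorm H (A (x n) \<ominus> \<mu> \<odot> x n) < inverse (real (Suc n)))" ..
  have u: "unit_seq x" using x unfolding unit_seq_def by blast
  have "aev x A \<mu>" if A: "(A, \<mu>) \<in> S" for A \<mu>
    unfolding aev_def
  proof (rule tendsto_sandwich[OF _ _ _ LIMSEQ_inverse_real_of_nat])
    show "\<forall>\<^sub>F n in sequentially. hnorm H (A (x n) \<ominus> \<mu> \<odot> x n) \<le> inverse (real (Suc n))"
      using x A by (intro always_eventually allI less_imp_le) blast
    show "\<forall>\<^sub>F n in sequentially. 0 \<le> hnorm H (A (x n) \<ominus> \<mu> \<odot> x n)"
      using u SB[OF A] by simp
    show "(\<lambda>n. 0::real) \<longlonglongrightarrow> 0" by simp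
  qed
  then show ?thesis using u by blast
qed

lemma op_adj_add: "S \<in> bounded_ops H H \<Longrightarrow> T \<in> bounded_ops H H \<Longrightarrow>
    op_adj H H (op_add H S T) = op_add H (op_adj H H S) (op_adj H H T)"
  by (rule HH.op_adj_eqI) (simp_all add: ip_simps adj_simps)

lemma op_adj_comp: "S \<in> bounded_ops H H \<Longrightarrow> T \<in> bounded_ops H H \<Longrightarrow>
    op_adj H H (op_comp H S T) = op_comp H (op_adj H H T) (op_adj H H S)"
  by (rule HH.op_adj_eqI) (simp_all add: adj_simps)

lemma op_adj_scale: "S \<in> bounded_ops H H \<Longrightarrow>
    op_adj H H (op_scale H c S) = op_scale H (cnj c) (op_adj H H S)"
  by (rule HH.op_adj_eqI) (simp_all add: ip_simps adj_simps)

lemma op_adj_id: "op_adj H H (op_id H) = op_id H"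
  by (rule HH.op_adj_eqI) simp_all

context
  fixes x assumes x: "unit_seq x"
begin

lemma aev_le:
  assumes "\<And>n. hnorm H (T (x n) \<ominus> c \<odot> x n) \<le> g n" "g \<longlonglongrightarrow> 0" "T \<in> bounded_ops H H"
  shows "aev x T c"
  unfolding aev_def
proof (rule tendsto_sandwich[OF _ _ tendsto_const assms(2)])
  show "\<forall>\<^sub>F n in sequentially. 0 \<le> hnorm H (T (x n) \<ominus> c \<odot> x n)"
    using assms(3) x by simp
qed (use assms(1) in simp)

lemma aev_add:
  assumes B: "S \<in> bounded_ops H H" "T \<in> bounded_ops H H" and a: "aev x S a" "aev x T b"
  shows "aev x (op_add H S T) (a + b)"
proof (rule aev_le)
  show "hnorm H (op_add H S T (x n) \<ominus> (a + b) \<odot> x n)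
      \<le> hnorm H (S (x n) \<ominus> a \<odot> x n) + hnorm H (T (x n) \<ominus> b \<odot> x n)" for n
  proof -
    have "op_add H S T (x n) \<ominus> (a + b) \<odot> x n = (S (x n) \<ominus> a \<odot> x n) \<oplus> (T (x n) \<ominus> b \<odot> x n)"
      using x B by (intro inner_ext) (simp_all add: ip_simps algebra_simps)
    then show ?thesis using x B by (simp only:) (intro hnorm_triangle; simp)
  qed
  show "(\<lambda>n. hnorm H (S (x n) \<ominus> a \<odot> x n) + hnorm H (T (x n) \<ominus> b \<odot> x n)) \<longlonglongrightarrow> 0"
    using tendsto_add[OF a[unfolded aev_def]] by simp
qed (use B in simp)

lemma aev_scale:
  assumes B: "S \<in> bounded_ops H H" and a: "aev x S a"
  shows "aev x (op_scale H c S) (c * a)"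
proof (rule aev_le)
  show "hnorm H (op_scale H c S (x n) \<ominus> (c * a) \<odot> x n) \<le> cmod c * hnorm H (S (x n) \<ominus> a \<odot> x n)" for n
  proof -
    have "op_scale H c S (x n) \<ominus> (c * a) \<odot> x n = c \<odot> (S (x n) \<ominus> a \<odot> x n)"
      using x B by (intro inner_ext) (simp_all add: ip_simps algebra_simps)
    then show ?thesis using x B by (simp add: hnorm_smult)
  qed
  show "(\<lambda>n. cmod c * hnorm H (S (x n) \<ominus> a \<odot> x n)) \<longlonglongrightarrow> 0"
    using tendsto_mult[OF tendsto_const a[unfolded aev_def]] by simp
qed (use B in simp)

lemma aev_comp:
  assumes B: "S \<in> bounded_ops H H" "T \<in> bounded_ops H H" and a: "aev x S a" "aev x T b"
  shows "aev x (op_comp H S T) (a * b)"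
proof -
  obtain M where M: "0 \<le> M" "\<And>y. y \<in> carrier H \<Longrightarrow> hnorm H (S y) \<le> M * hnorm H y"
    using HH.bop_boundE[OF B(1)] by blast
  show ?thesis
  proof (rule aev_le)
    show "hnorm H (op_comp H S T (x n) \<ominus> (a * b) \<odot> x n)
        \<le> M * hnorm H (T (x n) \<ominus> b \<odot> x n) + cmod b * hnorm H (S (x n) \<ominus> a \<odot> x n)" for n
    proof -
      let ?u = "T (x n) \<ominus> b \<odot> x n" and ?v = "S (x n) \<ominus> a \<odot> x n"
      have u: "?u \<in> carrier H" "?v \<in> carrier H" using x B by simp_all
      have "op_comp H S T (x n) \<ominus> (a * b) \<odot> x n = S ?u \<oplus> b \<odot> ?v"
        using x B by (intro inner_ext) (simp_all add: HH.bop_diff bop_smult[OF B(1)] ip_simps algebra_simps)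
      then have "hnorm H (op_comp H S T (x n) \<ominus> (a * b) \<odot> x n) \<le> hnorm H (S ?u) + cmod b * hnorm H ?v"
        using hnorm_triangle[of "S ?u" "b \<odot> ?v"] u B by (simp add: hnorm_smult)
      then show ?thesis using M(2)[OF u(1)] by linarith
    qed
    show "(\<lambda>n. M * hnorm H (T (x n) \<ominus> b \<odot> x n) + cmod b * hnorm H (S (x n) \<ominus> a \<odot> x n)) \<longlonglongrightarrow> 0"
      using tendsto_add[OF tendsto_mult[OF tendsto_const a(2)[unfolded aev_def]]
          tendsto_mult[OF tendsto_const a(1)[unfolded aev_def]]] by simp
  qed (use B in simp)
qed

lemma aev_id: "aev x (op_id H) 1"
proof (rule aev_le[OF _ tendsto_const])
  fix n
  have "op_id H (x n) \<ominus> 1 \<odot> x n = \<zero>"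
    using x by (intro inner_ext) (simp_all add: ip_simps)
  then show "hnorm H (op_id H (x n) \<ominus> 1 \<odot> x n) \<le> 0" by simp
qed simp

lemma aev_adj:
  assumes T: "normal_op H T" and c: "aev x T c"
  shows "aev x (op_adj H H T) (cnj c)"
  using c x by (simp add: aev_def normal_shift_norm[OF T])

lemma cinner_aev_bound:
  assumes T: "T \<in> bounded_ops H H"
  shows "cmod (cinner H (T (x n)) (x n) - c) \<le> hnorm H (T (x n) \<ominus> c \<odot> x n)"
proof -
  have "cinner H (T (x n)) (x n) - c = cinner H (T (x n) \<ominus> c \<odot> x n) (x n)"
    using x T cinner_self[of "x n"] by (simp add: ip_simps)
  then show ?thesis using cauchy_schwarz[of "T (x n) \<ominus> c \<odot> x n" "x n"] x T by simp
qed

lemma aev_cinner: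
  assumes T: "T \<in> bounded_ops H H" and c: "aev x T c"
  shows "(\<lambda>n. cinner H (T (x n)) (x n)) \<longlonglongrightarrow> c"
proof (rule LIM_zero_cancel, rule tendsto_norm_zero_cancel, rule tendsto_sandwich[OF _ _ tendsto_const c[unfolded aev_def]])
qed (use cinner_aev_bound[OF T] in simp_all)

lemma aev_unique:
  assumes T: "T \<in> bounded_ops H H" and "aev x T c" "aev x T c'"
  shows "c = c'"
  by (rule LIMSEQ_unique[OF aev_cinner[OF T] aev_cinner[OF T]]) fact+

text \<open>The eigenvalue is read off from \<open>T\<close> itself: the approximants confine the
  tails of \<open><T x_n, x_n>\<close> to small disks, so this sequence is Cauchy, and its limit is
  the eigenvalue.\<close>

lemma aev_limit:
  assumes T: "T \<in> bounded_ops H H"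
    and ap: "\<And>e. 0 < e \<Longrightarrow> \<exists>S\<in>bounded_ops H H. (\<exists>c. aev x S c) \<and>
       (\<forall>y\<in>carrier H. hnorm H (T y \<ominus> S y) \<le> e * hnorm H y)"
  shows "\<exists>c. aev x T c"
proof -
  have near: "\<exists>c. \<exists>N. \<forall>n\<ge>N. hnorm H (T (x n) \<ominus> c \<odot> x n) < e" if e: "0 < e" for e
  proof -
    have e2: "0 < e / 2" using e by simp
    obtain S c where S: "S \<in> bounded_ops H H" "aev x S c"
      and TS: "\<And>y. y \<in> carrier H \<Longrightarrow> hnorm H (T y \<ominus> S y) \<le> e / 2 * hnorm H y"
      using ap[OF e2] by blast
    have "\<forall>\<^sub>F n in sequentially. hnorm H (S (x n) \<ominus> c \<odot> x n) < e / 2"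
      by (rule order_tendstoD(2)[OF S(2)[unfolded aev_def] e2])
    then obtain N where N: "\<And>n. n \<ge> N \<Longrightarrow> hnorm H (S (x n) \<ominus> c \<odot> x n) < e / 2"
      unfolding eventually_sequentially by blast
    have "hnorm H (T (x n) \<ominus> c \<odot> x n) < e" if "n \<ge> N" for n
      using hnorm_triangle_diff[of "T (x n)" "S (x n)" "c \<odot> x n"] TS[of "x n"] N[OF that] x S T by simp
    then show ?thesis by blast
  qed
  define a where "a n = cinner H (T (x n)) (x n)" for n
  have "Cauchy a"
  proof (rule metric_CauchyI)
    fix e :: real assume "0 < e"
    then have "0 < e / 2" by simp
    from near[OF this] obtain c N where N: "\<And>n. n \<ge> N \<Longrightarrow> hnorm H (T (x n) \<ominus> c \<odot> x n) < e / 2" by blast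
    have "dist (a n) c < e / 2" if "n \<ge> N" for n
      using cinner_aev_bound[OF T, of n c] N[OF that] by (simp add: a_def dist_norm)
    then have "dist (a i) (a j) < e" if "i \<ge> N" "j \<ge> N" for i j
      using that by (meson dist_triangle_half_r dist_commute_lessI)
    then show "\<exists>M. \<forall>i\<ge>M. \<forall>j\<ge>M. dist (a i) (a j) < e" by blast
  qed
  then obtain l where l: "a \<longlonglongrightarrow> l" by (auto simp: Cauchy_convergent_iff convergent_def)
  have "aev x T l"
    unfolding aev_def
  proof (rule LIMSEQ_I)
    fix e :: real assume e: "0 < e"
    then have e4: "0 < e / 4" by simp
    from near[OF this] obtain c N where N: "\<And>n. n \<ge> N \<Longrightarrow> hnorm H (T (x n) \<ominus> c \<odot> x n) < e / 4" by blast
    have "\<forall>\<^sub>F n in sequentially. dist (a n) l < e / 4" by (rule tendstoD[OF l e4])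
    then obtain N' where N': "\<And>n. n \<ge> N' \<Longrightarrow> dist (a n) l < e / 4"
      unfolding eventually_sequentially by blast
    have "dist (a (max N N')) c < e / 4"
      using cinner_aev_bound[OF T, of "max N N'" c] N[of "max N N'"] by (simp add: a_def dist_norm)
    then have cl: "cmod (c - l) < e / 2"
      using N'[of "max N N'"] dist_triangle3[of c l "a (max N N')"] by (simp add: dist_norm)
    have "norm (hnorm H (T (x n) \<ominus> l \<odot> x n) - 0) < e" if n: "n \<ge> N" for n
    proof -
      have xn: "x n \<in> carrier H" "T (x n) \<in> carrier H" using x T by simp_all
      have "c \<odot> x n \<ominus> l \<odot> x n = (c - l) \<odot> x n"
        using xn by (intro inner_ext) (simp_all add: ip_simps algebra_simps)
      then have "hnorm H (c \<odot> x n \<ominus> l \<odot> x n) = cmod (c - l)" using xn x by (simp add: hnorm_smult)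
      then have "hnorm H (T (x n) \<ominus> l \<odot> x n) < e"
        using hnorm_triangle_diff[of "T (x n)" "c \<odot> x n" "l \<odot> x n"] xn N[OF n] cl e by simp
      then show ?thesis using xn by simp
    qed
    then show "\<exists>M. \<forall>n\<ge>M. norm (hnorm H (T (x n) \<ominus> l \<odot> x n) - 0) < e" by blast
  qed
  then show ?thesis by blast
qed

text \<open>Demanding the conjugate eigenvalue of the adjoint makes the set closed under adjoints.
  For a normal operator the demand is automatic by \<open>aev_adj\<close>, so generators enter
  freely.\<close>

definition aev_alg :: "('a \<Rightarrow> 'a) set" where
  "aev_alg = {T \<in> bounded_ops H H. \<exists>c. aev x T c \<and> aev x (op_adj H H T) (cnj c)}"

lemma aev_alg_cstar: "unital_cstar_subalgebra H aev_alg"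
  unfolding unital_cstar_subalgebra_def
proof (intro conjI ballI allI impI)
  show "aev_alg \<subseteq> bounded_ops H H" by (auto simp: aev_alg_def)
  have "aev x (op_adj H H (op_id H)) (cnj 1)" by (simp add: op_adj_id aev_id)
  then show "op_id H \<in> aev_alg" using aev_id op_id_in by (auto simp: aev_alg_def)
next
  fix S T assume "S \<in> aev_alg" "T \<in> aev_alg"
  then obtain a b where S: "S \<in> bounded_ops H H" "aev x S a" "aev x (op_adj H H S) (cnj a)"
    and T: "T \<in> bounded_ops H H" "aev x T b" "aev x (op_adj H H T) (cnj b)" by (auto simp: aev_alg_def)
  have "aev x (op_adj H H (op_add H S T)) (cnj (a + b))"
    using aev_add[OF HH.op_adj_in[OF S(1)] HH.op_adj_in[OF T(1)] S(3) T(3)] S T by (simp add: op_adj_add)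
  then show "op_add H S T \<in> aev_alg"
    using aev_add[OF S(1) T(1) S(2) T(2)] op_add_in[OF S(1) T(1)] by (auto simp: aev_alg_def)
  have "aev x (op_adj H H (op_comp H S T)) (cnj (a * b))"
    using aev_comp[OF HH.op_adj_in[OF T(1)] HH.op_adj_in[OF S(1)] T(3) S(3)] S T
    by (simp add: op_adj_comp mult.commute)
  then show "op_comp H S T \<in> aev_alg"
    using aev_comp[OF S(1) T(1) S(2) T(2)] op_comp_in[OF S(1) T(1)] unfolding aev_alg_def by blast
next
  fix S c assume "S \<in> aev_alg"
  then obtain a where S: "S \<in> bounded_ops H H" "aev x S a" "aev x (op_adj H H S) (cnj a)"
    by (auto simp: aev_alg_def)
  have "aev x (op_adj H H (op_scale H c S)) (cnj (c * a))"
    using aev_scale[OF HH.op_adj_in[OF S(1)] S(3), of "cnj c"] S by (simp add: op_adj_scale)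
  then show "op_scale H c S \<in> aev_alg"
    using aev_scale[OF S(1,2), of c] op_scale_in[OF S(1), of c] unfolding aev_alg_def by blast
  have "aev x (op_adj H H (op_adj H H S)) (cnj (cnj a))" using S by (simp add: op_adj_invol)
  then show "op_adj H H S \<in> aev_alg" using S HH.op_adj_in[OF S(1)] unfolding aev_alg_def by blast
next
  fix T assume T: "T \<in> bounded_ops H H"
    and ap: "\<forall>e>0. \<exists>S\<in>aev_alg. op_norm H H (op_add H T (op_scale H (- 1) S)) < e"
  \<comment> \<open>One \<open>S\<close> approximates \<open>T\<close> and its adjoint equally well,
    because the adjoint of \<open>T - S\<close> obeys the same bound.\<close>
  have near: "\<exists>S\<in>bounded_ops H H. (\<exists>c. aev x S c \<and> aev x (op_adj H H S) (cnj c)) \<and>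
      (\<forall>y\<in>carrier H. hnorm H (T y \<ominus> S y) \<le> e * hnorm H y) \<and>
      (\<forall>y\<in>carrier H. hnorm H (op_adj H H T y \<ominus> op_adj H H S y) \<le> e * hnorm H y)" if e: "0 < e" for e
  proof -
    obtain S where S: "S \<in> aev_alg" and n: "op_norm H H (op_add H T (op_scale H (- 1) S)) < e" using ap e by blast
    let ?D = "op_add H T (op_scale H (- 1) S)"
    have SB: "S \<in> bounded_ops H H" and Sc: "\<exists>c. aev x S c \<and> aev x (op_adj H H S) (cnj c)"
      using S by (auto simp: aev_alg_def)
    have D: "?D \<in> bounded_ops H H" using T SB by simp
    have Db: "hnorm H (?D y) \<le> e * hnorm H y" if "y \<in> carrier H" for y
      using HH.hnorm_le_op_norm[OF D that] mult_right_mono[OF less_imp_le[OF n], of "hnorm H y"] that by simp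
    have "T y \<ominus> S y = ?D y" if "y \<in> carrier H" for y
      using that T SB by (intro inner_ext) (simp_all add: ip_simps)
    moreover have "op_adj H H T y \<ominus> op_adj H H S y = op_adj H H ?D y" if "y \<in> carrier H" for y
      using that T SB by (intro inner_ext) (simp_all add: op_adj_add op_adj_scale ip_simps)
    moreover have "hnorm H (op_adj H H ?D y) \<le> e * hnorm H y" if "y \<in> carrier H" for y
      by (rule HH.hnorm_op_adj[OF D less_imp_le[OF e] Db that])
    ultimately show ?thesis using SB Sc Db by (intro bexI[of _ S]) simp_all
  qed
  have "\<exists>c. aev x T c"
    by (rule aev_limit[OF T]) (use near in blast)
  then obtain c where c: "aev x T c" ..
  have "\<exists>c. aev x (op_adj H H T) c"
    by (rule aev_limit[OF HH.op_adj_in[OF T]]) (use near HH.op_adj_in in blast)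
  then obtain c' where c': "aev x (op_adj H H T) c'" ..
  \<comment> \<open>The eigenvalues \<open>c\<close> and \<open>c'\<close> were obtained
    independently; conjugating \<open><T x_n, x_n>\<close> identifies \<open>c'\<close> with the
    conjugate of \<open>c\<close>.\<close>
  have "(\<lambda>n. cinner H (op_adj H H T (x n)) (x n)) \<longlonglongrightarrow> cnj c"
  proof -
    have "cinner H (op_adj H H T (x n)) (x n) = cnj (cinner H (T (x n)) (x n))" for n
      using x T cinner_commute[of "T (x n)" "x n"] by (simp add: HH.cinner_op_adj_left)
    then show ?thesis using tendsto_cnj[OF aev_cinner[OF T c]] by simp
  qed
  then have "c' = cnj c" using aev_cinner[OF HH.op_adj_in[OF T] c'] LIMSEQ_unique by blast
  then show "T \<in> aev_alg" using T c c' by (auto simp: aev_alg_def)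
qed

text \<open>\<open>\<chi> T = lim <T x_n, x_n>\<close> returns the asymptotic eigenvalue and is
  therefore multiplicative on \<open>aev_alg\<close>. This algebra contains the generated one
  because it is a C*-algebra containing the tuple.\<close>

lemma aev_joint_spectrum:
  assumes N: "normal_tuple H N" and f: "\<And>i. i < length N \<Longrightarrow> aev x (N ! i) (f i)"
  shows "vec (length N) f \<in> joint_spectrum H N"
proof -
  define \<chi> where "\<chi> T = lim (\<lambda>n. cinner H (T (x n)) (x n))" for T
  have NB: "S \<in> bounded_ops H H" "normal_op H S" if "S \<in> set N" for S
    using N that by (auto simp: normal_tuple_def normal_op_def)
  have "set N \<subseteq> aev_alg"
  proof
    fix S assume "S \<in> set N"
    then obtain i where i: "i < length N" "S = N ! i" by (metis in_set_conv_nth)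
    then show "S \<in> aev_alg"
      using f[OF i(1)] NB[OF \<open>S \<in> set N\<close>] aev_adj[of S "f i"] unfolding aev_alg_def by blast
  qed
  then have sub: "cstar_generated H (set N) \<subseteq> aev_alg"
    using aev_alg_cstar by (auto simp: cstar_generated_def)
  have B: "T \<in> bounded_ops H H" if "T \<in> aev_alg" for T using that by (simp add: aev_alg_def)
  have eqI: "\<chi> T = c" if "T \<in> bounded_ops H H" "aev x T c" for T c
    unfolding \<chi>_def by (rule limI[OF aev_cinner[OF that]])
  have ae: "aev x T (\<chi> T)" if "T \<in> aev_alg" for T
    using that eqI by (auto simp: aev_alg_def)
  have "character H (cstar_generated H (set N)) \<chi>"
    unfolding character_def linear_functional_def
  proof (intro conjI ballI allI)
    fix S T assume "S \<in> cstar_generated H (set N)" "T \<in> cstar_generated H (set N)"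
    then have S: "S \<in> aev_alg" and T: "T \<in> aev_alg" using sub by auto
    show "\<chi> (op_add H S T) = \<chi> S + \<chi> T"
      by (rule eqI[OF op_add_in[OF B[OF S] B[OF T]] aev_add[OF B[OF S] B[OF T] ae[OF S] ae[OF T]]])
    show "\<chi> (op_comp H S T) = \<chi> S * \<chi> T"
      by (rule eqI[OF op_comp_in[OF B[OF S] B[OF T]] aev_comp[OF B[OF S] B[OF T] ae[OF S] ae[OF T]]])
  next
    fix S c assume "S \<in> cstar_generated H (set N)"
    then have S: "S \<in> aev_alg" using sub by auto
    show "\<chi> (op_scale H c S) = c * \<chi> S"
      by (rule eqI[OF op_scale_in[OF B[OF S]] aev_scale[OF B[OF S] ae[OF S]]])
  next
    show "\<chi> (op_id H) = 1" by (rule eqI[OF op_id_in aev_id])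
  qed
  moreover have "vec (length N) f = vec (length N) (\<lambda>i. \<chi> (N ! i))"
    by (intro eq_vecI) (simp_all add: eqI[OF NB(1)[OF nth_mem] f])
  ultimately show ?thesis unfolding joint_spectrum_def by blast
qed

end

text \<open>The members of \<open>N\<close> are adjoined one by one to the prescribed pairs
  \<open>S\<close>. The outcome is a point of the joint spectrum at which the operators of
  \<open>S\<close> take their prescribed values, which transfers spectral bounds to them.\<close>

lemma ex_joint_spectrum:
  assumes N: "normal_tuple H N" and S: "approx_eigen S"
    and SB: "\<And>A \<mu>. (A, \<mu>) \<in> S \<Longrightarrow> A \<in> bounded_ops H H"
    and com: "\<And>A \<mu> T y. (A, \<mu>) \<in> S \<Longrightarrow> T \<in> set N \<Longrightarrow> y \<in> carrier H \<Longrightarrow> A (T y) = T (A y)"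
  shows "\<exists>x f. unit_seq x \<and> (\<forall>A \<mu>. (A, \<mu>) \<in> S \<longrightarrow> aev x A \<mu>) \<and>
     (\<forall>i<length N. aev x (N ! i) (f i)) \<and> vec (length N) f \<in> joint_spectrum H N"
proof -
  have NB: "T \<in> bounded_ops H H" "normal_op H T" if "T \<in> set N" for T
    using N that by (auto simp: normal_tuple_def normal_op_def)
  have Ncom: "A (T y) = T (A y)" if "A \<in> set N" "T \<in> set N" "y \<in> carrier H" for A T y
  proof -
    have "op_comp H A T = op_comp H T A" using N that by (simp add: normal_tuple_def)
    then show ?thesis using that(3) by (metis op_comp_app)
  qed
  have "\<exists>f. approx_eigen (S \<union> {(N ! i, f i) | i. i < m})" if "m \<le> length N" for m
    using that
  proof (induction m)
    case 0
    then show ?case using S by simp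
  next
    case (Suc m)
    then obtain f where f: "approx_eigen (S \<union> {(N ! i, f i) | i. i < m})" (is "approx_eigen ?S'") by auto
    have Nm: "N ! m \<in> set N" using Suc.prems by simp
    have "\<exists>\<mu>. approx_eigen (insert (N ! m, \<mu>) ?S')"
    proof (rule approx_eigen_extend[OF f NB(2)[OF Nm]])
      show "A \<in> bounded_ops H H" if "(A, \<mu>) \<in> ?S'" for A \<mu>
        using that SB NB(1) Suc.prems by auto
      show "A ((N ! m) y) = (N ! m) (A y)" if "(A, \<mu>) \<in> ?S'" "y \<in> carrier H" for A \<mu> y
        using that com[OF _ Nm] Ncom[OF _ Nm] Suc.prems by auto
    qed
    then obtain \<mu> where \<mu>: "approx_eigen (insert (N ! m, \<mu>) ?S')" ..
    have "S \<union> {(N ! i, (f(m := \<mu>)) i) | i. i < Suc m} \<subseteq> insert (N ! m, \<mu>) ?S'"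
      by (auto simp: less_Suc_eq)
    then show ?case using approx_eigen_mono[OF \<mu>] by blast
  qed
  from this[OF order_refl] obtain f where f: "approx_eigen (S \<union> {(N ! i, f i) | i. i < length N})" ..
  have "\<exists>x. unit_seq x \<and> (\<forall>A \<mu>. (A, \<mu>) \<in> S \<union> {(N ! i, f i) | i. i < length N} \<longrightarrow> aev x A \<mu>)"
    by (rule approx_eigen_seq[OF f]) (use SB NB in auto)
  then obtain x where x: "unit_seq x"
    and ae: "\<And>A \<mu>. (A, \<mu>) \<in> S \<union> {(N ! i, f i) | i. i < length N} \<Longrightarrow> aev x A \<mu>" by blast
  have i: "aev x (N ! i) (f i)" if "i < length N" for i using ae that by blast
  show ?thesis using x ae i aev_joint_spectrum[OF x N i] by blast
qed

text \<open>For a unit vector \<open>x\<close> and \<open>M\<close> the norm of \<open>T\<close>,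
  the squared norm of \<open>T^* T x - M^2 x\<close> is at most
  \<open>M^2 (M^2 - \<parallel>T x\<parallel>^2)\<close>. Vectors that nearly attain the norm are
  thus approximate eigenvectors.\<close>

lemma norm_approx_eigen:
  assumes T: "T \<in> bounded_ops H H" and pos: "0 < op_norm H H T"
  shows "approx_eigen {(op_comp H (op_adj H H T) T, complex_of_real ((op_norm H H T)\<^sup>2))}"
proof (rule approx_eigenI)
  define M where "M = op_norm H H T"
  have M: "0 < M" using pos by (simp add: M_def)
  have TM: "hnorm H (T y) \<le> M * hnorm H y" if "y \<in> carrier H" for y
    unfolding M_def by (rule HH.hnorm_le_op_norm[OF T that])
  fix e :: real assume e: "0 < e"
  \<comment> \<open>\<open>\<parallel>T x\<parallel>^2 > q\<close> brings the error below
    \<open>M^2 (M^2 - q) \<le> e^2\<close>; the maximum with 0 keeps the square root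
    meaningful.\<close>
  define q where "q = max 0 (M\<^sup>2 - e\<^sup>2 / M\<^sup>2)"
  have q: "0 \<le> q" "q < M\<^sup>2" "M\<^sup>2 - e\<^sup>2 / M\<^sup>2 \<le> q" using e M by (auto simp: q_def)
  have "sqrt q < M" using q M by (simp add: real_less_lsqrt)
  then have "\<exists>r\<in>{hnorm H (T x) |x. x \<in> carrier H \<and> hnorm H x \<le> 1}. sqrt q < r"
    unfolding M_def op_norm_def using zero_closed hnorm_zero
    by (intro less_cSupD) force+
  then obtain y where y: "y \<in> carrier H" "hnorm H y \<le> 1" "sqrt q < hnorm H (T y)" by blast
  have "0 < hnorm H (T y)" using y(3) q(1) real_sqrt_ge_zero[of q] by linarith
  then have yp: "0 < hnorm H y" using TM[OF y(1)] M y(1) by (smt (verit) hnorm_ge mult_nonneg_nonpos)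
  define x where "x = complex_of_real (inverse (hnorm H y)) \<odot> y"
  have x: "x \<in> carrier H" using y by (simp add: x_def)
  have x1: "hnorm H x = 1" using y yp by (simp add: x_def hnorm_smult norm_inverse)
  have "hnorm H (T y) = hnorm H y * hnorm H (T x)"
    using y yp T by (simp add: x_def bop_smult hnorm_smult norm_inverse)
  also have "\<dots> \<le> hnorm H (T x)" using y x T by (simp add: mult_left_le_one_le)
  finally have "sqrt q < hnorm H (T x)" using y(3) by simp
  then have big: "q < (hnorm H (T x))\<^sup>2" 
    using power_strict_mono[of "sqrt q" "hnorm H (T x)" 2] q(1) by simp
  let ?G = "op_comp H (op_adj H H T) T"
  have Gx: "?G x = op_adj H H T (T x)" "?G x \<in> carrier H" using x T by simp_all
  have "hnorm H (?G x) \<le> M * hnorm H (T x)"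
    using HH.hnorm_op_adj[OF T less_imp_le[OF M] TM] x T by (simp add: Gx(1))
  then have G2: "(hnorm H (?G x))\<^sup>2 \<le> M\<^sup>2 * (hnorm H (T x))\<^sup>2"
    using Gx(2) by (simp add: power_mono flip: power_mult_distrib)
  have "(hnorm H (?G x \<ominus> complex_of_real (M\<^sup>2) \<odot> x))\<^sup>2
      = (hnorm H (?G x))\<^sup>2 - 2 * (M\<^sup>2 * (hnorm H (T x))\<^sup>2) + (M\<^sup>2)\<^sup>2"
  proof -
    have "Re (cinner H (?G x) (complex_of_real (M\<^sup>2) \<odot> x)) = M\<^sup>2 * (hnorm H (T x))\<^sup>2"
      using x T by (simp add: HH.cinner_op_adj_left ip_simps hnorm_sq flip: of_real_power)
    moreover have "hnorm H (complex_of_real (M\<^sup>2) \<odot> x) = M\<^sup>2"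
      using x x1 by (simp add: hnorm_smult flip: of_real_power)
    ultimately show ?thesis
      using hnorm_diff_sq[OF Gx(2) smult_in[OF x, of "complex_of_real (M\<^sup>2)"]] by (simp only:)
  qed
  also have "\<dots> \<le> M\<^sup>2 * (M\<^sup>2 - (hnorm H (T x))\<^sup>2)"
    using G2 by (simp add: algebra_simps power2_eq_square)
  also have "\<dots> < M\<^sup>2 * (e\<^sup>2 / M\<^sup>2)"
    using big q(3) M by (intro mult_strict_left_mono) simp_all
  also have "\<dots> = e\<^sup>2" using M by simp
  finally have "hnorm H (?G x \<ominus> complex_of_real (M\<^sup>2) \<odot> x) < e"
    by (rule power2_less_imp_less) (use e in simp)
  then show "\<exists>x\<in>carrier H. hnorm H x = 1 \<and>
      (\<forall>A \<mu>. (A, \<mu>) \<in> {(?G, complex_of_real ((op_norm H H T)\<^sup>2))} \<longrightarrow> hnorm H (A x \<ominus> \<mu> \<odot> x) < e)"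
    using x x1 by (auto simp: M_def[symmetric])
qed

text \<open>If \<open>h = T - T^*\<close> were nonzero, its squared norm would be an approximate
  eigenvalue of \<open>h^* h\<close>. Adjoining \<open>T\<close> with a value \<open>\<mu>\<close>
  gives \<open>\<parallel>h\<parallel>^2 = - (\<mu> - cnj \<mu>)^2\<close>, so \<open>\<mu>\<close>
  is not real, and extending it to the whole tuple yields a non-real point of the joint
  spectrum.\<close>

lemma real_spectrum_self_adjoint:
  assumes N: "normal_tuple H N" and T: "T \<in> set N"
    and real: "\<And>v i. v \<in> joint_spectrum H N \<Longrightarrow> i < length N \<Longrightarrow> Im (v $ i) = 0"
  shows "op_adj H H T = T"
proof (rule ccontr)
  assume ne: "op_adj H H T \<noteq> T"
  have Tn: "normal_op H T" and TB: "T \<in> bounded_ops H H"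
    using N T by (auto simp: normal_tuple_def normal_op_def)
  define h where "h = op_add H T (op_scale H (- 1) (op_adj H H T))"
  have hB: "h \<in> bounded_ops H H" using TB by (simp add: h_def)
  have happ: "h y = T y \<ominus> op_adj H H T y" if "y \<in> carrier H" for y
    using that TB by (intro inner_ext) (simp_all add: h_def ip_simps)
  have hadj: "op_adj H H h = op_scale H (- 1) h"
    using TB hB by (intro HH.op_adj_eqI) (simp_all add: happ ip_simps adj_simps)
  have hT: "h (T y) = T (h y)" if "y \<in> carrier H" for y
    using that TB by (simp add: happ HH.bop_diff normal_op_app[OF Tn])
  have "op_norm H H h \<noteq> 0"
  proof
    assume z: "op_norm H H h = 0"
    have "op_adj H H T = T"
    proof (rule bop_eqI[OF HH.op_adj_in[OF TB] TB])
      fix y assume y: "y \<in> carrier H"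
      have hy: "h y \<in> carrier H" using hB y by simp
      have "hnorm H (h y) = 0" using HH.hnorm_le_op_norm[OF hB y] hnorm_ge[OF hy] by (simp add: z)
      then have "h y = \<zero>" using hy by (simp add: hnorm_eq_0)
      then have "(T y \<ominus> op_adj H H T y) \<oplus> op_adj H H T y = \<zero> \<oplus> op_adj H H T y" using happ[OF y] by simp
      then show "op_adj H H T y = T y" using y TB by (simp add: diff_add_cancel_carrier)
    qed
    then show False using ne by simp
  qed
  then have pos: "0 < op_norm H H h" using HH.op_norm_ge[OF hB] by simp
  let ?g = "op_comp H (op_adj H H h) h"
  have "\<exists>\<mu>. approx_eigen (insert (T, \<mu>) {(?g, complex_of_real ((op_norm H H h)\<^sup>2))})"
  proof (rule approx_eigen_extend[OF norm_approx_eigen[OF hB pos] Tn])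
    show "A (T y) = T (A y)" if A: "(A, \<mu>) \<in> {(?g, complex_of_real ((op_norm H H h)\<^sup>2))}" and y: "y \<in> carrier H" for A \<mu> y
    proof -
      have "A = ?g" using A by simp
      then show ?thesis using y TB hB by (simp add: hadj hT bop_smult[OF TB])
    qed
  qed (use hB in auto)
  then obtain \<mu> where \<mu>: "approx_eigen (insert (T, \<mu>) {(?g, complex_of_real ((op_norm H H h)\<^sup>2))})" ..
  have "\<exists>x. unit_seq x \<and> (\<forall>A \<nu>. (A, \<nu>) \<in> insert (T, \<mu>) {(?g, complex_of_real ((op_norm H H h)\<^sup>2))} \<longrightarrow> aev x A \<nu>)"
    by (rule approx_eigen_seq[OF \<mu>]) (use TB hB in auto)
  then obtain x where x: "unit_seq x" and xT: "aev x T \<mu>"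
    and xg: "aev x ?g (complex_of_real ((op_norm H H h)\<^sup>2))" by blast
  have xh: "aev x h (\<mu> + (- 1) * cnj \<mu>)"
    unfolding h_def by (intro aev_add[OF x] aev_scale[OF x] aev_adj[OF x Tn] xT) (simp_all add: TB)
  have "aev x ?g ((- 1 * (\<mu> + (- 1) * cnj \<mu>)) * (\<mu> + (- 1) * cnj \<mu>))"
    unfolding hadj by (intro aev_comp[OF x] aev_scale[OF x] xh) (simp_all add: hB)
  from aev_unique[OF x _ this xg] have "\<mu> \<noteq> cnj \<mu>" using hB pos by auto
  then have im: "Im \<mu> \<noteq> 0" by (simp add: complex_eq_iff)
  have "approx_eigen {(T, \<mu>)}" by (rule approx_eigen_mono[OF \<mu>]) simp
  moreover have "A (S y) = S (A y)" if "(A, \<nu>) \<in> {(T, \<mu>)}" "S \<in> set N" "y \<in> carrier H" for A \<nu> S y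
  proof -
    have "op_comp H T S = op_comp H S T" using N T that by (simp add: normal_tuple_def)
    then show ?thesis using that by (metis op_comp_app prod.inject singletonD)
  qed
  ultimately obtain x f where x: "unit_seq x" and xT: "aev x T \<mu>"
    and xN: "\<And>i. i < length N \<Longrightarrow> aev x (N ! i) (f i)" and v: "vec (length N) f \<in> joint_spectrum H N"
    using ex_joint_spectrum[OF N, of "{(T, \<mu>)}"] TB by blast
  obtain i where i: "i < length N" "T = N ! i" using T by (metis in_set_conv_nth)
  have "f i = \<mu>" using aev_unique[OF x TB xT] xN[OF i(1)] i(2) by simp
  then show False using real[OF v i(1)] i(1) im by simp
qed

text \<open>The operator \<open>a = S^2 + T^2\<close> is self-adjoint and commutes with the tuple,
  so the square of its norm is the value of \<open>a^2\<close> at some point of the joint spectrum.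
  There \<open>a\<close> has modulus at most 1, and the left-hand side is
  \<open><a y, y>\<close>.\<close>

lemma spectrum_disk_bound:
  assumes N: "normal_tuple H N" and ij: "S \<in> set N" "T \<in> set N"
    and sa: "\<And>R. R \<in> set N \<Longrightarrow> op_adj H H R = R"
    and disk: "\<And>v. v \<in> joint_spectrum H N \<Longrightarrow> \<exists>i<length N. \<exists>j<length N. N ! i = S \<and> N ! j = T \<and>
       cmod ((v $ i)\<^sup>2 + (v $ j)\<^sup>2) \<le> 1"
    and y: "y \<in> carrier H"
  shows "(hnorm H (S y))\<^sup>2 + (hnorm H (T y))\<^sup>2 \<le> (hnorm H y)\<^sup>2"
proof -
  have NB: "R \<in> bounded_ops H H" if "R \<in> set N" for R
    using N that by (auto simp: normal_tuple_def normal_op_def)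
  note SB = NB[OF ij(1)] and TB = NB[OF ij(2)]
  have Ncom: "A (R z) = R (A z)" if "A \<in> set N" "R \<in> set N" "z \<in> carrier H" for A R z
  proof -
    have "op_comp H A R = op_comp H R A" using N that by (simp add: normal_tuple_def)
    then show ?thesis using that(3) by (metis op_comp_app)
  qed
  define a where "a = op_add H (op_comp H S S) (op_comp H T T)"
  have aB: "a \<in> bounded_ops H H" using SB TB by (simp add: a_def)
  have aadj: "op_adj H H a = a"
    using SB TB by (simp add: a_def op_adj_add op_adj_comp sa[OF ij(1)] sa[OF ij(2)])
  have acom: "a (R z) = R (a z)" if "R \<in> set N" "z \<in> carrier H" for R z
    using that NB[OF that(1)] SB TB Ncom[OF ij(1) that(1)] Ncom[OF ij(2) that(1)] by (simp add: a_def bop_add)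
  have "op_norm H H a \<le> 1"
  proof (cases "0 < op_norm H H a")
    case pos: True
    let ?g = "op_comp H a a"
    have ap: "approx_eigen {(?g, complex_of_real ((op_norm H H a)\<^sup>2))}"
      using norm_approx_eigen[OF aB pos] by (simp only: aadj)
    have gB: "?g \<in> bounded_ops H H" using aB by simp
    have gcom: "?g (R z) = R (?g z)" if "R \<in> set N" "z \<in> carrier H" for R z
      using that aB NB[OF that(1)] by (simp add: acom)
    obtain x f where x: "unit_seq x" and xg: "aev x ?g (complex_of_real ((op_norm H H a)\<^sup>2))"
      and xN: "\<And>i. i < length N \<Longrightarrow> aev x (N ! i) (f i)" and v: "vec (length N) f \<in> joint_spectrum H N"
      using ex_joint_spectrum[OF N ap] gB gcom by auto
    from disk[OF v] obtain i j where i: "i < length N" "N ! i = S" and j: "j < length N" "N ! j = T"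
      and le: "cmod ((f i)\<^sup>2 + (f j)\<^sup>2) \<le> 1" by auto
    have xa: "aev x a ((f i)\<^sup>2 + (f j)\<^sup>2)"
      unfolding a_def power2_eq_square using xN[OF i(1)] xN[OF j(1)] i j SB TB
      by (intro aev_add[OF x] aev_comp[OF x]) simp_all
    have "((f i)\<^sup>2 + (f j)\<^sup>2) * ((f i)\<^sup>2 + (f j)\<^sup>2) = complex_of_real ((op_norm H H a)\<^sup>2)"
      by (rule aev_unique[OF x gB aev_comp[OF x aB aB xa xa] xg])
    then have "cmod ((f i)\<^sup>2 + (f j)\<^sup>2) * cmod ((f i)\<^sup>2 + (f j)\<^sup>2) = (op_norm H H a)\<^sup>2"
      by (metis norm_mult norm_of_real abs_power2)
    then have "(op_norm H H a)\<^sup>2 \<le> 1" using mult_le_one[OF le norm_ge_zero le] by simp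
    then show ?thesis using pos by (simp add: abs_square_le_1)
  qed simp
  then have "hnorm H (a y) \<le> hnorm H y"
    using HH.hnorm_le_op_norm[OF aB y] mult_right_mono[of "op_norm H H a" 1 "hnorm H y"] y by simp
  moreover have "(hnorm H (S y))\<^sup>2 + (hnorm H (T y))\<^sup>2 = Re (cinner H (a y) y)"
    using y SB TB HH.cinner_op_adj[OF SB, of "S y" y] HH.cinner_op_adj[OF TB, of "T y" y]
    by (simp add: a_def hnorm_sq ip_simps sa[OF ij(1)] sa[OF ij(2)])
  moreover have "Re (cinner H (a y) y) \<le> hnorm H (a y) * hnorm H y"
    using y aB by (intro order_trans[OF complex_Re_le_cmod cauchy_schwarz]) simp_all
  ultimately show ?thesis
    using mult_right_mono[of "hnorm H (a y)" "hnorm H y" "hnorm H y"] y by (simp add: power2_eq_square)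
qed

end

section \<open>Optimality\<close>

context hilbert_space
begin

lemma cinner_finsum_left:
  assumes "finite A" "\<And>a. a \<in> A \<Longrightarrow> f a \<in> carrier H" "z \<in> carrier H"
  shows "cinner H (finsum H f A) z = (\<Sum>a\<in>A. cinner H (f a) z)"
  using assms
proof (induction A rule: finite_induct)
  case (insert a A)
  then have "finsum H f (insert a A) = f a \<oplus> finsum H f A" "finsum H f A \<in> carrier H"
    by (auto intro!: finsum_insert finsum_closed)
  then show ?case using insert by (simp add: cinner_add_left)
qed (simp add: cinner_zero_left)

lemma finsum_in: "(\<And>a. a \<in> A \<Longrightarrow> f a \<in> carrier H) \<Longrightarrow> finsum H f A \<in> carrier H"
  by (rule finsum_closed) auto

lemma cinner_finsum_right:
  assumes "finite A" "\<And>a. a \<in> A \<Longrightarrow> f a \<in> carrier H" "z \<in> carrier H"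
  shows "cinner H z (finsum H f A) = (\<Sum>a\<in>A. cinner H z (f a))"
proof -
  have "cinner H z (finsum H f A) = cnj (cinner H (finsum H f A) z)"
    using assms finsum_in by (intro cinner_commute) auto
  also have "\<dots> = (\<Sum>a\<in>A. cnj (cinner H (f a) z))"
    using assms by (simp add: cinner_finsum_left)
  also have "\<dots> = (\<Sum>a\<in>A. cinner H z (f a))"
    using assms by (intro sum.cong refl) (simp add: cinner_commute[of _ z])
  finally show ?thesis .
qed

text \<open>Applied to the positive element \<open>(1 - a S - b T)\<^sup>2\<close>, where \<open>a\<close> and \<open>b\<close> are the
  values of the state at \<open>S\<close> and \<open>T\<close>.\<close>

lemma state_anticommuting:
  assumes \<A>: "unital_cstar_subalgebra H \<A>" and \<phi>: "state H \<A> \<phi>" and ST: "S \<in> \<A>" "T \<in> \<A>"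
    and S: "\<And>x y. x \<in> carrier H \<Longrightarrow> y \<in> carrier H \<Longrightarrow> cinner H (S x) y = cinner H x (S y)"
    and T: "\<And>x y. x \<in> carrier H \<Longrightarrow> y \<in> carrier H \<Longrightarrow> cinner H (T x) y = cinner H x (T y)"
    and SS: "\<And>x y. x \<in> carrier H \<Longrightarrow> y \<in> carrier H \<Longrightarrow> cinner H (S x) (S y) = cinner H x y"
    and TT: "\<And>x y. x \<in> carrier H \<Longrightarrow> y \<in> carrier H \<Longrightarrow> cinner H (T x) (T y) = cinner H x y"
    and anti: "\<And>x y. x \<in> carrier H \<Longrightarrow> y \<in> carrier H \<Longrightarrow> cinner H (S x) (T y) + cinner H (T x) (S y) = 0"
  shows "Im (\<phi> S) = 0" "(Re (\<phi> S))\<^sup>2 + (Re (\<phi> T))\<^sup>2 \<le> 1"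
proof -
  have SB: "S \<in> bounded_ops H H" and TB: "T \<in> bounded_ops H H" using cstar_sub[OF \<A>] ST by blast+
  have pos: "\<phi> (op_comp H (op_adj H H R) R) \<in> \<real>" "0 \<le> Re (\<phi> (op_comp H (op_adj H H R) R))" if "R \<in> \<A>" for R
    using \<phi> that by (auto simp: state_def)
  have add: "\<phi> (op_add H R Q) = \<phi> R + \<phi> Q" if "R \<in> \<A>" "Q \<in> \<A>" for R Q
    using \<phi> that by (simp add: state_def linear_functional_def)
  have scale: "\<phi> (op_scale H c R) = c * \<phi> R" if "R \<in> \<A>" for R c
    using \<phi> that by (simp add: state_def linear_functional_def)
  have one: "\<phi> (op_id H) = 1" using \<phi> by (simp add: state_def)
  note cl = cstar_id[OF \<A>] cstar_add[OF \<A>] cstar_scale[OF \<A>]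
  have key: "\<phi> (op_comp H (op_adj H H R) R) = (1 + a\<^sup>2 + b\<^sup>2) - 2 * (complex_of_real a * \<phi> S + complex_of_real b * \<phi> T)"
      and R: "R \<in> \<A>"
    if R_def: "R = op_add H (op_id H) (op_scale H (- 1) (op_add H (op_scale H a S) (op_scale H b T)))"
    for R and a b :: real
  proof -
    show R: "R \<in> \<A>" unfolding R_def by (intro cl ST)
    have RB: "R \<in> bounded_ops H H" by (rule cstar_sub[OF \<A> R])
    let ?Q = "op_add H (op_scale H (1 + a\<^sup>2 + b\<^sup>2) (op_id H))
        (op_scale H (- 2) (op_add H (op_scale H a S) (op_scale H b T)))"
    have "op_comp H (op_adj H H R) R = ?Q"
    proof (rule bop_eqI[of _ H H])
      fix x assume x: "x \<in> carrier H"
      have "cinner H (op_adj H H R (R x)) y = cinner H (?Q x) y" if y: "y \<in> carrier H" for y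
      proof -
        \<comment> \<open>Anticommutation removes the mixed terms of the square. As
          \<open>S^2 = T^2 = 1\<close>, what is left is affine in \<open>S\<close> and
          \<open>T\<close>, and the state can be evaluated on it.\<close>
        have a: "cinner H (S x) (T y) = - cinner H (T x) (S y)"
          using anti[OF x y] by (simp add: eq_neg_iff_add_eq_0)
        have "cinner H (op_adj H H R (R x)) y = cinner H (R x) (R y)"
          using x y RB by (simp add: HH.cinner_op_adj_left)
        also have "\<dots> = cinner H (?Q x) y"
          unfolding R_def using x y SB TB
          by (simp add: ip_simps S[OF x y, symmetric] T[OF x y, symmetric] SS[OF x y] TT[OF x y] a
              power2_eq_square algebra_simps)
        finally show ?thesis .
      qed
      then show "op_comp H (op_adj H H R) R x = ?Q x"
        using x RB SB TB by (intro inner_ext) simp_all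
    qed (use RB SB TB in simp_all)
    then show "\<phi> (op_comp H (op_adj H H R) R) = (1 + a\<^sup>2 + b\<^sup>2) - 2 * (complex_of_real a * \<phi> S + complex_of_real b * \<phi> T)"
      using ST cl by (simp add: add scale one)
  qed
  have im: "Im (complex_of_real a * \<phi> S + complex_of_real b * \<phi> T) = 0"
    and re: "2 * (a * Re (\<phi> S) + b * Re (\<phi> T)) \<le> 1 + a\<^sup>2 + b\<^sup>2" for a b :: real
    using pos[OF R[OF refl, of a b]] unfolding key[OF refl]
    by (auto simp: complex_is_Real_iff simp flip: of_real_power)
  show "Im (\<phi> S) = 0" using im[of 1 0] by simp
  show "(Re (\<phi> S))\<^sup>2 + (Re (\<phi> T))\<^sup>2 \<le> 1"
    using re[of "Re (\<phi> S)" "Re (\<phi> T)"] by (simp add: power2_eq_square)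
qed

end

text \<open>Hermitian generators of a Clifford algebra; the case \<open>i = j\<close> says that the
  square of \<open>F i\<close> is 1, which makes it unitary.\<close>

definition anticommuting_unitaries :: "nat \<Rightarrow> nat \<Rightarrow> (nat \<Rightarrow> complex mat) \<Rightarrow> bool" where
  "anticommuting_unitaries m n F \<longleftrightarrow>
     (\<forall>i<m. F i \<in> carrier_mat n n \<and> (\<forall>r<n. \<forall>c<n. F i $$ (r, c) = cnj (F i $$ (c, r)))) \<and>
     (\<forall>i<m. \<forall>j<m. F i * F j + F j * F i = (if i = j then 2 else 0) \<cdot>\<^sub>m 1\<^sub>m n)"

text \<open>The size is doubled: the old matrices are tensored with the Pauli matrix
  \<open>diag (1, -1)\<close>, and the swap of the two blocks is the new generator.\<close>

lemma ex_anticommuting_unitaries: "\<exists>n\<ge>1. \<exists>F. anticommuting_unitaries m n F"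
proof (induction m)
  case 0
  show ?case by (intro exI[of _ 1]) (simp add: anticommuting_unitaries_def)
next
  case (Suc m)
  then obtain n F where n: "1 \<le> n" and aF: "anticommuting_unitaries m n F" by blast
  have F: "F i \<in> carrier_mat n n" and Fh: "r < n \<Longrightarrow> c < n \<Longrightarrow> F i $$ (r, c) = cnj (F i $$ (c, r))" if "i < m" for i r c
    using aF that unfolding anticommuting_unitaries_def by blast+
  have FF: "F i * F j + F j * F i = (if i = j then 2 else 0) \<cdot>\<^sub>m 1\<^sub>m n" if "i < m" "j < m" for i j
    using aF that by (simp add: anticommuting_unitaries_def)
  let ?Z = "0\<^sub>m n n :: complex mat"
  define X where "X = four_block_mat ?Z (1\<^sub>m n) (1\<^sub>m n) ?Z"
  define E where "E i = four_block_mat (F i) ?Z ?Z (- F i)" for i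
  have mz: "- ?Z = ?Z" by (intro eq_matI) auto
  have XX: "X * X + X * X = 2 \<cdot>\<^sub>m 1\<^sub>m (n + n)"
  proof -
    have "X * X = four_block_mat (1\<^sub>m n) ?Z ?Z (1\<^sub>m n)"
      unfolding X_def by (subst mult_four_block_mat[of _ n n _ n _ n _ _ n _ n]) (simp_all add: mz)
    then show ?thesis by (intro eq_matI) auto
  qed
  have EX: "E i * X + X * E i = 0 \<cdot>\<^sub>m 1\<^sub>m (n + n)" if i: "i < m" for i
  proof -
    have "E i * X = four_block_mat ?Z (F i) (- F i) ?Z"
      unfolding X_def E_def using F[OF i] by (subst mult_four_block_mat[of _ n n _ n _ n _ _ n _ n]) (simp_all add: mz)
    moreover have "X * E i = four_block_mat ?Z (- F i) (F i) ?Z"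
      unfolding X_def E_def using F[OF i] by (subst mult_four_block_mat[of _ n n _ n _ n _ _ n _ n]) (simp_all add: mz)
    ultimately show ?thesis using F[OF i] by (intro eq_matI) auto
  qed
  have EE: "E i * E j + E j * E i = (if i = j then 2 else 0) \<cdot>\<^sub>m 1\<^sub>m (n + n)" if i: "i < m" and j: "j < m" for i j
  proof -
    have p: "E i * E j = four_block_mat (F i * F j) ?Z ?Z (F i * F j)" if i: "i < m" and j: "j < m" for i j
      unfolding E_def using F[OF i] F[OF j] by (subst mult_four_block_mat[of _ n n _ n _ n _ _ n _ n]) (simp_all add: mz)
    have "E i * E j + E j * E i = four_block_mat (F i * F j + F j * F i) ?Z ?Z (F i * F j + F j * F i)"
      unfolding p[OF i j] p[OF j i] using F[OF i] F[OF j] by (intro eq_matI) auto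
    then show ?thesis unfolding FF[OF i j] by (intro eq_matI) auto
  qed
  have Ec: "E i \<in> carrier_mat (n + n) (n + n)" if "i < m" for i
    using F[OF that] by (simp add: E_def)
  have Xc: "X \<in> carrier_mat (n + n) (n + n)" by (simp add: X_def)
  have Eh: "E i $$ (r, c) = cnj (E i $$ (c, r))" if i: "i < m" and r: "r < n + n" and c: "c < n + n" for i r c
    using F[OF i] r c Fh[OF i, of r c] Fh[OF i, of "r - n" "c - n"]
    by (cases "r < n"; cases "c < n") (simp_all add: E_def)
  have Xh: "X $$ (r, c) = cnj (X $$ (c, r))" if "r < n + n" "c < n + n" for r c
    using that by (cases "r < n"; cases "c < n") (auto simp: X_def)
  define G where "G i = (if i < m then E i else X)" for i
  have "anticommuting_unitaries (Suc m) (n + n) G"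
    unfolding anticommuting_unitaries_def
  proof (intro conjI allI impI)
    fix i assume i: "i < Suc m"
    show "G i \<in> carrier_mat (n + n) (n + n)" using Ec Xc by (simp add: G_def)
    fix r c assume "r < n + n" "c < n + n"
    then show "G i $$ (r, c) = cnj (G i $$ (c, r))"
      using Eh[of i r c] Xh[of r c] by (cases "i < m") (simp_all only: G_def if_True if_False)
  next
    fix i j assume i: "i < Suc m" and j: "j < Suc m"
    consider "i < m" "j < m" | "i < m" "j = m" | "i = m" "j < m" | "i = m" "j = m"
      using i j by linarith
    then show "G i * G j + G j * G i = (if i = j then 2 else 0) \<cdot>\<^sub>m 1\<^sub>m (n + n)"
    proof cases
      case 1
      then show ?thesis using EE[of i j] by (simp add: G_def)
    next
      case 2
      then show ?thesis using EX[of i] by (simp add: G_def)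
    next
      case 3
      then have "G i * G j + G j * G i = E j * X + X * E j"
        using comm_add_mat[of "X * E j" "n + n" "n + n" "E j * X"] Ec[of j] Xc by (simp add: G_def)
      then show ?thesis using EX[of j] 3 by simp
    next
      case 4
      then show ?thesis using XX by (simp add: G_def)
    qed
  qed
  then show ?case using n by (intro exI[of _ "n + n"] conjI) auto
qed

text \<open>A state sends any two distinct generators to a point of the real unit disk, by
  \<open>state_anticommuting\<close>; the pairs \<open>2 j\<close>, \<open>2 j + 1\<close> give the
  coordinates of the polydisk.\<close>

lemma anticommuting_in_W_max:
  assumes F: "anticommuting_unitaries (2 * d) n F"
  shows "map F [0..<2 * d] \<in> W_max_level (2 * d) n (closed_polydisk d)"
proof -
  interpret Cn: hilbert_space "Cn n" by (rule Cn_hilbert)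
  have FM: "F i \<in> carrier_mat n n" and Fh: "\<And>r c. r < n \<Longrightarrow> c < n \<Longrightarrow> F i $$ (r, c) = cnj (F i $$ (c, r))" if "i < 2 * d" for i
    using F that unfolding anticommuting_unitaries_def by blast+
  have FF: "F i * F j + F j * F i = (if i = j then 2 else 0) \<cdot>\<^sub>m 1\<^sub>m n" if "i < 2 * d" "j < 2 * d" for i j
    using F that by (simp add: anticommuting_unitaries_def)
  have adj: "mat_adjoint (F i) = F i" if "i < 2 * d" for i
  proof (rule eq_matI)
    show "mat_adjoint (F i) $$ (r, c) = F i $$ (r, c)" if "r < dim_row (F i)" "c < dim_col (F i)" for r c
      using that FM[OF \<open>i < 2 * d\<close>] Fh[OF \<open>i < 2 * d\<close>, of r c] mat_adjoint_index[OF FM[OF \<open>i < 2 * d\<close>], of r c] by simp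
  qed (use FM[OF that] in \<open>auto simp: mat_adjoint_def\<close>)
  let ?f = "\<lambda>i. mat_op n (F i)"
  let ?A = "cstar_generated (Cn n) (set (map (mat_op n) (map F [0..<2 * d])))"
  have fB: "?f i \<in> bounded_ops (Cn n) (Cn n)" if "i < 2 * d" for i by (rule mat_op_in[OF FM[OF that]])
  have A: "unital_cstar_subalgebra (Cn n) ?A"
    by (rule Cn.cstar_generated_cstar) (use fB in auto)
  have fA: "?f i \<in> ?A" if "i < 2 * d" for i
    using that Cn.cstar_generated_incl[of "set (map (mat_op n) (map F [0..<2 * d]))"] by auto
  have sa: "cinner (Cn n) (?f i x) y = cinner (Cn n) x (?f i y)"
    if "i < 2 * d" "x \<in> carrier (Cn n)" "y \<in> carrier (Cn n)" for i x y
    using that mat_sa_cinner[OF FM[OF that(1)] adj[OF that(1)], of x y] by simp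
  have anti: "cinner (Cn n) (?f i x) (?f j y) + cinner (Cn n) (?f j x) (?f i y) = (if i = j then 2 else 0) * cinner (Cn n) x y"
    if i: "i < 2 * d" and j: "j < 2 * d" and x: "x \<in> carrier (Cn n)" and y: "y \<in> carrier (Cn n)" for i j x y
  proof -
    have c: "F i *\<^sub>v x \<in> carrier_vec n" "F j *\<^sub>v x \<in> carrier_vec n" using FM[OF i] FM[OF j] x by auto
    have "F j *\<^sub>v (F i *\<^sub>v x) + F i *\<^sub>v (F j *\<^sub>v x) = (F i * F j + F j * F i) *\<^sub>v x"
      using FM[OF i] FM[OF j] x by (simp add: add_mult_distrib_mat_vec[of _ n n] comm_add_vec[of _ n])
    also have "\<dots> = (if i = j then 2 else 0) \<cdot>\<^sub>v x"
      unfolding FF[OF i j] using x by (intro eq_vecI) auto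
    finally have e: "F j *\<^sub>v (F i *\<^sub>v x) + F i *\<^sub>v (F j *\<^sub>v x) = (if i = j then 2 else 0) \<cdot>\<^sub>v x" .
    have "cinner (Cn n) (?f i x) (?f j y) + cinner (Cn n) (?f j x) (?f i y)
        = cinner (Cn n) (?f j (?f i x)) y + cinner (Cn n) (?f i (?f j x)) y"
      using sa[OF j, of "?f i x" y] sa[OF i, of "?f j x" y] x y c by simp
    also have "\<dots> = cinner (Cn n) (F j *\<^sub>v (F i *\<^sub>v x) \<oplus>\<^bsub>Cn n\<^esub> F i *\<^sub>v (F j *\<^sub>v x)) y"
      using x y c FM[OF i] FM[OF j] by (subst Cn.cinner_add_left) (simp_all del: Cn_simps(5))
    also have "\<dots> = cinner (Cn n) ((if i = j then 2 else 0) \<odot>\<^bsub>Cn n\<^esub> x) y" by (simp only: Cn_simps e)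
    also have "\<dots> = (if i = j then 2 else 0) * cinner (Cn n) x y" by (rule Cn.cinner_smult_left[OF x y])
    finally show ?thesis .
  qed
  have "W1 (Cn n) (map (mat_op n) (map F [0..<2 * d])) \<subseteq> map_vec complex_of_real ` closed_polydisk d"
  proof
    fix v assume "v \<in> W1 (Cn n) (map (mat_op n) (map F [0..<2 * d]))"
    then obtain \<phi> where \<phi>: "state (Cn n) ?A \<phi>" and "v = vec (length (map (mat_op n) (map F [0..<2 * d])))
        (\<lambda>i. \<phi> (map (mat_op n) (map F [0..<2 * d]) ! i))"
      by (auto simp: W1_def)
    then have v: "v = vec (2 * d) (\<lambda>i. \<phi> (?f i))" by (auto intro!: eq_vecI)
    have un: "cinner (Cn n) (?f i x) (?f i y) = cinner (Cn n) x y"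
      if "i < 2 * d" "x \<in> carrier (Cn n)" "y \<in> carrier (Cn n)" for i x y
      using anti[OF that(1,1,2,3)] by simp
    have st: "Im (\<phi> (?f i)) = 0" "(Re (\<phi> (?f i)))\<^sup>2 + (Re (\<phi> (?f j)))\<^sup>2 \<le> 1" if i: "i < 2 * d" and j: "j < 2 * d" and ij: "i \<noteq> j" for i j
      by (rule Cn.state_anticommuting[OF A \<phi> fA[OF i] fA[OF j] sa[OF i] sa[OF j] un[OF i] un[OF j]];
          (assumption | simp only: anti[OF i j] ij if_False mult_zero_left))+
    \<comment> \<open>\<open>st\<close> speaks of a pair of distinct indices; as
      \<open>2 d \<ge> 2\<close>, either 0 or 1 serves as a partner of \<open>i\<close>.\<close>
    have "Im (\<phi> (?f i)) = 0" if "i < 2 * d" for i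
      using st(1)[OF that, of "if i = 0 then 1 else 0"] that by (cases "i = 0") auto
    moreover have "(Re (\<phi> (?f (2 * j))))\<^sup>2 + (Re (\<phi> (?f (2 * j + 1))))\<^sup>2 \<le> 1" if "j < d" for j
      using that by (intro st(2)) auto
    ultimately show "v \<in> map_vec complex_of_real ` closed_polydisk d"
      by (simp add: polydisk_iff v)
  qed
  then show ?thesis
    using FM adj by (auto simp: W_max_level_def sa_tuples_def)
qed

text \<open>Against a symmetric \<open>g\<close> only the symmetric part of \<open>A\<close> counts,
  and this part is \<open>c\<close> times the Kronecker delta.\<close>

lemma sum_anticommuting:
  fixes A g :: "nat \<Rightarrow> nat \<Rightarrow> complex"
  assumes "\<And>j l. j < m \<Longrightarrow> l < m \<Longrightarrow> A j l + A l j = (if j = l then 2 * c else 0)"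
    and "\<And>j l. j < m \<Longrightarrow> l < m \<Longrightarrow> g j l = g l j"
  shows "(\<Sum>j<m. \<Sum>l<m. A j l * g j l) = c * (\<Sum>j<m. g j j)"
proof -
  have "(\<Sum>j<m. \<Sum>l<m. A j l * g j l) = (\<Sum>j<m. \<Sum>l<m. A l j * g j l)"
    by (subst sum.swap, intro sum.cong refl) (simp add: assms(2))
  then have "2 * (\<Sum>j<m. \<Sum>l<m. A j l * g j l) = (\<Sum>j<m. \<Sum>l<m. (A j l + A l j) * g j l)"
    by (simp add: distrib_right sum.distrib)
  also have "\<dots> = (\<Sum>j<m. \<Sum>l<m. if j = l then 2 * c * g j l else 0)"
    using assms(1) by (intro sum.cong refl) auto
  also have "\<dots> = 2 * (c * (\<Sum>j<m. g j j))" by (simp add: sum_distrib_left mult.assoc)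
  finally show ?thesis by simp
qed

lemma sum_mult_delta:
  fixes f :: "nat \<Rightarrow> complex"
  assumes "l < n"
  shows "(\<Sum>i<n. f i * (if i = l then 1 else 0)) = f l"
proof -
  have "(\<Sum>i<n. f i * (if i = l then 1 else 0)) = (\<Sum>i<n. if i = l then f i else 0)"
    by (intro sum.cong refl) simp
  then show ?thesis using assms by simp
qed

text \<open>
  With \<open>\<xi> = \<Sum> e\<^sub>k \<otimes> e\<^sub>k\<close> the vectors \<open>\<eta> i\<close> are the coordinates of
  \<open>(\<Sum> N\<^sub>j \<otimes> cnj F\<^sub>j) (V \<otimes> 1) \<xi>\<close>. Its inner product with \<open>(V \<otimes> 1) \<xi>\<close> is
  \<open>2 d n / C\<close>, whereas its norm is at most \<open>\<surd>d\<close> times that of \<open>\<xi>\<close>, because the mixed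
  terms of \<open>(\<Sum> N\<^sub>j \<otimes> cnj F\<^sub>j)\<^sup>2\<close> cancel.
\<close>

theorem scale_ge_2_sqrt:
  assumes d: "d \<ge> 1" and C: "0 < C"
    and sub: "W_max (2 * d) (closed_polydisk d)
        \<subseteq> scale_tuples C (W_min TYPE('k) (2 * d) (closed_polydisk d))"
  shows "2 * sqrt (real d) \<le> C"
proof -
  obtain n F where n: "1 \<le> n" and F: "anticommuting_unitaries (2 * d) n F"
    using ex_anticommuting_unitaries by blast
  have FM: "F i \<in> carrier_mat n n" and Fh: "\<And>r c. r < n \<Longrightarrow> c < n \<Longrightarrow> F i $$ (r, c) = cnj (F i $$ (c, r))" if "i < 2 * d" for i
    using F that unfolding anticommuting_unitaries_def by blast+
  have FF: "F i * F j + F j * F i = (if i = j then 2 else 0) \<cdot>\<^sub>m 1\<^sub>m n" if "i < 2 * d" "j < 2 * d" for i j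
    using F that by (simp add: anticommuting_unitaries_def)
  have "map F [0..<2 * d] \<in> W_max (2 * d) (closed_polydisk d)"
    using n anticommuting_in_W_max[OF F] by (auto simp: W_max_def)
  then have "map F [0..<2 * d] \<in> scale_tuples C (W_min TYPE('k) (2 * d) (closed_polydisk d))"
    using sub by blast
  then obtain Y n' where Y: "Y \<in> W_min_level TYPE('k) (2 * d) n' (closed_polydisk d)"
    and FY: "map F [0..<2 * d] = map (\<lambda>A. complex_of_real C \<cdot>\<^sub>m A) Y"
    by (auto simp: scale_tuples_def W_min_def)
  have lenY: "length Y = 2 * d" and YM: "\<And>j. j < 2 * d \<Longrightarrow> Y ! j \<in> carrier_mat n' n'"
    using Y by (auto simp: W_min_level_def sa_tuples_def)
  have FYj: "F j = complex_of_real C \<cdot>\<^sub>m (Y ! j)" if "j < 2 * d" for j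
    using arg_cong[OF FY, of "\<lambda>l. l ! j"] that lenY by simp
  \<comment> \<open>The unions over all levels have lost the matrix size; it is recovered from the
    entry with index 0, which exists because \<open>d \<ge> 1\<close>.\<close>
  have "n' = n" using FYj[of 0] FM[of 0] YM[of 0] d by auto
  note Y = Y[unfolded this] and YM = YM[unfolded this]
  obtain L :: "'k cinner_space" and N where L: "hilbert_space L" and N: "normal_tuple L N"
    and dil: "dilation (Cn n) L (map (mat_op n) Y) N"
    and spec: "joint_spectrum L N \<subseteq> map_vec complex_of_real ` closed_polydisk d"
    using Y by (auto simp: W_min_level_def)
  interpret Cn: hilbert_space "Cn n" by (rule Cn_hilbert)
  interpret L: hilbert_space L by fact
  interpret CL: hilbert_pair "Cn n" L ..
  have lenN: "length N = 2 * d" using dil lenY by (simp add: dilation_def)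
  have NB: "N ! j \<in> bounded_ops L L" if "j < 2 * d" for j
    using N that lenN by (auto simp: normal_tuple_def normal_op_def)
  obtain V where V: "isometry (Cn n) L V"
    and dilV: "\<And>j x y. j < 2 * d \<Longrightarrow> x \<in> carrier (Cn n) \<Longrightarrow> y \<in> carrier (Cn n) \<Longrightarrow>
      cinner L ((N ! j) (V x)) (V y) = cinner (Cn n) ((map (mat_op n) Y ! j) x) y"
    using CL.dilationE[OF dil] NB lenY by auto
  have VB: "V \<in> bounded_ops (Cn n) L" using V by (simp add: isometry_def)
  have disk: "Im (v $ i) = 0" "(Re (v $ (2 * j)))\<^sup>2 + (Re (v $ (2 * j + 1)))\<^sup>2 \<le> 1"
    if "v \<in> joint_spectrum L N" "i < 2 * d" "j < d" for v i j
  proof -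
    have "v \<in> map_vec complex_of_real ` closed_polydisk d" using spec that(1) by blast
    then show "Im (v $ i) = 0" "(Re (v $ (2 * j)))\<^sup>2 + (Re (v $ (2 * j + 1)))\<^sup>2 \<le> 1"
      using that(2,3) unfolding polydisk_iff by blast+
  qed
  have sa: "op_adj L L T = T" if "T \<in> set N" for T
    by (rule L.real_spectrum_self_adjoint[OF N that]) (use disk(1)[of _ _ 0] lenN d in auto)
  have sa': "cinner L ((N ! j) x) y = cinner L x ((N ! j) y)" if "j < 2 * d" "x \<in> carrier L" "y \<in> carrier L" for j x y
    using L.HH.cinner_op_adj[OF NB[OF that(1)] that(2,3)] sa[of "N ! j"] that(1) lenN by simp
  have Ncom: "(N ! i) ((N ! j) x) = (N ! j) ((N ! i) x)" if "i < 2 * d" "j < 2 * d" "x \<in> carrier L" for i j x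
  proof -
    have "op_comp L (N ! i) (N ! j) = op_comp L (N ! j) (N ! i)" using N that lenN by (simp add: normal_tuple_def)
    then show ?thesis using that(3) by (metis op_comp_app)
  qed
  have pair: "(hnorm L ((N ! (2 * j)) y))\<^sup>2 + (hnorm L ((N ! (2 * j + 1)) y))\<^sup>2 \<le> (hnorm L y)\<^sup>2"
    if j: "j < d" and y: "y \<in> carrier L" for j y
  proof (rule L.spectrum_disk_bound[OF N _ _ sa _ y])
    show "N ! (2 * j) \<in> set N" "N ! (2 * j + 1) \<in> set N" using j lenN by simp_all
    fix v assume v: "v \<in> joint_spectrum L N"
    have re: "v $ i = complex_of_real (Re (v $ i))" if "i < 2 * d" for i
      using disk(1)[OF v that j] by (simp add: complex_eq_iff)
    have "v $ (2 * j) = complex_of_real (Re (v $ (2 * j)))" "v $ (2 * j + 1) = complex_of_real (Re (v $ (2 * j + 1)))"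
      using j by (intro re; simp)+
    then have "(v $ (2 * j))\<^sup>2 + (v $ (2 * j + 1))\<^sup>2
        = complex_of_real ((Re (v $ (2 * j)))\<^sup>2 + (Re (v $ (2 * j + 1)))\<^sup>2)"
      by (metis of_real_add of_real_power)
    then have "cmod ((v $ (2 * j))\<^sup>2 + (v $ (2 * j + 1))\<^sup>2) \<le> 1"
      using disk(2)[OF v _ j, of 0] j by (simp only: norm_of_real) (simp add: abs_le_iff)
    then show "\<exists>i<length N. \<exists>l<length N. N ! i = N ! (2 * j) \<and> N ! l = N ! (2 * j + 1) \<and>
       cmod ((v $ i)\<^sup>2 + (v $ l)\<^sup>2) \<le> 1"
      using j lenN by (intro exI[of _ "2 * j"] exI[of _ "2 * j + 1"] conjI) simp_all
  qed
  \<comment> \<open>The tensor product is kept in coordinates: an element of \<open>L\<close>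
    tensored with coordinate space is a family of \<open>n\<close> vectors in \<open>L\<close>, and
    the image of the maximally entangled vector is the family of the \<open>\<xi> i\<close>.\<close>
  define \<xi> where "\<xi> k = V (unit_vec n k)" for k
  have \<xi>: "\<xi> k \<in> carrier L" for k using CL.bop_in_pair[OF VB] by (simp add: \<xi>_def)
  have \<xi>1: "(hnorm L (\<xi> k))\<^sup>2 = 1" if "k < n" for k
  proof -
    have "hnorm L (\<xi> k) = hnorm (Cn n) (unit_vec n k)" using V by (simp add: isometry_def \<xi>_def)
    moreover have e: "(if i = k then 1 else 0) * cnj (if i = k then 1 else 0) = (if i = k then 1 else 0)" for i
      by simp
    have "unit_vec n k \<bullet>c unit_vec n k = (1 :: complex)"
      using that by (subst cscalar_prod_sum[of _ n]) (simp_all add: e)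
    then have "(hnorm (Cn n) (unit_vec n k))\<^sup>2 = 1"
      using that Cn.hnorm_sq[of "unit_vec n k"] by simp
    ultimately show ?thesis by simp
  qed
  have N\<xi>: "(N ! j) (\<xi> k) \<in> carrier L" if "j < 2 * d" for j k using NB[OF that] \<xi> by simp
  have gram: "cinner L ((N ! j) (\<xi> k)) (\<xi> l) = F j $$ (l, k) / C" if j: "j < 2 * d" and k: "k < n" and l: "l < n" for j k l
  proof -
    have "cinner L ((N ! j) (\<xi> k)) (\<xi> l) = (Y ! j *\<^sub>v unit_vec n k) \<bullet>c unit_vec n l"
      unfolding \<xi>_def using dilV[OF j, of "unit_vec n k" "unit_vec n l"] j lenY by simp
    also have "\<dots> = (\<Sum>i<n. (Y ! j *\<^sub>v unit_vec n k) $ i * (if i = l then 1 else 0))"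
      using YM[OF j] l by (subst cscalar_prod_sum[of _ n]) (auto intro!: sum.cong)
    also have "\<dots> = (Y ! j *\<^sub>v unit_vec n k) $ l" by (rule sum_mult_delta[OF l])
    also have "\<dots> = (\<Sum>i<n. Y ! j $$ (l, i) * (if i = k then 1 else 0))"
      using YM[OF j] l k by (subst mult_mat_vec_index[of _ n]) (auto intro!: sum.cong)
    also have "\<dots> = Y ! j $$ (l, k)" by (rule sum_mult_delta[OF k])
    finally show ?thesis using FYj[OF j] YM[OF j] k l C by simp
  qed
  have FFe: "(\<Sum>i<n. F j $$ (k, i) * F l $$ (i, r)) + (\<Sum>i<n. F l $$ (k, i) * F j $$ (i, r))
      = (if j = l then 2 * (if k = r then 1 else 0) else 0)"
    if j: "j < 2 * d" and l: "l < 2 * d" and k: "k < n" and r: "r < n" for j l k r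
  proof -
    have "(F j * F l + F l * F j) $$ (k, r) = (if j = l then 2 * (if k = r then 1 else 0) else 0)"
      unfolding FF[OF j l] using k r by simp
    then show ?thesis using FM[OF j] FM[OF l] k r by (simp add: scalar_prod_def atLeast0LessThan)
  qed
  define I where "I = {..<2 * d} \<times> {..<n}"
  have I: "finite I" by (simp add: I_def)
  define f where "f i a = cnj (F (fst a) $$ (i, snd a)) \<odot>\<^bsub>L\<^esub> (N ! fst a) (\<xi> (snd a))" for i a
  have f: "f i a \<in> carrier L" if "a \<in> I" for i a using that N\<xi> by (auto simp: f_def I_def)
  define \<eta> where "\<eta> i = finsum L (f i) I" for i
  have \<eta>: "\<eta> i \<in> carrier L" for i unfolding \<eta>_def by (rule L.finsum_in[OF f])
  have S1: "(\<Sum>i<n. cinner L (\<eta> i) (\<xi> i)) = of_nat (2 * d * n) / C"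
  proof -
    have "cinner L (\<eta> i) (\<xi> i) = (\<Sum>j<2*d. \<Sum>k<n. cnj (F j $$ (i, k)) * F j $$ (i, k)) / C" if i: "i < n" for i
    proof -
      have "cinner L (\<eta> i) (\<xi> i) = (\<Sum>a\<in>I. cinner L (f i a) (\<xi> i))"
        unfolding \<eta>_def using I f \<xi> by (intro L.cinner_finsum_left)
      also have "\<dots> = (\<Sum>(j, k)\<in>I. cnj (F j $$ (i, k)) * F j $$ (i, k) / C)"
        using N\<xi> \<xi> i by (intro sum.cong refl) (auto simp: f_def I_def L.ip_simps gram)
      finally show ?thesis by (simp add: I_def sum.cartesian_product sum_divide_distrib case_prod_unfold)
    qed
    then have "(\<Sum>i<n. cinner L (\<eta> i) (\<xi> i)) = (\<Sum>i<n. \<Sum>j<2*d. \<Sum>k<n. cnj (F j $$ (i, k)) * F j $$ (i, k)) / C"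
      by (simp add: sum_divide_distrib)
    also have "(\<Sum>i<n. \<Sum>j<2*d. \<Sum>k<n. cnj (F j $$ (i, k)) * F j $$ (i, k)) = (\<Sum>i<n. \<Sum>j<2*d. 1)"
    proof (intro sum.cong refl)
      fix i j assume "i \<in> {..<n}" "j \<in> {..<2 * d}"
      then have i: "i < n" and j: "j < 2 * d" by auto
      \<comment> \<open>As \<open>F j\<close> is Hermitian, this is the diagonal entry
        \<open>(i, i)\<close> of its square, hence 1.\<close>
      have "(\<Sum>k<n. cnj (F j $$ (i, k)) * F j $$ (i, k)) = (\<Sum>k<n. F j $$ (i, k) * F j $$ (k, i))"
        using Fh[OF j i] Fh[OF j _ i] by (intro sum.cong refl) (metis lessThan_iff mult.commute)
      then show "(\<Sum>k<n. cnj (F j $$ (i, k)) * F j $$ (i, k)) = 1" using FFe[OF j j i i] by simp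
    qed
    finally show ?thesis by (simp add: mult.commute)
  qed
  define g where "g k r j l = cinner L ((N ! j) (\<xi> k)) ((N ! l) (\<xi> r))" for k r j l
  have S2: "(\<Sum>i<n. cinner L (\<eta> i) (\<eta> i)) = (\<Sum>k<n. \<Sum>j<2*d. g k k j j)"
  proof -
    have "cinner L (\<eta> i) (\<eta> i) = (\<Sum>k<n. \<Sum>r<n. \<Sum>j<2*d. \<Sum>l<2*d. (F j $$ (k, i) * F l $$ (i, r)) * g k r j l)"
      if i: "i < n" for i
    proof -
      have "cinner L (\<eta> i) (\<eta> i) = (\<Sum>a\<in>I. cinner L (f i a) (\<eta> i))"
        using I f \<eta> by (subst (1) \<eta>_def, intro L.cinner_finsum_left)
      also have "\<dots> = (\<Sum>a\<in>I. \<Sum>b\<in>I. cinner L (f i a) (f i b))"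
        unfolding \<eta>_def using I f by (intro sum.cong refl L.cinner_finsum_right)
      also have "\<dots> = (\<Sum>(j, k)\<in>I. \<Sum>(l, r)\<in>I. (F j $$ (k, i) * F l $$ (i, r)) * g k r j l)"
      proof (intro sum.cong refl, clarify, intro sum.cong refl, clarify)
        fix j k l r assume "(j, k) \<in> I" "(l, r) \<in> I"
        then have j: "j < 2 * d" "k < n" "l < 2 * d" "r < n" by (auto simp: I_def)
        show "cinner L (f i (j, k)) (f i (l, r)) = (F j $$ (k, i) * F l $$ (i, r)) * g k r j l"
          using N\<xi>[OF j(1)] N\<xi>[OF j(3)] Fh[OF j(1,2) i] by (simp add: f_def g_def L.ip_simps)
      qed
      also have "\<dots> = (\<Sum>j<2*d. \<Sum>k<n. \<Sum>l<2*d. \<Sum>r<n. (F j $$ (k, i) * F l $$ (i, r)) * g k r j l)"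
        unfolding I_def sum.cartesian_product[symmetric] ..
      also have "\<dots> = (\<Sum>k<n. \<Sum>j<2*d. \<Sum>r<n. \<Sum>l<2*d. (F j $$ (k, i) * F l $$ (i, r)) * g k r j l)"
        by (rule trans[OF sum.swap], rule sum.cong[OF refl], rule sum.cong[OF refl], rule sum.swap)
      also have "\<dots> = (\<Sum>k<n. \<Sum>r<n. \<Sum>j<2*d. \<Sum>l<2*d. (F j $$ (k, i) * F l $$ (i, r)) * g k r j l)"
        by (rule sum.cong[OF refl], rule sum.swap)
      finally show ?thesis .
    qed
    then have "(\<Sum>i<n. cinner L (\<eta> i) (\<eta> i)) = (\<Sum>i<n. \<Sum>k<n. \<Sum>r<n. \<Sum>j<2*d. \<Sum>l<2*d. (F j $$ (k, i) * F l $$ (i, r)) * g k r j l)"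
      by simp
    also have "\<dots> = (\<Sum>k<n. \<Sum>r<n. \<Sum>j<2*d. \<Sum>l<2*d. \<Sum>i<n. (F j $$ (k, i) * F l $$ (i, r)) * g k r j l)"
      by (rule trans[OF sum.swap], rule sum.cong[OF refl], rule trans[OF sum.swap], rule sum.cong[OF refl],
          rule trans[OF sum.swap], rule sum.cong[OF refl], rule sum.swap)
    also have "\<dots> = (\<Sum>k<n. \<Sum>r<n. \<Sum>j<2*d. \<Sum>l<2*d. (\<Sum>i<n. F j $$ (k, i) * F l $$ (i, r)) * g k r j l)"
      by (simp add: sum_distrib_right)
    \<comment> \<open>Commutation on one factor meets anticommutation on the other:
      \<open>g k r j l\<close> is symmetric in \<open>j\<close> and \<open>l\<close> because the
      \<open>N ! j\<close> are self-adjoint and commute, so all mixed terms cancel.\<close>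
    also have "\<dots> = (\<Sum>k<n. \<Sum>r<n. (if k = r then 1 else 0) * (\<Sum>j<2*d. g k r j j))"
    proof (intro sum.cong refl)
      fix k r assume "k \<in> {..<n}" "r \<in> {..<n}"
      then have k: "k < n" and r: "r < n" by auto
      show "(\<Sum>j<2*d. \<Sum>l<2*d. (\<Sum>i<n. F j $$ (k, i) * F l $$ (i, r)) * g k r j l)
          = (if k = r then 1 else 0) * (\<Sum>j<2*d. g k r j j)"
      proof (rule sum_anticommuting)
        show "(\<Sum>i<n. F j $$ (k, i) * F l $$ (i, r)) + (\<Sum>i<n. F l $$ (k, i) * F j $$ (i, r))
            = (if j = l then 2 * (if k = r then 1 else 0) else 0)" if "j < 2 * d" "l < 2 * d" for j l
          by (rule FFe[OF that k r])
        show "g k r j l = g k r l j" if j: "j < 2 * d" and l: "l < 2 * d" for j l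
        proof -
          have "g k r j l = cinner L ((N ! l) ((N ! j) (\<xi> k))) (\<xi> r)"
            unfolding g_def by (rule sa'[OF l N\<xi>[OF j] \<xi>, symmetric])
          also have "\<dots> = cinner L ((N ! j) ((N ! l) (\<xi> k))) (\<xi> r)" by (simp only: Ncom[OF l j \<xi>])
          also have "\<dots> = g k r l j" unfolding g_def by (rule sa'[OF j N\<xi>[OF l] \<xi>])
          finally show ?thesis .
        qed
      qed
    qed
    also have "\<dots> = (\<Sum>k<n. \<Sum>r<n. if k = r then (\<Sum>j<2*d. g k r j j) else 0)"
      by (intro sum.cong refl) simp
    also have "\<dots> = (\<Sum>k<n. \<Sum>j<2*d. g k k j j)" by simp
    finally show ?thesis .
  qed
  have S2': "Re (\<Sum>i<n. cinner L (\<eta> i) (\<eta> i)) \<le> real (n * d)"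
  proof -
    have "Re (\<Sum>j<2*d. g k k j j) \<le> real d" if k: "k < n" for k
    proof -
      \<comment> \<open>The induction consumes one disk at a time: the pair \<open>2 e\<close>,
        \<open>2 e + 1\<close> contributes at most 1, so that the total is \<open>d\<close> and not
        \<open>2 d\<close>.\<close>
      have "Re (\<Sum>j<2*e. g k k j j) \<le> real e" if "e \<le> d" for e
        using that
      proof (induction e)
        case (Suc e)
        have "Re (g k k (2 * e) (2 * e)) + Re (g k k (2 * e + 1) (2 * e + 1)) \<le> 1"
          using pair[of e "\<xi> k"] Suc.prems \<xi> N\<xi>[of "2 * e" k] N\<xi>[of "2 * e + 1" k] \<xi>1[OF k]
          by (simp add: g_def L.hnorm_sq)
        then show ?case using Suc by simp
      qed simp
      then show ?thesis by simp
    qed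
    then have "(\<Sum>k<n. Re (\<Sum>j<2*d. g k k j j)) \<le> (\<Sum>k<n. real d)" by (intro sum_mono) simp
    then show ?thesis unfolding S2 by simp
  qed
  \<comment> \<open>\<open>t\<close> is the inner product \<open>2 d n / C\<close> divided by the
    total squared norm \<open>n\<close> of the \<open>\<xi> i\<close>, the coefficient of the
    orthogonal projection. The expansion that follows is the Cauchy-Schwarz inequality in the direct
    sum of \<open>n\<close> copies of \<open>L\<close>.\<close>
  define t where "t = 2 * real d / C"
  have "0 \<le> (\<Sum>i<n. Re (cinner L (\<eta> i \<ominus>\<^bsub>L\<^esub> complex_of_real t \<odot>\<^bsub>L\<^esub> \<xi> i) (\<eta> i \<ominus>\<^bsub>L\<^esub> complex_of_real t \<odot>\<^bsub>L\<^esub> \<xi> i)))"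
    using \<eta> \<xi> by (intro sum_nonneg L.cinner_self_ge) simp
  also have "\<dots> = (\<Sum>i<n. Re (cinner L (\<eta> i) (\<eta> i)) - 2 * t * Re (cinner L (\<eta> i) (\<xi> i)) + t\<^sup>2)"
  proof (intro sum.cong refl)
    fix i assume "i \<in> {..<n}"
    then have i: "i < n" by simp
    have "Re (cinner L (\<xi> i) (\<eta> i)) = Re (cinner L (\<eta> i) (\<xi> i))"
      using L.cinner_commute[OF \<eta> \<xi>, of i i] by simp
    moreover have "Re (cinner L (\<xi> i) (\<xi> i)) = 1" using \<xi>1[OF i] L.hnorm_sq[OF \<xi>] by simp
    ultimately show "Re (cinner L (\<eta> i \<ominus>\<^bsub>L\<^esub> complex_of_real t \<odot>\<^bsub>L\<^esub> \<xi> i) (\<eta> i \<ominus>\<^bsub>L\<^esub> complex_of_real t \<odot>\<^bsub>L\<^esub> \<xi> i))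
        = Re (cinner L (\<eta> i) (\<eta> i)) - 2 * t * Re (cinner L (\<eta> i) (\<xi> i)) + t\<^sup>2"
      using \<eta> \<xi> by (simp add: L.ip_simps power2_eq_square algebra_simps)
  qed
  also have "\<dots> = Re (\<Sum>i<n. cinner L (\<eta> i) (\<eta> i)) - 2 * t * Re (\<Sum>i<n. cinner L (\<eta> i) (\<xi> i)) + real n * t\<^sup>2"
    by (simp add: sum.distrib sum_subtractf sum_distrib_left)
  also have "Re (\<Sum>i<n. cinner L (\<eta> i) (\<xi> i)) = real n * t"
    unfolding S1 by (simp add: t_def Re_divide_of_real)
  also have "Re (\<Sum>i<n. cinner L (\<eta> i) (\<eta> i)) - 2 * t * (real n * t) + real n * t\<^sup>2 \<le> real n * (real d - t\<^sup>2)"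
    using S2' by (simp add: algebra_simps power2_eq_square)
  finally have "t\<^sup>2 \<le> real d" using n by (simp add: zero_le_mult_iff)
  then have "4 * (real d * real d) \<le> real d * C\<^sup>2"
    using C by (simp add: t_def field_simps power2_eq_square)
  then have "(2 * sqrt (real d))\<^sup>2 \<le> C\<^sup>2" using d by (simp add: power_mult_distrib)
  then show ?thesis by (rule power2_le_imp_le) (use C in simp)
qed

text \<open>The inclusion is witnessed by dilation spaces in \<open>nat => complex\<close>, whereas
  optimality holds for an arbitrary carrier type \<open>'k\<close>: enlarging the universe of
  dilation spaces cannot improve the constant.\<close>

theorem corollary6p11:
  fixes d :: nat
  assumes "d \<ge> 1"
  shows
    "W_max (2 * d) (closed_polydisk d)
       \<subseteq> scale_tuples (2 * sqrt (real d))
            (W_min TYPE(nat \<Rightarrow> complex) (2 * d) (closed_polydisk d))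
     \<and> (\<forall>C::real. C > 0 \<longrightarrow>
          W_max (2 * d) (closed_polydisk d)
            \<subseteq> scale_tuples C (W_min TYPE('k) (2 * d) (closed_polydisk d)) \<longrightarrow>
          2 * sqrt (real d) \<le> C)
     \<and> (\<forall>(H :: 'a cinner_space) T.
          hilbert_space H \<longrightarrow> length T = d \<longrightarrow> (\<forall>S\<in>set T. contraction H S) \<longrightarrow>
          (\<exists>(K :: (nat \<Rightarrow> 'a) cinner_space) N.
             hilbert_space K \<and> normal_tuple K N \<and> dilation H K T N \<and>
             (\<forall>S\<in>set N. op_norm K K S \<le> min (real d) (2 * sqrt (real d)))))"
proof (intro conjI allI impI)
  show "W_max (2 * d) (closed_polydisk d) \<subseteq> scale_tuples (2 * sqrt (real d))
      (W_min TYPE(nat \<Rightarrow> complex) (2 * d) (closed_polydisk d))"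
    by (rule W_max_subset_scaled_W_min[OF assms])
  show "2 * sqrt (real d) \<le> C" if "C > 0" "W_max (2 * d) (closed_polydisk d)
      \<subseteq> scale_tuples C (W_min TYPE('k) (2 * d) (closed_polydisk d))" for C
    by (rule scale_ge_2_sqrt[OF assms that])
  show "\<exists>(K :: (nat \<Rightarrow> 'a) cinner_space) N. hilbert_space K \<and> normal_tuple K N \<and> dilation H K T N \<and>
      (\<forall>S\<in>set N. op_norm K K S \<le> min (real d) (2 * sqrt (real d)))"
    if "hilbert_space H" "length T = d" "\<forall>S\<in>set T. contraction H S" for H :: "'a cinner_space" and T
    using hilbert_space.ex_normal_dilation[OF that(1) assms that(2)] that(3) by blast
qed

end
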